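(* Let $G$ be a group generated by a finite symmetric set $X$ and hyperbolic relative to a collection of subgroups $\mathcal{H}=\{H_i\}_{i=1}^m$. For any pair of relatively quasiconvex subgroups $Q_1,Q_2$ of $G$ and any maximal parabolic subgroup $P$ of $G$ such that $R:=Q_1\cap P=Q_2\cap P$, there is a constant $C=C(Q_1,Q_2,P)\geq0$ with the following property. If $h\in P$ is such that 1. $hRh^{-1}=R$, and 2. $|g|_X\geq C$ for any $g\in RhR$, then the natural homomorphism $$Q_1\ast_R hQ_2h^{-1}\longrightarrow G$$ (induced by the inclusions $Q_1\to G$ and $hQ_2h^{-1}\to G$) is injective and its image $\langle Q_1\cup hQ_2h^{-1}\rangle$ is a relatively quasiconvex subgroup of $G$. Moreover, every parabolic subgroup of $G$ contained in $\langle Q_1\cup hQ_2h^{-1}\rangle$ is conjugate, by an element of $\langle Q_1\cup hQ_2h^{-1}\rangle$, either to a subgroup of $Q_1$ or to a subgroup of $hQ_2h^{-1}$.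
   Context: Setting. $G$ is a group, $X$ a finite generating set of $G$ closed under inverses, $\mathcal{H}=\{H_i\}_{i=1}^m$ a finite collection of subgroups. $|g|_X$ is the word length and $dist_X(f,g)=|f^{-1}g|_X$. Let $\widetilde{\mathcal{H}}=\bigsqcup_{i=1}^m(\widetilde{H_i}\setminus\{1\})$, where $\widetilde{H_i}$ is a copy of $H_i$, and let $\Gamma=Cayley(G,X\cup\widetilde{\mathcal{H}})$ be the graph with vertex set $G$ and, for each $g\in G$ and each letter $a\in X\sqcup\widetilde{\mathcal{H}}$, an edge from $g$ to $ga$ with label $a$; all edges have length 1. For a path $p$, $p_-$ and $p_+$ are its initial and terminal vertices and $l(p)$ its length. A path $p$ is a $(\lambda,c)$-quasi-geodesic if $l(q)\leq\lambda d(q_-,q_+)+c$ for every subpath $q$ of $p$, $d$ being the metric of $\Gamma$. Components. An $H_i$-component of a path $q$ in $\Gamma$ is a maximal subpath with at least one edge whose label is a word in the alphabet $\widetilde{H_i}\setminus\{1\}$; an $\mathcal{H}$-component is an $H_i$-component for some $i$. Two $\mathcal{H}$-components (of one path or of two paths) are connected if, for some $i$, both are $H_i$-components and their vertices belong to the same left coset of $H_i$. An $\mathcal{H}$-component of $q$ is isolated if it is not connected to a different $\mathcal{H}$-component of $q$. A path is without backtracking if all its $\mathcal{H}$-components are isolated. A vertex of $q$ is phase if it is not an inner vertex of an $\mathcal{H}$-component of $q$. Two paths $p,q$ are $k$-similar if $\max\{dist_X(p_-,q_-),dist_X(p_+,q_+)\}\leq k$. Bounded coset penetration (BCP). $(G,\mathcal{H})$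 satisfies BCP if for all $\lambda\geq1$, $c\geq0$, $k\geq0$ there is an integer $\epsilon(\lambda,c,k)>0$ such that for any two $k$-similar $(\lambda,c)$-quasi-geodesics $p,q$ in $\Gamma$ without backtracking: (i) the sets of phase vertices of $p$ and $q$ are contained in the closed $\epsilon(\lambda,c,k)$-neighborhoods of each other with respect to $dist_X$; (ii) if $s$ is an $\mathcal{H}$-component of $p$ with $dist_X(s_-,s_+)>\epsilon(\lambda,c,k)$, then some $\mathcal{H}$-component of $q$ is connected to $s$; (iii) if $s,t$ are connected $\mathcal{H}$-components of $p,q$ respectively, then $\max\{dist_X(s_-,t_-),dist_X(s_+,t_+)\}\leq\epsilon(\lambda,c,k)$. $G$ is hyperbolic relative to $\mathcal{H}$ if $\Gamma$ is a $\delta$-hyperbolic metric space for some $\delta\ge 0$ and $(G,\mathcal{H})$ satisfies BCP. A subgroup $Q\leq G$ is relatively quasiconvex if there is $\sigma\geq0$ (and then $Q$ is called $\sigma$-quasiconvex) such that for all $f,g\in Q$, every geodesic $p$ in $\Gamma$ from $f$ to $g$ and every vertex $v$ of $p$, there is $w\in Q$ with $dist_X(v,w)\leq\sigma$. A subgroup of $G$ is parabolic if it can be conjugated in $G$ into one of the subgroups in $\mathcal{H}$; a maximal parabolic subgroup of $G$ is a parabolic subgroup not properly contained in another parabolic subgroup. *)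

theory Defs
  imports Complex_Main "HOL-Algebra.Generated_Groups"
begin

section \<open>Word length\<close>

definition word_length :: "('a, 'b) monoid_scheme \<Rightarrow> 'a set \<Rightarrow> 'a \<Rightarrow> nat" where
  "word_length G X g =
     (LEAST n. \<exists>w. set w \<subseteq> X \<and> length w = n \<and> foldl (\<otimes>\<^bsub>G\<^esub>) \<one>\<^bsub>G\<^esub> w = g)"

definition word_dist :: "('a, 'b) monoid_scheme \<Rightarrow> 'a set \<Rightarrow> 'a \<Rightarrow> 'a \<Rightarrow> nat" where
  "word_dist G X f g = word_length G X (inv\<^bsub>G\<^esub> f \<otimes>\<^bsub>G\<^esub> g)"

section \<open>The relative Cayley graph\<close>

text \<open>The alphabet is the disjoint union of \<open>X\<close> and the copies of the \<open>H i - {1}\<close>, so letters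
  carry a tag: different letters may represent the same element of the group. The subgroups are
  \<open>H 1, \<dots>, H m\<close>; the values of \<open>H\<close> outside \<open>{1..m}\<close> are irrelevant.\<close>

datatype 'a letter = XLet 'a | HLet nat 'a

primrec letter_val :: "'a letter \<Rightarrow> 'a" where
  "letter_val (XLet x) = x"
| "letter_val (HLet i x) = x"

definition alphabet ::
  "('a, 'b) monoid_scheme \<Rightarrow> 'a set \<Rightarrow> (nat \<Rightarrow> 'a set) \<Rightarrow> nat \<Rightarrow> 'a letter set" where
  "alphabet G X H m = XLet ` X \<union> (\<Union>i\<in>{1..m}. HLet i ` (H i - {\<one>\<^bsub>G\<^esub>}))"

text \<open>A path is given by its initial vertex and its label. An edge with label \<open>a\<close> is traversed
  backwards by the edge whose label is the letter inverse to \<open>a\<close>.\<close>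

type_synonym 'a cpath = "'a \<times> 'a letter list"

definition is_path ::
  "('a, 'b) monoid_scheme \<Rightarrow> 'a set \<Rightarrow> (nat \<Rightarrow> 'a set) \<Rightarrow> nat \<Rightarrow> 'a cpath \<Rightarrow> bool" where
  "is_path G X H m p \<longleftrightarrow> fst p \<in> carrier G \<and> set (snd p) \<subseteq> alphabet G X H m"

definition path_length :: "'a cpath \<Rightarrow> nat" where
  "path_length p = length (snd p)"

definition path_vertex :: "('a, 'b) monoid_scheme \<Rightarrow> 'a cpath \<Rightarrow> nat \<Rightarrow> 'a" where
  "path_vertex G p n = foldl (\<lambda>g a. g \<otimes>\<^bsub>G\<^esub> letter_val a) (fst p) (take n (snd p))"

definition path_start :: "('a, 'b) monoid_scheme \<Rightarrow> 'a cpath \<Rightarrow> 'a" where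
  "path_start G p = path_vertex G p 0"

definition path_end :: "('a, 'b) monoid_scheme \<Rightarrow> 'a cpath \<Rightarrow> 'a" where
  "path_end G p = path_vertex G p (path_length p)"

definition subpath :: "('a, 'b) monoid_scheme \<Rightarrow> 'a cpath \<Rightarrow> nat \<Rightarrow> nat \<Rightarrow> 'a cpath" where
  "subpath G p j k = (path_vertex G p j, take (k - j) (drop j (snd p)))"

definition graph_dist ::
  "('a, 'b) monoid_scheme \<Rightarrow> 'a set \<Rightarrow> (nat \<Rightarrow> 'a set) \<Rightarrow> nat \<Rightarrow> 'a \<Rightarrow> 'a \<Rightarrow> nat" where
  "graph_dist G X H m f g =
     (LEAST n. \<exists>p. is_path G X H m p \<and> path_start G p = f \<and> path_end G p = g \<and> path_length p = n)"

definition geodesic_path ::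
  "('a, 'b) monoid_scheme \<Rightarrow> 'a set \<Rightarrow> (nat \<Rightarrow> 'a set) \<Rightarrow> nat \<Rightarrow> 'a cpath \<Rightarrow> bool" where
  "geodesic_path G X H m p \<longleftrightarrow> is_path G X H m p \<and>
     path_length p = graph_dist G X H m (path_start G p) (path_end G p)"

definition quasi_geodesic ::
  "('a, 'b) monoid_scheme \<Rightarrow> 'a set \<Rightarrow> (nat \<Rightarrow> 'a set) \<Rightarrow> nat \<Rightarrow> real \<Rightarrow> real \<Rightarrow> 'a cpath \<Rightarrow> bool"
where
  "quasi_geodesic G X H m lam c p \<longleftrightarrow> is_path G X H m p \<and>
     (\<forall>j k. j \<le> k \<and> k \<le> path_length p \<longrightarrow>
       (let q = subpath G p j k in
         real (path_length q) \<le> lam * real (graph_dist G X H m (path_start G q) (path_end G q)) + c))"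

section \<open>The Cayley graph as a metric space, hyperbolicity\<close>

text \<open>Besides the vertices, the points of the graph are the points at distance \<open>t\<close>,
  \<open>0 < t < 1\<close>, from the initial vertex of the edge that starts at \<open>g\<close> and has label \<open>a\<close>.\<close>

datatype 'a gpoint = Vertex 'a | EdgePoint 'a "'a letter" real

definition graph_points ::
  "('a, 'b) monoid_scheme \<Rightarrow> 'a set \<Rightarrow> (nat \<Rightarrow> 'a set) \<Rightarrow> nat \<Rightarrow> 'a gpoint set" where
  "graph_points G X H m = Vertex ` carrier G \<union>
     {EdgePoint g a t | g a t. g \<in> carrier G \<and> a \<in> alphabet G X H m \<and> 0 < t \<and> t < 1}"

text \<open>The vertices at which one can leave the closed edge of a point, with the distance to the
  point inside the edge.\<close>

primrec exits :: "('a, 'b) monoid_scheme \<Rightarrow> 'a gpoint \<Rightarrow> ('a \<times> real) set" where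
  "exits G (Vertex g) = {(g, 0)}"
| "exits G (EdgePoint g a t) = {(g, t), (g \<otimes>\<^bsub>G\<^esub> letter_val a, 1 - t)}"

text \<open>The length metric: the shortest way either passes through vertices or stays in one edge.\<close>

definition point_dist ::
  "('a, 'b) monoid_scheme \<Rightarrow> 'a set \<Rightarrow> (nat \<Rightarrow> 'a set) \<Rightarrow> nat \<Rightarrow> 'a gpoint \<Rightarrow> 'a gpoint \<Rightarrow> real" where
  "point_dist G X H m x y = Min
     ((\<lambda>((u, r), (v, s)). r + real (graph_dist G X H m u v) + s) ` (exits G x \<times> exits G y) \<union>
      {\<bar>s - t\<bar> | g a s t. x = EdgePoint g a s \<and> y = EdgePoint g a t})"

definition geodesic_segment ::
  "'p set \<Rightarrow> ('p \<Rightarrow> 'p \<Rightarrow> real) \<Rightarrow> 'p \<Rightarrow> 'p \<Rightarrow> 'p set \<Rightarrow> bool" where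
  "geodesic_segment M d x y S \<longleftrightarrow> (\<exists>\<gamma> L. 0 \<le> L \<and> \<gamma> ` {0..L} = S \<and> S \<subseteq> M \<and> \<gamma> 0 = x \<and> \<gamma> L = y \<and>
     (\<forall>s\<in>{0..L}. \<forall>t\<in>{0..L}. d (\<gamma> s) (\<gamma> t) = \<bar>s - t\<bar>))"

text \<open>Slim triangles; the condition on one side suffices, since the sides can be permuted.\<close>

definition delta_hyperbolic :: "'p set \<Rightarrow> ('p \<Rightarrow> 'p \<Rightarrow> real) \<Rightarrow> real \<Rightarrow> bool" where
  "delta_hyperbolic M d \<delta> \<longleftrightarrow>
     (\<forall>x\<in>M. \<forall>y\<in>M. \<forall>z\<in>M. \<forall>S T U.
        geodesic_segment M d x y S \<and> geodesic_segment M d y z T \<and> geodesic_segment M d z x U \<longrightarrow>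
        (\<forall>p\<in>S. \<exists>q\<in>T \<union> U. d p q \<le> \<delta>))"

section \<open>Components and bounded coset penetration\<close>

text \<open>A subpath of \<open>q\<close> is represented by the pair \<open>(j, k)\<close> of the positions of its endpoints;
  \<open>q\<close> may run through the same edge several times.\<close>

definition H_subpath :: "nat \<Rightarrow> 'a cpath \<Rightarrow> nat \<times> nat \<Rightarrow> bool" where
  "H_subpath i q s \<longleftrightarrow> fst s < snd s \<and> snd s \<le> path_length q \<and>
     (\<forall>n\<in>{fst s..<snd s}. \<exists>a. snd q ! n = HLet i a)"

definition H_component :: "nat \<Rightarrow> 'a cpath \<Rightarrow> nat \<times> nat \<Rightarrow> bool" where
  "H_component i q s \<longleftrightarrow> H_subpath i q s \<and>
     (\<forall>t. H_subpath i q t \<and> fst t \<le> fst s \<and> snd s \<le> snd t \<longrightarrow> t = s)"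

definition component :: "nat \<Rightarrow> 'a cpath \<Rightarrow> nat \<times> nat \<Rightarrow> bool" where
  "component m q s \<longleftrightarrow> (\<exists>i\<in>{1..m}. H_component i q s)"

definition connected_components ::
  "('a, 'b) monoid_scheme \<Rightarrow> (nat \<Rightarrow> 'a set) \<Rightarrow> nat \<Rightarrow>
   'a cpath \<Rightarrow> nat \<times> nat \<Rightarrow> 'a cpath \<Rightarrow> nat \<times> nat \<Rightarrow> bool" where
  "connected_components G H m p s q t \<longleftrightarrow>
     (\<exists>i\<in>{1..m}. H_component i p s \<and> H_component i q t \<and>
       (\<exists>g\<in>carrier G. path_vertex G p ` {fst s..snd s} \<union> path_vertex G q ` {fst t..snd t}
          \<subseteq> g <#\<^bsub>G\<^esub> H i))"

definition isolated ::
  "('a, 'b) monoid_scheme \<Rightarrow> (nat \<Rightarrow> 'a set) \<Rightarrow> nat \<Rightarrow> 'a cpath \<Rightarrow> nat \<times> nat \<Rightarrow> bool" where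
  "isolated G H m q s \<longleftrightarrow>
     \<not> (\<exists>t. component m q t \<and> t \<noteq> s \<and> connected_components G H m q s q t)"

definition without_backtracking ::
  "('a, 'b) monoid_scheme \<Rightarrow> (nat \<Rightarrow> 'a set) \<Rightarrow> nat \<Rightarrow> 'a cpath \<Rightarrow> bool" where
  "without_backtracking G H m q \<longleftrightarrow> (\<forall>s. component m q s \<longrightarrow> isolated G H m q s)"

definition phase_vertices :: "('a, 'b) monoid_scheme \<Rightarrow> nat \<Rightarrow> 'a cpath \<Rightarrow> 'a set" where
  "phase_vertices G m q = path_vertex G q `
     {n. n \<le> path_length q \<and> \<not> (\<exists>s. component m q s \<and> fst s < n \<and> n < snd s)}"

definition similar ::
  "('a, 'b) monoid_scheme \<Rightarrow> 'a set \<Rightarrow> real \<Rightarrow> 'a cpath \<Rightarrow> 'a cpath \<Rightarrow> bool" where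
  "similar G X k p q \<longleftrightarrow>
     real (max (word_dist G X (path_start G p) (path_start G q))
               (word_dist G X (path_end G p) (path_end G q))) \<le> k"

definition BCP :: "('a, 'b) monoid_scheme \<Rightarrow> 'a set \<Rightarrow> (nat \<Rightarrow> 'a set) \<Rightarrow> nat \<Rightarrow> bool" where
  "BCP G X H m \<longleftrightarrow> (\<forall>lam\<ge>1. \<forall>c\<ge>0. \<forall>k\<ge>0. \<exists>\<epsilon>::nat. 0 < \<epsilon> \<and>
     (\<forall>p q. quasi_geodesic G X H m lam c p \<and> quasi_geodesic G X H m lam c q \<and>
            without_backtracking G H m p \<and> without_backtracking G H m q \<and> similar G X k p q \<longrightarrow>
        ((\<forall>u\<in>phase_vertices G m p. \<exists>v\<in>phase_vertices G m q. word_dist G X u v \<le> \<epsilon>) \<and>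
         (\<forall>v\<in>phase_vertices G m q. \<exists>u\<in>phase_vertices G m p. word_dist G X v u \<le> \<epsilon>)) \<and>
        (\<forall>s. component m p s \<and>
             \<epsilon> < word_dist G X (path_vertex G p (fst s)) (path_vertex G p (snd s)) \<longrightarrow>
             (\<exists>t. component m q t \<and> connected_components G H m p s q t)) \<and>
        (\<forall>s t. component m p s \<and> component m q t \<and> connected_components G H m p s q t \<longrightarrow>
             max (word_dist G X (path_vertex G p (fst s)) (path_vertex G q (fst t)))
                 (word_dist G X (path_vertex G p (snd s)) (path_vertex G q (snd t))) \<le> \<epsilon>)))"

section \<open>Relatively hyperbolic groups and their subgroups\<close>

definition relatively_hyperbolic ::
  "('a, 'b) monoid_scheme \<Rightarrow> 'a set \<Rightarrow> (nat \<Rightarrow> 'a set) \<Rightarrow> nat \<Rightarrow> bool" where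
  "relatively_hyperbolic G X H m \<longleftrightarrow>
     (\<exists>\<delta>\<ge>0. delta_hyperbolic (graph_points G X H m) (point_dist G X H m) \<delta>) \<and> BCP G X H m"

definition quasiconvex ::
  "('a, 'b) monoid_scheme \<Rightarrow> 'a set \<Rightarrow> (nat \<Rightarrow> 'a set) \<Rightarrow> nat \<Rightarrow> real \<Rightarrow> 'a set \<Rightarrow> bool" where
  "quasiconvex G X H m \<sigma> Q \<longleftrightarrow>
     (\<forall>f\<in>Q. \<forall>g\<in>Q. \<forall>p. geodesic_path G X H m p \<and> path_start G p = f \<and> path_end G p = g \<longrightarrow>
        (\<forall>n\<le>path_length p. \<exists>w\<in>Q. real (word_dist G X (path_vertex G p n) w) \<le> \<sigma>))"

definition relatively_quasiconvex ::
  "('a, 'b) monoid_scheme \<Rightarrow> 'a set \<Rightarrow> (nat \<Rightarrow> 'a set) \<Rightarrow> nat \<Rightarrow> 'a set \<Rightarrow> bool" where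
  "relatively_quasiconvex G X H m Q \<longleftrightarrow> subgroup Q G \<and> (\<exists>\<sigma>\<ge>0. quasiconvex G X H m \<sigma> Q)"

definition conj_set :: "('a, 'b) monoid_scheme \<Rightarrow> 'a \<Rightarrow> 'a set \<Rightarrow> 'a set" where
  "conj_set G g S = g <#\<^bsub>G\<^esub> S #>\<^bsub>G\<^esub> inv\<^bsub>G\<^esub> g"

definition parabolic :: "('a, 'b) monoid_scheme \<Rightarrow> (nat \<Rightarrow> 'a set) \<Rightarrow> nat \<Rightarrow> 'a set \<Rightarrow> bool" where
  "parabolic G H m P \<longleftrightarrow> subgroup P G \<and> (\<exists>g\<in>carrier G. \<exists>i\<in>{1..m}. conj_set G g P \<subseteq> H i)"

definition maximal_parabolic ::
  "('a, 'b) monoid_scheme \<Rightarrow> (nat \<Rightarrow> 'a set) \<Rightarrow> nat \<Rightarrow> 'a set \<Rightarrow> bool" where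
  "maximal_parabolic G H m P \<longleftrightarrow> parabolic G H m P \<and> \<not> (\<exists>P'. parabolic G H m P' \<and> P \<subset> P')"

section \<open>Amalgamated free products\<close>

text \<open>The amalgamated product of two groups \<open>A\<close> and \<open>B\<close> over a common subgroup \<open>R\<close>, as the group
  of words in the disjoint union of \<open>A\<close> and \<open>B\<close> modulo the congruence generated by the
  multiplication tables of \<open>A\<close> and \<open>B\<close> and the identification of the two copies of \<open>R\<close>.\<close>

definition amalgam_words ::
  "('a, 'b) monoid_scheme \<Rightarrow> ('a, 'c) monoid_scheme \<Rightarrow> ('a + 'a) list set" where
  "amalgam_words A B = lists (carrier A <+> carrier B)"

inductive_set amalgam_rel ::
  "('a, 'b) monoid_scheme \<Rightarrow> ('a, 'c) monoid_scheme \<Rightarrow> 'a set \<Rightarrow>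
   (('a + 'a) list \<times> ('a + 'a) list) set"
  for A B R where
  refl: "w \<in> amalgam_words A B \<Longrightarrow> (w, w) \<in> amalgam_rel A B R"
| sym: "(v, w) \<in> amalgam_rel A B R \<Longrightarrow> (w, v) \<in> amalgam_rel A B R"
| trans: "(u, v) \<in> amalgam_rel A B R \<Longrightarrow> (v, w) \<in> amalgam_rel A B R \<Longrightarrow> (u, w) \<in> amalgam_rel A B R"
| append: "(u, u') \<in> amalgam_rel A B R \<Longrightarrow> (v, v') \<in> amalgam_rel A B R \<Longrightarrow>
    (u @ v, u' @ v') \<in> amalgam_rel A B R"
| one_left: "([Inl \<one>\<^bsub>A\<^esub>], []) \<in> amalgam_rel A B R"
| one_right: "([Inr \<one>\<^bsub>B\<^esub>], []) \<in> amalgam_rel A B R"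
| mult_left: "x \<in> carrier A \<Longrightarrow> y \<in> carrier A \<Longrightarrow>
    ([Inl x, Inl y], [Inl (x \<otimes>\<^bsub>A\<^esub> y)]) \<in> amalgam_rel A B R"
| mult_right: "x \<in> carrier B \<Longrightarrow> y \<in> carrier B \<Longrightarrow>
    ([Inr x, Inr y], [Inr (x \<otimes>\<^bsub>B\<^esub> y)]) \<in> amalgam_rel A B R"
| glue: "r \<in> R \<Longrightarrow> ([Inl r], [Inr r]) \<in> amalgam_rel A B R"

definition amalgam ::
  "('a, 'b) monoid_scheme \<Rightarrow> ('a, 'c) monoid_scheme \<Rightarrow> 'a set \<Rightarrow> ('a + 'a) list set monoid" where
  "amalgam A B R =
     \<lparr>carrier = amalgam_words A B // amalgam_rel A B R,
      mult = \<lambda>S T. \<Union>u\<in>S. \<Union>v\<in>T. amalgam_rel A B R `` {u @ v},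
      one = amalgam_rel A B R `` {[]}\<rparr>"

primrec amalgam_eval ::
  "('d, 'e) monoid_scheme \<Rightarrow> ('a \<Rightarrow> 'd) \<Rightarrow> ('a \<Rightarrow> 'd) \<Rightarrow> ('a + 'a) list \<Rightarrow> 'd" where
  "amalgam_eval G f g [] = \<one>\<^bsub>G\<^esub>"
| "amalgam_eval G f g (x # w) = case_sum f g x \<otimes>\<^bsub>G\<^esub> amalgam_eval G f g w"

text \<open>The homomorphism to \<open>G\<close> induced by homomorphisms \<open>f\<close>, \<open>g\<close> on \<open>A\<close>, \<open>B\<close> that agree on \<open>R\<close>.\<close>

definition amalgam_lift ::
  "('d, 'e) monoid_scheme \<Rightarrow> ('a \<Rightarrow> 'd) \<Rightarrow> ('a \<Rightarrow> 'd) \<Rightarrow> ('a + 'a) list set \<Rightarrow> 'd" where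
  "amalgam_lift G f g S = the_elem (amalgam_eval G f g ` S)"

end

theory Submission
  imports Defs
begin

text \<open>
  \<^bold>\<open>Why the theorem holds.\<close> A maximal parabolic subgroup is a conjugate \<open>P = g H\<^sub>i g\<inverse>\<close>, so
  that \<open>t p g H\<^sub>i = t g H\<^sub>i\<close> for \<open>p \<in> P\<close>. Put
  \<open>F\<^sub>0 = Q\<^sub>1\<close>, \<open>F\<^sub>1 = h Q\<^sub>2 h\<inverse>\<close>, and consider a product of elements that are taken alternately from
  \<open>F\<^sub>0\<close> and \<open>F\<^sub>1\<close>, the inner ones outside \<open>R\<close>. Its partial products \<open>t\<^sub>0, t\<^sub>1, \<dots>\<close> determine the
  cosets \<open>C\<^sub>k = t\<^sub>k g H\<^sub>i\<close>; consecutive ones are disjoint because \<open>F\<^sub>b \<inter> P = R\<close>. The product can be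
  followed by a broken line that enters \<open>C\<^sub>k\<close> near a translate of one of \<open>Q\<^sub>1, Q\<^sub>2\<close> and leaves it near
  a translate of the other one, and between the two it has to jump by an element \<open>r h r'\<close> or
  \<open>r h\<inverse> r'\<close> with \<open>r, r' \<in> R\<close>, up to bounded errors (\<open>near_peripheral\<close>; the bound, from \<open>decomposes_exists\<close>, is due to
  the finiteness of balls in the word metric of \<open>X\<close>). So the second hypothesis on \<open>h\<close> says that all these jumps
  are long (\<open>far_apart\<close>).

  Long jumps force geodesics to follow the broken line. The reason is a contraction property of
  peripheral cosets. Call \<open>y \<in> C\<close> an entry of \<open>x\<close> into the coset \<open>C\<close> if some geodesic from \<open>x\<close>
  to \<open>y\<close> meets \<open>C\<close> only at \<open>y\<close>. There is a constant \<open>\<kappa>\<close> such that, whenever some geodesic from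
  \<open>x\<close> to \<open>x'\<close> avoids \<open>C\<close>, all entries of \<open>x\<close> and \<open>x'\<close> into \<open>C\<close> are at \<open>X\<close>-distance at most
  \<open>\<kappa>\<close> from each other (\<open>projection_constant_exists\<close>). Slim triangles
  reduce this to the claim that the ends of a detour of bounded length around \<open>C\<close> are close to each
  other, and that is a consequence of bounded coset penetration: a shortest detour does not
  backtrack, and it can be compared with the single edge that joins its ends (\<open>detour_bound\<close>).

  The contraction property propagates along a chain of cosets without any loss in the constant
  (\<open>entry_from_start\<close>): the geodesic from the start \<open>x\<close> to its entry \<open>c\<close> into \<open>C\<^sub>k\<^sub>+\<^sub>1\<close> has to cross \<open>C\<^sub>k\<close>, as
  the entries of \<open>x\<close> and \<open>c\<close> into \<open>C\<^sub>k\<close> are far apart, and from there on it shows \<open>c\<close> as an entry of a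
  point of \<open>C\<^sub>k\<close>. Hence every geodesic between the ends of the broken line crosses all cosets \<open>C\<^sub>k\<close>,
  in order, and within \<open>\<kappa>\<close> of the places where the broken line does (\<open>chain_geodesic\<close>).

  All three conclusions follow. Such a geodesic has at least as many edges as there are cosets
  (\<open>chain_length\<close>), so that a nontrivial normal form does not represent \<open>\<one>\<close> and the homomorphism is
  injective. Between two crossings the geodesic has its ends near a coset of \<open>Q\<^sub>1\<close> or
  \<open>Q\<^sub>2\<close> inside \<open>J\<close>, respectively \<open>J h\<close>, so it stays near it by the quasiconvexity of that subgroup
  (\<open>quasiconvex_stable\<close>) and \<open>J\<close> is quasiconvex. Finally the elements \<open>x\<close> of a parabolic subgroup
  have bounded length in the relative Cayley graph, hence bounded normal forms, so that the
  subgroup has a bounded orbit in the Bass-Serre tree of the amalgam and fixes a vertex;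
  \<open>bounded_subgroup_in_factor\<close> is an elementary version of this argument.
\<close>

section \<open>Word metrics and geodesics\<close>

context group begin

lemma mult_inv_cancel: "x \<in> carrier G \<Longrightarrow> y \<in> carrier G \<Longrightarrow> x \<otimes> (inv x \<otimes> y) = y"
  using m_assoc[of x "inv x" y] by simp

lemma inv_mult_cancel: "x \<in> carrier G \<Longrightarrow> y \<in> carrier G \<Longrightarrow> inv x \<otimes> (x \<otimes> y) = y"
  using m_assoc[of "inv x" x y] by simp

lemmas group_word_simps = m_assoc inv_mult_group mult_inv_cancel inv_mult_cancel

end

locale word_metric = group G for G (structure) +
  fixes S
  assumes S_carrier: "S \<subseteq> carrier G"
    and S_inv: "x \<in> S \<Longrightarrow> inv x \<in> S"
    and S_generates: "generate G S = carrier G"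
begin

abbreviation len :: "'a \<Rightarrow> nat" where "len \<equiv> word_length G S"
abbreviation dist :: "'a \<Rightarrow> 'a \<Rightarrow> nat" where "dist \<equiv> word_dist G S"
abbreviation word_prod :: "'a list \<Rightarrow> 'a" where "word_prod w \<equiv> foldl (\<otimes>) \<one> w"

lemma foldl_mult_closed:
  assumes "a \<in> carrier G" "set w \<subseteq> carrier G"
  shows "foldl (\<otimes>) a w \<in> carrier G"
  using assms by (induction w arbitrary: a) auto

lemma foldl_mult:
  assumes "a \<in> carrier G" "set w \<subseteq> carrier G"
  shows "foldl (\<otimes>) a w = a \<otimes> word_prod w"
  using assms(2)
proof (induction w rule: rev_induct)
  case (snoc x w)
  then show ?case
    using assms(1) foldl_mult_closed[of \<one> w] by (simp add: m_assoc)
qed (use assms(1) in simp)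

lemma word_prod_append:
  assumes "set v \<subseteq> carrier G" "set w \<subseteq> carrier G"
  shows "word_prod (v @ w) = word_prod v \<otimes> word_prod w"
  unfolding foldl_append using assms foldl_mult_closed[of \<one> v] by (intro foldl_mult) auto

lemma word_prod_closed: "set w \<subseteq> S \<Longrightarrow> word_prod w \<in> carrier G"
  using S_carrier foldl_mult_closed[of \<one> w] by auto

lemma word_exists:
  assumes "g \<in> carrier G"
  obtains w where "set w \<subseteq> S" "word_prod w = g"
proof -
  have "g \<in> generate G S" using assms S_generates by simp
  then have "\<exists>w. set w \<subseteq> S \<and> word_prod w = g"
  proof (induction rule: generate.induct)
    case one
    show ?case by (rule exI[of _ "[]"]) simp
  next
    case (incl h)
    then show ?case using S_carrier by (intro exI[of _ "[h]"]) auto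
  next
    case (inv h)
    then show ?case using S_carrier S_inv by (intro exI[of _ "[inv h]"]) auto
  next
    case (eng h1 h2)
    then obtain v w where "set v \<subseteq> S" "word_prod v = h1" "set w \<subseteq> S" "word_prod w = h2"
      by blast
    then show ?case
      using word_prod_append[of v w] S_carrier by (intro exI[of _ "v @ w"]) auto
  qed
  then show ?thesis using that by blast
qed

lemma len_le: "set w \<subseteq> S \<Longrightarrow> word_prod w = g \<Longrightarrow> len g \<le> length w"
  unfolding word_length_def by (rule Least_le) auto

lemma len_word:
  assumes "g \<in> carrier G"
  obtains w where "set w \<subseteq> S" "length w = len g" "word_prod w = g"
proof -
  obtain w where "set w \<subseteq> S" "word_prod w = g" using word_exists[OF assms] .
  then have "\<exists>n w. set w \<subseteq> S \<and> length w = n \<and> word_prod w = g" by blast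
  from LeastI_ex[OF this] show ?thesis
    unfolding word_length_def[symmetric] using that by blast
qed

lemma len_one [simp]: "len \<one> = 0"
  using len_le[of "[]" \<one>] by simp

lemma len_eq_0: "g \<in> carrier G \<Longrightarrow> len g = 0 \<longleftrightarrow> g = \<one>"
  by (metis foldl_Nil len_one len_word length_0_conv)

lemma len_mult_le:
  assumes "g \<in> carrier G" "h \<in> carrier G"
  shows "len (g \<otimes> h) \<le> len g + len h"
proof -
  obtain v where v: "set v \<subseteq> S" "length v = len g" "word_prod v = g" using len_word assms(1) .
  obtain w where w: "set w \<subseteq> S" "length w = len h" "word_prod w = h" using len_word assms(2) .
  have "word_prod (v @ w) = g \<otimes> h" using v w S_carrier by (subst word_prod_append) auto
  then show ?thesis using len_le[of "v @ w"] v w by auto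
qed

lemma len_inv_le:
  assumes "g \<in> carrier G"
  shows "len (inv g) \<le> len g"
proof -
  have "len (inv (word_prod w)) \<le> length w" if "set w \<subseteq> S" for w
    using that
  proof (induction w rule: rev_induct)
    case (snoc x w)
    then have "x \<in> S" "x \<in> carrier G" "word_prod w \<in> carrier G"
      using S_carrier word_prod_closed by auto
    moreover have "len (inv x) \<le> 1" using len_le[of "[inv x]"] S_inv[OF \<open>x \<in> S\<close>] S_carrier by auto
    ultimately show ?case
      using snoc len_mult_le[of "inv x" "inv (word_prod w)"] by (simp add: inv_mult_group)
  qed simp
  with len_word[OF assms] show ?thesis by metis
qed

lemma len_inv [simp]: "g \<in> carrier G \<Longrightarrow> len (inv g) = len g"
  using len_inv_le[of g] len_inv_le[of "inv g"] by simp

lemma len_generator: "x \<in> S \<Longrightarrow> len x \<le> 1"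
  using len_le[of "[x]" x] S_carrier by auto

lemma len_eq_1: 
  assumes "g \<in> carrier G" "len g = 1"
  shows "g \<in> S"
proof -
  obtain w where w: "set w \<subseteq> S" "length w = 1" "word_prod w = g" using len_word assms by metis
  then obtain x where "w = [x]" by (auto simp: length_Suc_conv)
  with w show ?thesis using S_carrier by auto
qed

lemma finite_ball:
  assumes "finite S"
  shows "finite {g \<in> carrier G. len g \<le> n}"
proof (rule finite_subset)
  show "{g \<in> carrier G. len g \<le> n} \<subseteq> word_prod ` {w. set w \<subseteq> S \<and> length w \<le> n}"
    by (auto, metis (mono_tags, lifting) image_eqI len_word mem_Collect_eq)
  show "finite (word_prod ` {w. set w \<subseteq> S \<and> length w \<le> n})"
    using finite_lists_length_le[OF assms] by auto
qed

lemma dist_translate: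
  assumes "g \<in> carrier G" "u \<in> carrier G" "v \<in> carrier G"
  shows "dist (g \<otimes> u) (g \<otimes> v) = dist u v"
proof -
  have "inv (g \<otimes> u) \<otimes> (g \<otimes> v) = inv u \<otimes> v"
    using assms by (simp add: group_word_simps)
  then show ?thesis by (simp add: word_dist_def)
qed

lemma dist_refl [simp]: "u \<in> carrier G \<Longrightarrow> dist u u = 0"
  by (simp add: word_dist_def)

lemma dist_eq_0: "u \<in> carrier G \<Longrightarrow> v \<in> carrier G \<Longrightarrow> dist u v = 0 \<longleftrightarrow> u = v"
  unfolding word_dist_def using mult_inv_cancel[of u v] by (subst len_eq_0) auto

lemma dist_sym: "u \<in> carrier G \<Longrightarrow> v \<in> carrier G \<Longrightarrow> dist u v = dist v u"
  unfolding word_dist_def using len_inv[of "inv u \<otimes> v"] by (simp add: inv_mult_group)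

lemma dist_triangle:
  assumes "u \<in> carrier G" "v \<in> carrier G" "w \<in> carrier G"
  shows "dist u w \<le> dist u v + dist v w"
proof -
  have "inv u \<otimes> w = (inv u \<otimes> v) \<otimes> (inv v \<otimes> w)"
    using assms by (simp add: group_word_simps)
  then show ?thesis unfolding word_dist_def using len_mult_le assms by simp
qed

lemma dist_mult_right: "u \<in> carrier G \<Longrightarrow> g \<in> carrier G \<Longrightarrow> dist u (u \<otimes> g) = len g"
  unfolding word_dist_def by (simp add: m_assoc[symmetric])

text \<open>A geodesic is recorded by its vertices alone: distances do not depend on the labels of the edges,
  and labels can be chosen whenever an edge path is required.\<close>

definition geodesic :: "(nat \<Rightarrow> 'a) \<Rightarrow> nat \<Rightarrow> 'a \<Rightarrow> 'a \<Rightarrow> bool" where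
  "geodesic f n u v \<longleftrightarrow> f 0 = u \<and> f n = v \<and> (\<forall>i\<le>n. f i \<in> carrier G) \<and>
     (\<forall>i j. i \<le> j \<and> j \<le> n \<longrightarrow> dist (f i) (f j) = j - i)"

lemma geodesicD:
  assumes "geodesic f n u v"
  shows "f 0 = u" "f n = v" "\<And>i. i \<le> n \<Longrightarrow> f i \<in> carrier G" "u \<in> carrier G" "v \<in> carrier G"
    "dist u v = n" "\<And>i j. i \<le> j \<Longrightarrow> j \<le> n \<Longrightarrow> dist (f i) (f j) = j - i"
  using assms unfolding geodesic_def by fastforce+

lemma walk_dist_le:
  assumes "\<And>i. i \<le> n \<Longrightarrow> f i \<in> carrier G" "\<And>i. i < n \<Longrightarrow> dist (f i) (f (Suc i)) \<le> 1"
    "i \<le> j" "j \<le> n"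
  shows "dist (f i) (f j) \<le> j - i"
  using assms(3,4)
proof (induction j rule: dec_induct)
  case base then show ?case using assms(1)[of i] by simp
next
  case (step j)
  then have "dist (f i) (f (Suc j)) \<le> dist (f i) (f j) + dist (f j) (f (Suc j))"
    using dist_triangle assms(1) by simp
  then show ?case using step assms(2)[of j] by simp
qed

lemma geodesicI:
  assumes "\<And>i. i \<le> n \<Longrightarrow> f i \<in> carrier G" "\<And>i. i < n \<Longrightarrow> dist (f i) (f (Suc i)) \<le> 1"
    "f 0 = u" "f n = v" "n \<le> dist u v"
  shows "geodesic f n u v"
  unfolding geodesic_def
proof (intro conjI allI impI assms(1,3,4))
  fix i j assume ij: "i \<le> j \<and> j \<le> n"
  have "n \<le> dist (f 0) (f i) + dist (f i) (f j) + dist (f j) (f n)"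
    using dist_triangle[of "f 0" "f i" "f n"] dist_triangle[of "f i" "f j" "f n"]
      assms(1)[of 0] assms(1)[of i] assms(1)[of j] assms(1)[of n] assms(3-5) ij by fastforce
  moreover have "dist (f 0) (f i) \<le> i" "dist (f i) (f j) \<le> j - i" "dist (f j) (f n) \<le> n - j"
    using walk_dist_le[of n f 0 i] walk_dist_le[of n f i j] walk_dist_le[of n f j n] assms ij by auto
  ultimately show "dist (f i) (f j) = j - i" using ij by linarith
qed

lemma geodesic_exists:
  assumes "u \<in> carrier G" "v \<in> carrier G"
  obtains f where "geodesic f (dist u v) u v"
proof -
  have uv: "inv u \<otimes> v \<in> carrier G" using assms by simp
  obtain w where w: "set w \<subseteq> S" "length w = dist u v" "word_prod w = inv u \<otimes> v"
    using len_word[OF uv] unfolding word_dist_def .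
  have c: "word_prod (take i w) \<in> carrier G" for i
    using w set_take_subset[of i w] by (intro word_prod_closed) auto
  have "geodesic (\<lambda>i. u \<otimes> word_prod (take i w)) (dist u v) u v"
  proof (rule geodesicI)
    fix i assume i: "i < dist u v"
    then have wi: "w ! i \<in> S" using w nth_mem by fastforce
    have "dist (u \<otimes> word_prod (take i w)) (u \<otimes> word_prod (take i w) \<otimes> w ! i) \<le> 1"
      using dist_mult_right assms c wi S_carrier len_generator by auto
    then show "dist (u \<otimes> word_prod (take i w)) (u \<otimes> word_prod (take (Suc i) w)) \<le> 1"
      using i w assms c wi S_carrier by (auto simp: take_Suc_conv_app_nth m_assoc subset_eq)
  next
    show "u \<otimes> word_prod (take (dist u v) w) = v"
      using w assms by (simp add: m_assoc[symmetric])
  qed (use assms c in auto)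
  then show ?thesis using that by blast
qed

lemma geodesic_sub:
  assumes "geodesic f n u v" "a \<le> b" "b \<le> n"
  shows "geodesic (\<lambda>i. f (a + i)) (b - a) (f a) (f b)"
  using assms unfolding geodesic_def by auto

lemma geodesic_rev:
  assumes "geodesic f n u v"
  shows "geodesic (\<lambda>i. f (n - i)) n v u"
  unfolding geodesic_def
proof (intro conjI allI impI)
  fix i j assume "i \<le> j \<and> j \<le> n"
  then show "dist (f (n - i)) (f (n - j)) = j - i"
    using geodesicD(7)[OF assms, of "n - j" "n - i"] geodesicD(3)[OF assms]
    by (subst dist_sym) auto
qed (use geodesicD[OF assms] in auto)

end

section \<open>The relative Cayley graph as a word metric\<close>

locale relative_cayley = word_metric G X for G (structure) and X +
  fixes H :: "nat \<Rightarrow> 'a set" and m :: nat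
  assumes X_finite: "finite X"
    and H_subgroup: "i \<in> {1..m} \<Longrightarrow> subgroup (H i) G"
begin

definition relative_generators :: "'a set" where
  "relative_generators = letter_val ` alphabet G X H m"

lemma H_carrier: "i \<in> {1..m} \<Longrightarrow> H i \<subseteq> carrier G"
  using H_subgroup subgroup.subset by blast

lemma relative_generators_eq: "relative_generators = X \<union> (\<Union>i\<in>{1..m}. H i - {\<one>})"
  by (simp add: relative_generators_def alphabet_def image_Un image_UN image_image)

end

sublocale relative_cayley \<subseteq> rel: word_metric G relative_generators
proof
  show sub: "relative_generators \<subseteq> carrier G"
    unfolding relative_generators_eq using S_carrier H_carrier by blast
  show "inv x \<in> relative_generators" if "x \<in> relative_generators" for x
    using that S_inv H_subgroup H_carrier subgroup.m_inv_closed inv_eq_1_iff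
    by (fastforce simp: relative_generators_eq)
  have "carrier G \<subseteq> generate G relative_generators"
    using mono_generate[of X relative_generators] S_generates relative_generators_eq by auto
  then show "generate G relative_generators = carrier G"
    using generate_incl[OF sub] by blast
qed

context relative_cayley begin

abbreviation d :: "'a \<Rightarrow> 'a \<Rightarrow> nat" where "d \<equiv> rel.dist"

lemma d_le_1_H:
  assumes "i \<in> {1..m}" "inv u \<otimes> v \<in> H i"
  shows "d u v \<le> 1"
proof (cases "inv u \<otimes> v = \<one>")
  case False
  then have "inv u \<otimes> v \<in> relative_generators"
    using assms unfolding relative_generators_eq by blast
  then show ?thesis unfolding word_dist_def by (rule rel.len_generator)
qed (simp add: word_dist_def)

lemma path_vertex_eq:
  assumes "is_path G X H m p"
  shows "path_vertex G p n = fst p \<otimes> rel.word_prod (map letter_val (take n (snd p)))"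
proof -
  have "foldl (\<lambda>g a. g \<otimes> letter_val a) u w = foldl (\<otimes>) u (map letter_val w)" for u w
    by (simp add: foldl_map)
  moreover have "set (map letter_val (take n (snd p))) \<subseteq> carrier G"
    using assms set_take_subset[of n "snd p"] rel.S_carrier
    unfolding is_path_def relative_generators_def by fastforce
  ultimately show ?thesis
    using assms rel.foldl_mult[of "fst p" "map letter_val (take n (snd p))"]
    unfolding path_vertex_def is_path_def by metis
qed

text \<open>The labels of a path from \<open>u\<close> to \<open>v\<close> spell \<open>inv u \<otimes> v\<close>. Hence the graph metric is the word metric
  of a generating set, though in general of an infinite one.\<close>

lemma graph_dist_eq:
  assumes "u \<in> carrier G" "v \<in> carrier G"
  shows "graph_dist G X H m u v = d u v"
proof -
  have "(\<exists>p. is_path G X H m p \<and> path_start G p = u \<and> path_end G p = v \<and> path_length p = n) \<longleftrightarrow>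
    (\<exists>w. set w \<subseteq> relative_generators \<and> length w = n \<and> rel.word_prod w = inv u \<otimes> v)" (is "?L \<longleftrightarrow> ?R") for n
  proof
    assume ?L
    then obtain p where p: "is_path G X H m p" "path_start G p = u" "path_end G p = v" "path_length p = n"
      by blast
    let ?w = "map letter_val (snd p)"
    have u: "fst p = u" using p(2) by (simp add: path_start_def path_vertex_def)
    have w: "set ?w \<subseteq> relative_generators"
      using p(1) by (auto simp: is_path_def relative_generators_def)
    have "v = u \<otimes> rel.word_prod ?w"
      using path_vertex_eq[OF p(1), of "path_length p"] p(3) u by (simp add: path_end_def path_length_def)
    then have "rel.word_prod ?w = inv u \<otimes> v"
      using assms rel.word_prod_closed[OF w] by (simp add: inv_mult_cancel)
    then show ?R using w p(4) by (intro exI[of _ ?w]) (simp add: path_length_def)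
  next
    assume ?R
    then obtain w where w: "set w \<subseteq> relative_generators" "length w = n" "rel.word_prod w = inv u \<otimes> v"
      by blast
    then have "w \<in> lists (letter_val ` alphabet G X H m)"
      unfolding relative_generators_def by auto
    then obtain l where l: "l \<in> lists (alphabet G X H m)" "w = map letter_val l"
      by (auto simp: lists_image)
    then have p: "is_path G X H m (u, l)" using assms by (auto simp: is_path_def)
    have "path_end G (u, l) = v"
      using path_vertex_eq[OF p, of n] w l assms
      by (simp add: path_end_def path_length_def mult_inv_cancel)
    then show ?L using p l w by (intro exI[of _ "(u, l)"])
        (auto simp: path_start_def path_vertex_def path_length_def)
  qed
  then show ?thesis unfolding graph_dist_def word_dist_def word_length_def by simp
qed

lemma path_vertex_carrier:
  assumes "is_path G X H m p"
  shows "path_vertex G p n \<in> carrier G"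
proof -
  have "set (map letter_val (take n (snd p))) \<subseteq> relative_generators"
    using assms set_take_subset[of n "snd p"] unfolding is_path_def relative_generators_def by fastforce
  then show ?thesis
    using rel.word_prod_closed assms path_vertex_eq[OF assms] unfolding is_path_def by simp
qed

lemma path_vertex_Suc:
  "i < path_length p \<Longrightarrow> path_vertex G p (Suc i) = path_vertex G p i \<otimes> letter_val (snd p ! i)"
  by (simp add: path_vertex_def path_length_def take_Suc_conv_app_nth)

lemma path_letter:
  assumes "is_path G X H m p" "i < path_length p"
  shows "snd p ! i \<in> alphabet G X H m" "letter_val (snd p ! i) \<in> relative_generators"
    "letter_val (snd p ! i) = inv (path_vertex G p i) \<otimes> path_vertex G p (Suc i)"
proof -
  show *: "snd p ! i \<in> alphabet G X H m"
    using assms nth_mem by (fastforce simp: is_path_def path_length_def)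
  then show **: "letter_val (snd p ! i) \<in> relative_generators"
    by (simp add: relative_generators_def)
  show "letter_val (snd p ! i) = inv (path_vertex G p i) \<otimes> path_vertex G p (Suc i)"
    using path_vertex_Suc[OF assms(2)] path_vertex_carrier[OF assms(1)] ** rel.S_carrier
    by (auto simp: inv_mult_cancel)
qed

lemma path_d_Suc:
  assumes "is_path G X H m p" "i < path_length p"
  shows "d (path_vertex G p i) (path_vertex G p (Suc i)) \<le> 1"
  using path_letter[OF assms] rel.len_generator unfolding word_dist_def by metis

lemma subpath_simps:
  assumes "i \<le> j" "j \<le> path_length p"
  shows "path_length (subpath G p i j) = j - i" "path_start G (subpath G p i j) = path_vertex G p i"
    "path_end G (subpath G p i j) = path_vertex G p j"
proof -
  show l: "path_length (subpath G p i j) = j - i" 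
    using assms by (auto simp: path_length_def subpath_def)
  show "path_start G (subpath G p i j) = path_vertex G p i"
    by (simp add: path_start_def subpath_def path_vertex_def)
  have "take j (snd p) = take i (snd p) @ take (j - i) (drop i (snd p))"
    using assms take_add[of i "j - i" "snd p"] by simp
  then show "path_end G (subpath G p i j) = path_vertex G p j"
    unfolding path_end_def l by (simp add: subpath_def path_vertex_def)
qed

lemma quasi_geodesic_iff:
  assumes "is_path G X H m p"
  shows "quasi_geodesic G X H m l c p \<longleftrightarrow>
    (\<forall>i j. i \<le> j \<and> j \<le> path_length p \<longrightarrow>
      real (j - i) \<le> l * real (d (path_vertex G p i) (path_vertex G p j)) + c)"
  using assms path_vertex_carrier[OF assms]
  by (auto simp: quasi_geodesic_def Let_def subpath_simps graph_dist_eq)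

lemma geodesic_path_geodesic:
  assumes "geodesic_path G X H m p"
  shows "rel.geodesic (path_vertex G p) (path_length p) (path_start G p) (path_end G p)"
proof -
  have p: "is_path G X H m p" using assms by (simp add: geodesic_path_def)
  show ?thesis
    by (rule rel.geodesicI)
      (use assms p path_vertex_carrier[OF p] path_d_Suc[OF p]
        in \<open>auto simp: path_start_def path_end_def geodesic_path_def graph_dist_eq\<close>)
qed

text \<open>Conversely, a sequence of adjacent elements is turned into an edge path. An element may be the
  value of several letters, and it does not matter which of them is chosen as a label.\<close>

definition walk :: "(nat \<Rightarrow> 'a) \<Rightarrow> nat \<Rightarrow> bool" where
  "walk f n \<longleftrightarrow> (\<forall>i\<le>n. f i \<in> carrier G) \<and> (\<forall>i<n. d (f i) (f (Suc i)) = 1)"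

definition step_label :: "(nat \<Rightarrow> 'a) \<Rightarrow> nat \<Rightarrow> 'a letter" where
  "step_label f i = (SOME a. a \<in> alphabet G X H m \<and> letter_val a = inv (f i) \<otimes> f (Suc i))"

definition walk_path :: "(nat \<Rightarrow> 'a) \<Rightarrow> nat \<Rightarrow> 'a cpath" where
  "walk_path f n = (f 0, map (step_label f) [0..<n])"

lemma step_label:
  assumes "walk f n" "i < n"
  shows "step_label f i \<in> alphabet G X H m" "letter_val (step_label f i) = inv (f i) \<otimes> f (Suc i)"
proof -
  have "inv (f i) \<otimes> f (Suc i) \<in> relative_generators"
    using assms rel.len_eq_1 unfolding walk_def word_dist_def by simp
  then have "\<exists>a. a \<in> alphabet G X H m \<and> letter_val a = inv (f i) \<otimes> f (Suc i)"
    unfolding relative_generators_def by auto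
  from someI_ex[OF this] 
  show "step_label f i \<in> alphabet G X H m" "letter_val (step_label f i) = inv (f i) \<otimes> f (Suc i)"
    unfolding step_label_def by auto
qed

lemma walk_path_simps:
  assumes "walk f n"
  shows "is_path G X H m (walk_path f n)" "path_length (walk_path f n) = n"
    "i \<le> n \<Longrightarrow> path_vertex G (walk_path f n) i = f i"
    "path_start G (walk_path f n) = f 0" "path_end G (walk_path f n) = f n"
    "i < n \<Longrightarrow> snd (walk_path f n) ! i = step_label f i"
proof -
  show l: "path_length (walk_path f n) = n"
    "i < n \<Longrightarrow> snd (walk_path f n) ! i = step_label f i" for i
    by (simp_all add: walk_path_def path_length_def)
  show "is_path G X H m (walk_path f n)"
    using assms step_label[OF assms] by (auto simp: is_path_def walk_path_def walk_def)
  have v: "path_vertex G (walk_path f n) i = f i" if "i \<le> n" for i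
    using that
  proof (induction i)
    case 0
    then show ?case by (simp add: path_vertex_def walk_path_def)
  next
    case (Suc i)
    then show ?case
      using path_vertex_Suc[of i "walk_path f n"] l step_label[OF assms, of i] assms
      by (simp add: walk_def mult_inv_cancel)
  qed
  then show "i \<le> n \<Longrightarrow> path_vertex G (walk_path f n) i = f i" .
  show "path_start G (walk_path f n) = f 0" "path_end G (walk_path f n) = f n"
    using v[of 0] v[of n] l by (simp_all add: path_start_def path_end_def)
qed

lemma geodesic_walk: "rel.geodesic f n u v \<Longrightarrow> walk f n"
  unfolding walk_def rel.geodesic_def by simp

lemma geodesic_walk_path:
  assumes "rel.geodesic f n u v"
  shows "geodesic_path G X H m (walk_path f n)" "quasi_geodesic G X H m 1 0 (walk_path f n)"
  using walk_path_simps[OF geodesic_walk[OF assms]] rel.geodesicD[OF assms] graph_dist_eq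
  by (auto simp: geodesic_path_def quasi_geodesic_iff)

lemma H_subpath_coset:
  assumes "is_path G X H m p" "H_subpath i p s" "i \<in> {1..m}" 
    "fst s \<le> a" "a \<le> b" "b \<le> snd s"
  shows "inv (path_vertex G p a) \<otimes> path_vertex G p b \<in> H i"
  using assms(5,6)
proof (induction b rule: dec_induct)
  case base
  then show ?case
    using path_vertex_carrier[OF assms(1)] subgroup.one_closed[OF H_subgroup[OF assms(3)]] by simp
next
  case (step b)
  have b: "b < path_length p" "b \<in> {fst s..<snd s}"
    using step assms(2,4) by (auto simp: H_subpath_def)
  then obtain x where x: "snd p ! b = HLet i x" using assms(2) unfolding H_subpath_def by blast
  then have "letter_val (snd p ! b) \<in> H i"
    using path_letter(1)[OF assms(1) b(1)] by (auto simp: alphabet_def)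
  then have "(inv (path_vertex G p a) \<otimes> path_vertex G p b) \<otimes> letter_val (snd p ! b) \<in> H i"
    using step subgroup.m_closed[OF H_subgroup[OF assms(3)]] by simp
  then show ?case
    using path_vertex_Suc[OF b(1)] path_vertex_carrier[OF assms(1)] path_letter(2)[OF assms(1) b(1)]
      rel.S_carrier by (simp add: m_assoc subset_eq)
qed

text \<open>A path that starts an edge in a coset of \<open>H i\<close> and is in the same coset at a later time could be shortened,
  unless it has just completed that edge. So paths that are shortest in a
  suitable sense are efficient, and efficiency is easier to check than the absence of backtracking,
  which it implies.\<close>

definition efficient :: "'a cpath \<Rightarrow> bool" where
  "efficient p \<longleftrightarrow> (\<forall>i\<in>{1..m}. \<forall>a b x. a < b \<and> b \<le> path_length p \<and> snd p ! a = HLet i x \<and>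
     inv (path_vertex G p a) \<otimes> path_vertex G p b \<in> H i \<longrightarrow> b = Suc a)"

lemma efficientD:
  assumes "efficient p" "i \<in> {1..m}" "a < b" "b \<le> path_length p" "snd p ! a = HLet i x"
    "inv (path_vertex G p a) \<otimes> path_vertex G p b \<in> H i"
  shows "b = Suc a"
  using assms unfolding efficient_def by blast

lemma H_component_efficient:
  assumes "is_path G X H m p" "efficient p" "H_component i p s" "i \<in> {1..m}" 
  shows "snd s = Suc (fst s)"
proof -
  have s: "H_subpath i p s" using assms by (simp add: H_component_def)
  then have s': "fst s < snd s" "snd s \<le> path_length p"
    and "fst s \<in> {fst s..<snd s} \<longrightarrow> (\<exists>x. snd p ! fst s = HLet i x)"
    unfolding H_subpath_def by blast+
  then obtain x where x: "snd p ! fst s = HLet i x" by auto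
  show ?thesis
    by (rule efficientD[OF assms(2,4) s' x])
      (use H_subpath_coset[OF assms(1) s assms(4) le_refl _ le_refl] s' in simp)
qed

lemma common_coset:
  assumes "i \<in> {1..m}" "g \<in> carrier G" "u \<in> g <# H i" "v \<in> g <# H i"
  shows "inv u \<otimes> v \<in> H i"
proof -
  obtain a b where "a \<in> H i" "b \<in> H i" "u = g \<otimes> a" "v = g \<otimes> b"
    using assms by (auto simp: l_coset_def)
  moreover then have "a \<in> carrier G" "b \<in> carrier G" using H_carrier assms(1) by auto
  ultimately show ?thesis
    using assms(2) H_subgroup[OF assms(1)] by (simp add: group_word_simps subgroup_def)
qed

text \<open>If two different components were connected, the first vertex of the earlier one and the last vertex of the
  later one would lie in one coset, at least two steps apart.\<close>

lemma efficient_without_backtracking: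
  assumes "is_path G X H m p" "efficient p"
  shows "without_backtracking G H m p"
proof -
  have *: "s = t" if c: "H_component i p s" "H_component i p t" and i: "i \<in> {1..m}" and g: "g \<in> carrier G"
    "path_vertex G p ` {fst s..snd s} \<union> path_vertex G p ` {fst t..snd t} \<subseteq> g <# H i" and le: "fst s \<le> fst t"
  for i s t g
  proof -
    have st: "snd s = Suc (fst s)" "snd t = Suc (fst t)"
      using H_component_efficient assms c i by auto
    have sub: "H_subpath i p s" "H_subpath i p t" using c by (auto simp: H_component_def)
    then have "fst s \<in> {fst s..<snd s} \<longrightarrow> (\<exists>x. snd p ! fst s = HLet i x)"
      unfolding H_subpath_def by blast
    then obtain x where x: "snd p ! fst s = HLet i x" using st by auto
    have "path_vertex G p (fst s) \<in> g <# H i" "path_vertex G p (snd t) \<in> g <# H i"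
      using g(2) sub by (auto simp: H_subpath_def subset_eq)
    then have "inv (path_vertex G p (fst s)) \<otimes> path_vertex G p (snd t) \<in> H i"
      using common_coset[OF i g(1)] by blast
    moreover have "fst s < snd t" "snd t \<le> path_length p" using st le sub by (auto simp: H_subpath_def)
    ultimately have "snd t = Suc (fst s)"
      using efficientD[OF assms(2) i _ _ x] by blast
    then show ?thesis using st by (simp add: prod_eq_iff)
  qed
  have "s = t" if conn: "connected_components G H m p s p t" for s t
  proof -
    obtain i g where "H_component i p s" "H_component i p t" "i \<in> {1..m}" "g \<in> carrier G"
      "path_vertex G p ` {fst s..snd s} \<union> path_vertex G p ` {fst t..snd t} \<subseteq> g <# H i"
      using conn unfolding connected_components_def by (elim bexE conjE) (rule that)
    then show ?thesis using *[of i s t g] *[of i t s g] by (cases "fst s \<le> fst t") (auto simp: Un_commute)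
  qed
  then show ?thesis unfolding without_backtracking_def isolated_def by blast
qed

lemma efficient_phase:
  assumes "is_path G X H m p" "efficient p"
  shows "phase_vertices G m p = path_vertex G p ` {..path_length p}"
  using H_component_efficient[OF assms] unfolding phase_vertices_def component_def by fastforce

text \<open>Two elements of one coset of \<open>H i\<close> are at distance at most one.\<close>

lemma geodesic_efficient:
  assumes "rel.geodesic f n u v"
  shows "efficient (walk_path f n)"
  unfolding efficient_def
proof (intro ballI allI impI)
  fix i a b x
  assume i: "i \<in> {1..m}" and "a < b \<and> b \<le> path_length (walk_path f n) \<and> snd (walk_path f n) ! a = HLet i x \<and>
       inv (path_vertex G (walk_path f n) a) \<otimes> path_vertex G (walk_path f n) b \<in> H i"
  then have "a < b" "b \<le> n" "d (f a) (f b) \<le> 1"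
    using walk_path_simps[OF geodesic_walk[OF assms]] d_le_1_H[OF i] by auto
  then show "b = Suc a" using rel.geodesicD(7)[OF assms, of a b] by linarith
qed

end

section \<open>Slim triangles of vertices\<close>

context relative_cayley begin

text \<open>The parametrisation by arc length of the path in the metric graph that has the vertices
  \<open>f 0, f 1, \<dots>\<close>.\<close>

definition edge_param :: "(nat \<Rightarrow> 'a) \<Rightarrow> real \<Rightarrow> 'a gpoint" where
  "edge_param f t = (if t = of_int \<lfloor>t\<rfloor> then Vertex (f (nat \<lfloor>t\<rfloor>))
     else EdgePoint (f (nat \<lfloor>t\<rfloor>)) (step_label f (nat \<lfloor>t\<rfloor>)) (frac t))"

lemma edge_param_of_nat [simp]: "edge_param f (real i) = Vertex (f i)"
  by (simp add: edge_param_def)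

lemma floor_bounds:
  assumes "0 \<le> t" "t \<le> real n"
  shows "nat \<lfloor>t\<rfloor> \<le> n" "real (nat \<lfloor>t\<rfloor>) \<le> t" "t < real (nat \<lfloor>t\<rfloor>) + 1"
    "t \<noteq> of_int \<lfloor>t\<rfloor> \<Longrightarrow> nat \<lfloor>t\<rfloor> < n" "frac t = t - real (nat \<lfloor>t\<rfloor>)"
proof -
  have e: "real (nat \<lfloor>t\<rfloor>) = of_int \<lfloor>t\<rfloor>" using assms by simp
  show "real (nat \<lfloor>t\<rfloor>) \<le> t" "t < real (nat \<lfloor>t\<rfloor>) + 1" "frac t = t - real (nat \<lfloor>t\<rfloor>)"
    unfolding e by (auto simp: frac_def)
  then show "nat \<lfloor>t\<rfloor> \<le> n" using assms by linarith
  show "nat \<lfloor>t\<rfloor> < n" if "t \<noteq> of_int \<lfloor>t\<rfloor>"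
    using that \<open>real (nat \<lfloor>t\<rfloor>) \<le> t\<close> assms e by linarith
qed

text \<open>This describes the exits of vertices and of inner points of edges in the same way, which avoids
  a case distinction in the computation of distances.\<close>

lemma exits_edge_param:
  assumes "walk f n" "0 \<le> t" "t \<le> real n"
  shows "exits G (edge_param f t) =
    {(f i, \<bar>t - real i\<bar>) | i. i \<le> n \<and> \<bar>t - real i\<bar> < 1}"
proof (cases "t = of_int \<lfloor>t\<rfloor>")
  case True
  then have t: "t = real (nat \<lfloor>t\<rfloor>)" using assms by simp
  have "\<bar>t - real i\<bar> < 1 \<longleftrightarrow> i = nat \<lfloor>t\<rfloor>" for i
    by (subst t) linarith
  moreover have "exits G (edge_param f t) = {(f (nat \<lfloor>t\<rfloor>), 0)}"
    by (subst t) simp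
  ultimately show ?thesis using t floor_bounds(1)[OF assms(2,3)] by auto
next
  case False
  let ?k = "nat \<lfloor>t\<rfloor>"
  note b = floor_bounds[OF assms(2,3)]
  have k: "?k < n" using b(4) False by simp
  have ne: "t \<noteq> real ?k" using False assms(2) by auto
  have i: "\<bar>t - real i\<bar> < 1 \<longleftrightarrow> i = ?k \<or> i = Suc ?k" for i
  proof
    assume "\<bar>t - real i\<bar> < 1"
    then have "real i < real ?k + 2" "real ?k < real i + 1" using b by linarith+
    then show "i = ?k \<or> i = Suc ?k" by linarith
  next
    have "\<bar>t - real ?k\<bar> < 1" using b(2,3) by linarith
    moreover have "\<bar>t - real (Suc ?k)\<bar> < 1" using b(2,3) ne unfolding of_nat_Suc by linarith
    moreover assume "i = ?k \<or> i = Suc ?k"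
    ultimately show "\<bar>t - real i\<bar> < 1" by blast
  qed
  have "f ?k \<otimes> letter_val (step_label f ?k) = f (Suc ?k)"
    using step_label(2)[OF assms(1) k] assms(1) k by (simp add: walk_def mult_inv_cancel)
  moreover have "1 - frac t = \<bar>t - real (Suc ?k)\<bar>" "frac t = \<bar>t - real ?k\<bar>"
    using b(2,3,5) unfolding of_nat_Suc by linarith+
  ultimately have "exits G (edge_param f t) = {(f ?k, \<bar>t - real ?k\<bar>), (f (Suc ?k), \<bar>t - real (Suc ?k)\<bar>)}"
    using False unfolding edge_param_def by (simp only: if_False exits.simps)
  then show ?thesis using i k by auto
qed

lemma edge_param_points:
  assumes "walk f n" "0 \<le> t" "t \<le> real n"
  shows "edge_param f t \<in> graph_points G X H m"
proof (cases "t = of_int \<lfloor>t\<rfloor>")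
  case True
  then show ?thesis
    using floor_bounds(1)[OF assms(2,3)] assms(1) by (simp add: edge_param_def graph_points_def walk_def)
next
  case False
  then have "0 < frac t" "frac t < 1"
    using frac_ge_0[of t] frac_lt_1[of t] unfolding frac_def by linarith+
  moreover have "nat \<lfloor>t\<rfloor> < n" using floor_bounds(4)[OF assms(2,3)] False by simp
  ultimately show ?thesis
    using assms(1) step_label(1)[OF assms(1)] False
    by (simp add: edge_param_def graph_points_def walk_def)
qed

text \<open>A route that leaves through \<open>f i\<close> and returns through \<open>f j\<close> has length
  \<open>\<bar>s - i\<bar> + \<bar>i - j\<bar> + \<bar>t - j\<bar> \<ge> \<bar>s - t\<bar>\<close>, with equality if \<open>i\<close> and \<open>j\<close> lie between \<open>s\<close> and \<open>t\<close> in the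
  right order. If there are no such integers then \<open>s\<close> and \<open>t\<close> belong to the interior of one edge,
  and the direct route along this edge has length \<open>\<bar>s - t\<bar>\<close>.\<close>

lemma point_dist_edge_param:
  assumes f: "rel.geodesic f n u v" and s: "0 \<le> s" "s \<le> real n" and t: "0 \<le> t" "t \<le> real n"
  shows "point_dist G X H m (edge_param f s) (edge_param f t) = \<bar>s - t\<bar>"
proof -
  note w = geodesic_walk[OF f]
  let ?E = "exits G (edge_param f s) \<times> exits G (edge_param f t)"
  let ?A = "(\<lambda>((u, r), (v, s)). r + real (graph_dist G X H m u v) + s) ` ?E"
  let ?B = "{\<bar>p - q\<bar> | g a p q. edge_param f s = EdgePoint g a p \<and> edge_param f t = EdgePoint g a q}"
  have dist: "graph_dist G X H m (f i) (f j) = nat \<bar>int i - int j\<bar>" if "i \<le> n" "j \<le> n" for i j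
  proof (cases "i \<le> j")
    case True
    then show ?thesis using that rel.geodesicD(3,7)[OF f] by (simp add: graph_dist_eq nat_minus_as_int)
  next
    case False
    then show ?thesis
      using that rel.geodesicD(3)[OF f] rel.geodesicD(7)[OF f, of j i] rel.dist_sym[of "f i" "f j"]
      by (simp add: graph_dist_eq nat_minus_as_int)
  qed
  have A: "x \<in> ?A \<longleftrightarrow> (\<exists>i j. x = \<bar>s - real i\<bar> + \<bar>real i - real j\<bar> + \<bar>t - real j\<bar> \<and>
      i \<le> n \<and> \<bar>s - real i\<bar> < 1 \<and> j \<le> n \<and> \<bar>t - real j\<bar> < 1)" for x
  proof -
    have r: "real (nat \<bar>int i - int j\<bar>) = \<bar>real i - real j\<bar>" for i j by simp
    show ?thesis
    proof
      assume "x \<in> ?A"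
      then show "\<exists>i j. x = \<bar>s - real i\<bar> + \<bar>real i - real j\<bar> + \<bar>t - real j\<bar> \<and>
          i \<le> n \<and> \<bar>s - real i\<bar> < 1 \<and> j \<le> n \<and> \<bar>t - real j\<bar> < 1"
        unfolding exits_edge_param[OF w s] exits_edge_param[OF w t]
        by (clarsimp simp only: mem_Times_iff image_iff) (auto simp: dist r)
    next
      assume "\<exists>i j. x = \<bar>s - real i\<bar> + \<bar>real i - real j\<bar> + \<bar>t - real j\<bar> \<and>
          i \<le> n \<and> \<bar>s - real i\<bar> < 1 \<and> j \<le> n \<and> \<bar>t - real j\<bar> < 1"
      then obtain i j where x: "x = \<bar>s - real i\<bar> + \<bar>real i - real j\<bar> + \<bar>t - real j\<bar>"
        and "i \<le> n" "\<bar>s - real i\<bar> < 1" "j \<le> n" "\<bar>t - real j\<bar> < 1" by blast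
      then have "((f i, \<bar>s - real i\<bar>), (f j, \<bar>t - real j\<bar>)) \<in> ?E"
        unfolding exits_edge_param[OF w s] exits_edge_param[OF w t] by blast
      moreover have "x = \<bar>s - real i\<bar> + real (graph_dist G X H m (f i) (f j)) + \<bar>t - real j\<bar>"
        using x dist \<open>i \<le> n\<close> \<open>j \<le> n\<close> r by simp
      ultimately show "x \<in> ?A" by (intro image_eqI) auto
    qed
  qed
  have B: "x = \<bar>s - t\<bar>" if "x \<in> ?B" for x
  proof -
    from that obtain g a p q where x: "x = \<bar>p - q\<bar>" and
      p: "edge_param f s = EdgePoint g a p" "edge_param f t = EdgePoint g a q" by blast
    then have ni: "s \<noteq> of_int \<lfloor>s\<rfloor>" "t \<noteq> of_int \<lfloor>t\<rfloor>"
      by (auto simp: edge_param_def split: if_splits)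
    then have "f (nat \<lfloor>s\<rfloor>) = f (nat \<lfloor>t\<rfloor>)" "p = frac s" "q = frac t"
      using p by (auto simp: edge_param_def)
    moreover then have "nat \<lfloor>s\<rfloor> = nat \<lfloor>t\<rfloor>"
      using dist[of "nat \<lfloor>s\<rfloor>" "nat \<lfloor>t\<rfloor>"] floor_bounds(1)[OF s] floor_bounds(1)[OF t]
        rel.geodesicD(3)[OF f] s(1) t(1) by (simp add: graph_dist_eq)
    ultimately show ?thesis using x floor_bounds(5)[OF s] floor_bounds(5)[OF t] by simp
  qed
  have "finite ?B" using finite_subset[of ?B "{\<bar>s - t\<bar>}"] B by blast
  moreover have "finite (exits G x)" for x by (cases x) auto
  ultimately have fin: "finite (?A \<union> ?B)" by simp
  have mem: "\<bar>s - t\<bar> \<in> ?A \<union> ?B"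
  proof (cases "\<lfloor>s\<rfloor> = \<lfloor>t\<rfloor> \<and> s \<noteq> of_int \<lfloor>s\<rfloor> \<and> t \<noteq> of_int \<lfloor>t\<rfloor>")
    case True
    then have "edge_param f s = EdgePoint (f (nat \<lfloor>s\<rfloor>)) (step_label f (nat \<lfloor>s\<rfloor>)) (frac s)"
      "edge_param f t = EdgePoint (f (nat \<lfloor>s\<rfloor>)) (step_label f (nat \<lfloor>s\<rfloor>)) (frac t)"
      by (auto simp: edge_param_def)
    moreover have "\<bar>s - t\<bar> = \<bar>frac s - frac t\<bar>" using True by (simp add: frac_def)
    ultimately show ?thesis by blast
  next
    case False
    have "\<exists>i j. \<bar>s - t\<bar> = \<bar>s - real i\<bar> + \<bar>real i - real j\<bar> + \<bar>t - real j\<bar> \<and>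
      i \<le> n \<and> \<bar>s - real i\<bar> < 1 \<and> j \<le> n \<and> \<bar>t - real j\<bar> < 1"
    proof -
      have between: "\<exists>i j. \<bar>s - t\<bar> = \<bar>s - real i\<bar> + \<bar>real i - real j\<bar> + \<bar>t - real j\<bar> \<and>
        i \<le> n \<and> \<bar>s - real i\<bar> < 1 \<and> j \<le> n \<and> \<bar>t - real j\<bar> < 1"
        if st: "0 \<le> s" "s \<le> t" "t \<le> real n" and F: "\<not> (\<lfloor>s\<rfloor> = \<lfloor>t\<rfloor> \<and> s \<noteq> of_int \<lfloor>s\<rfloor> \<and> t \<noteq> of_int \<lfloor>t\<rfloor>)" for s t
      proof (cases "\<lfloor>s\<rfloor> = \<lfloor>t\<rfloor>")
        case True
        have "s = of_int \<lfloor>s\<rfloor>" using F True st by linarith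
        then show ?thesis using st True by (intro exI[of _ "nat \<lfloor>s\<rfloor>"]) (auto, linarith+)
      next
        case False
        then have "\<lfloor>s\<rfloor> < \<lfloor>t\<rfloor>" using st floor_mono[of s t] by linarith
        then have "\<lceil>s\<rceil> \<le> \<lfloor>t\<rfloor>" by linarith
        then show ?thesis
          using st by (intro exI[of _ "nat \<lceil>s\<rceil>"] exI[of _ "nat \<lfloor>t\<rfloor>"]) (auto, linarith+)
      qed
      show ?thesis
      proof (cases "s \<le> t")
        case True
        then show ?thesis using between[of s t] s t False by blast
      next
        case le: False
        then have ts: "t \<le> s" by simp
        have ni: "\<not> (\<lfloor>t\<rfloor> = \<lfloor>s\<rfloor> \<and> t \<noteq> of_int \<lfloor>t\<rfloor> \<and> s \<noteq> of_int \<lfloor>s\<rfloor>)"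
          using False by metis
        obtain i j where e: "\<bar>t - s\<bar> = \<bar>t - real i\<bar> + \<bar>real i - real j\<bar> + \<bar>s - real j\<bar>"
          and ij: "i \<le> n" "\<bar>t - real i\<bar> < 1" "j \<le> n" "\<bar>s - real j\<bar> < 1"
          using between[OF t(1) ts s(2) ni] by (elim exE conjE)
        have "\<bar>s - t\<bar> = \<bar>s - real j\<bar> + \<bar>real j - real i\<bar> + \<bar>t - real i\<bar>"
          using e abs_minus_commute[of s t] abs_minus_commute[of "real i" "real j"] by simp
        then show ?thesis using ij by blast
      qed
    qed
    then show ?thesis using A by blast
  qed
  show ?thesis unfolding point_dist_def
    by (rule Min_eqI[OF fin _ mem]) (use A B in \<open>force\<close>)
qed

lemma geodesic_segment_edge_param:
  assumes "rel.geodesic f n u v"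
  shows "geodesic_segment (graph_points G X H m) (point_dist G X H m) (Vertex u) (Vertex v)
    (edge_param f ` {0..real n})"
proof -
  let ?g = "edge_param f"
  have "?g ` {0..real n} \<subseteq> graph_points G X H m"
    using edge_param_points[OF geodesic_walk[OF assms]] by auto
  moreover have "?g 0 = Vertex u" "?g (real n) = Vertex v"
    using edge_param_of_nat[of f 0] edge_param_of_nat[of f n] rel.geodesicD(1,2)[OF assms] by simp_all
  moreover have "\<forall>s\<in>{0..real n}. \<forall>t\<in>{0..real n}. point_dist G X H m (?g s) (?g t) = \<bar>s - t\<bar>"
    using point_dist_edge_param[OF assms] by simp
  ultimately show ?thesis
    unfolding geodesic_segment_def by (intro exI[of _ ?g] exI[of _ "real n"]) simp
qed

text \<open>The way from a vertex to a point of an edge passes through an end of the edge. This is why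
  slimness of triangles is inherited by the vertices with the same constant.\<close>

lemma point_dist_vertex_edge_param:
  assumes "rel.geodesic f n u v" "0 \<le> t" "t \<le> real n" "w \<in> carrier G"
    "point_dist G X H m (Vertex w) (edge_param f t) \<le> D"
  obtains i where "i \<le> n" "real (d w (f i)) \<le> D"
proof -
  note w = geodesic_walk[OF assms(1)]
  let ?A = "(\<lambda>((u, r), (v, s)). r + real (graph_dist G X H m u v) + s) ` (exits G (Vertex w) \<times> exits G (edge_param f t))"
  have e: "point_dist G X H m (Vertex w) (edge_param f t) = Min ?A"
    unfolding point_dist_def by simp
  have "finite (exits G x)" "exits G x \<noteq> {}" for x by (cases x; simp)+
  then have "finite ?A" "?A \<noteq> {}" by simp_all
  from Min_in[OF this] have "point_dist G X H m (Vertex w) (edge_param f t) \<in> ?A" unfolding e .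
  then obtain i where "i \<le> n" "point_dist G X H m (Vertex w) (edge_param f t) = real (graph_dist G X H m w (f i)) + \<bar>t - real i\<bar>"
    unfolding exits_edge_param[OF w assms(2,3)] by auto
  then show ?thesis
    using that[of i] assms rel.geodesicD(3)[OF assms(1)] by (simp add: graph_dist_eq)
qed

lemma slim_triangle:
  assumes hyp: "delta_hyperbolic (graph_points G X H m) (point_dist G X H m) \<delta>"
    and f: "rel.geodesic f a x y" and g: "rel.geodesic g b y z" and k: "rel.geodesic k c z x" and "i \<le> a"
  shows "(\<exists>j\<le>b. real (d (f i) (g j)) \<le> \<delta>) \<or> (\<exists>j\<le>c. real (d (f i) (k j)) \<le> \<delta>)"
proof -
  have "Vertex x \<in> graph_points G X H m" "Vertex y \<in> graph_points G X H m" "Vertex z \<in> graph_points G X H m"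
    using rel.geodesicD(4)[OF f] rel.geodesicD(4)[OF g] rel.geodesicD(4)[OF k]
    by (simp_all add: graph_points_def)
  moreover have "Vertex (f i) \<in> edge_param f ` {0..real a}"
    using \<open>i \<le> a\<close> edge_param_of_nat[of f i] by (metis atLeastAtMost_iff image_eqI of_nat_0_le_iff of_nat_le_iff)
  ultimately obtain q where "q \<in> edge_param g ` {0..real b} \<union> edge_param k ` {0..real c}"
    "point_dist G X H m (Vertex (f i)) q \<le> \<delta>"
    using hyp geodesic_segment_edge_param[OF f] geodesic_segment_edge_param[OF g]
      geodesic_segment_edge_param[OF k] unfolding delta_hyperbolic_def by meson
  then consider t where "0 \<le> t" "t \<le> real b" "point_dist G X H m (Vertex (f i)) (edge_param g t) \<le> \<delta>"
    | t where "0 \<le> t" "t \<le> real c" "point_dist G X H m (Vertex (f i)) (edge_param k t) \<le> \<delta>"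
    by auto
  then show ?thesis
  proof cases
    case (1 t)
    show ?thesis
      using point_dist_vertex_edge_param[OF g 1(1,2) rel.geodesicD(3)[OF f \<open>i \<le> a\<close>] 1(3)] by metis
  next
    case (2 t)
    show ?thesis
      using point_dist_vertex_edge_param[OF k 2(1,2) rel.geodesicD(3)[OF f \<open>i \<le> a\<close>] 2(3)] by metis
  qed
qed

end

section \<open>Consequences of bounded coset penetration\<close>

locale relatively_hyperbolic_group = relative_cayley +
  assumes rel_hyp: "relatively_hyperbolic G X H m"
begin

text \<open>Only distances between vertices are needed from here on, and these are natural numbers.\<close>

definition slim_constant :: "nat \<Rightarrow> bool" where
  "slim_constant \<delta> \<longleftrightarrow> (\<forall>f a x y g b z k c i. rel.geodesic f a x y \<and> rel.geodesic g b y z \<and>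
    rel.geodesic k c z x \<and> i \<le> a \<longrightarrow> (\<exists>j\<le>b. d (f i) (g j) \<le> \<delta>) \<or> (\<exists>j\<le>c. d (f i) (k j) \<le> \<delta>))"

lemma slim_constantD:
  assumes "slim_constant \<delta>" "rel.geodesic f a x y" "rel.geodesic g b y z" "rel.geodesic k c z x" "i \<le> a"
  shows "(\<exists>j\<le>b. d (f i) (g j) \<le> \<delta>) \<or> (\<exists>j\<le>c. d (f i) (k j) \<le> \<delta>)"
  using assms unfolding slim_constant_def by blast

lemma slim_constant_exists: "\<exists>\<delta>. slim_constant \<delta>"
proof -
  obtain \<delta> where \<delta>: "delta_hyperbolic (graph_points G X H m) (point_dist G X H m) \<delta>"
    using rel_hyp unfolding relatively_hyperbolic_def by blast
  have "n \<le> nat \<lceil>\<delta>\<rceil>" if "real n \<le> \<delta>" for n using that by linarith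
  then show ?thesis
    using slim_triangle[OF \<delta>] unfolding slim_constant_def by (intro exI[of _ "nat \<lceil>\<delta>\<rceil>"]) blast
qed

lemma efficient_quasi_geodesic:
  "quasi_geodesic G X H m lam c p \<Longrightarrow> efficient p \<Longrightarrow> without_backtracking G H m p"
  by (simp add: quasi_geodesic_def efficient_without_backtracking)

lemma bcp_phase:
  assumes "1 \<le> lam" "0 \<le> c" "0 \<le> k"
  shows "\<exists>\<epsilon>::nat. \<forall>p q. quasi_geodesic G X H m lam c p \<and> quasi_geodesic G X H m lam c q \<and>
      efficient p \<and> efficient q \<and> similar G X k p q \<longrightarrow>
      (\<forall>u\<in>phase_vertices G m p. \<exists>v\<in>phase_vertices G m q. dist u v \<le> \<epsilon>)"
proof -
  have "BCP G X H m" using rel_hyp unfolding relatively_hyperbolic_def by (rule conjunct2)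
  note B = this[unfolded BCP_def, rule_format, OF assms]
  show ?thesis
    apply (rule ex_forward[OF B], elim conjE, intro allI impI)
    subgoal premises prems for \<epsilon> p q
      using mp[OF spec[OF spec[OF prems(2), of p], of q]] prems(3) efficient_quasi_geodesic by blast
    done
qed

lemma bcp_component:
  assumes "1 \<le> lam" "0 \<le> c" "0 \<le> k"
  shows "\<exists>\<epsilon>::nat. \<forall>p q. quasi_geodesic G X H m lam c p \<and> quasi_geodesic G X H m lam c q \<and>
      efficient p \<and> efficient q \<and> similar G X k p q \<longrightarrow>
      (\<forall>s. component m p s \<and> \<epsilon> < dist (path_vertex G p (fst s)) (path_vertex G p (snd s)) \<longrightarrow>
         (\<exists>t. connected_components G H m p s q t))"
proof -
  have "BCP G X H m" using rel_hyp unfolding relatively_hyperbolic_def by (rule conjunct2)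
  note B = this[unfolded BCP_def, rule_format, OF assms]
  show ?thesis
    apply (rule ex_forward[OF B], elim conjE, intro allI impI)
    subgoal premises prems for \<epsilon> p q s
      using mp[OF spec[OF spec[OF prems(2), of p], of q]] prems(3-) efficient_quasi_geodesic by blast
    done
qed

text \<open>All vertices of a geodesic are phase, because its components are single edges.\<close>

lemma geodesics_fellow_travel:
  obtains \<epsilon> :: nat where "\<And>f n u v g n' u' v' i. rel.geodesic f n u v \<Longrightarrow> rel.geodesic g n' u' v' \<Longrightarrow>
    dist u u' \<le> k \<Longrightarrow> dist v v' \<le> k \<Longrightarrow> i \<le> n \<Longrightarrow> \<exists>j\<le>n'. dist (f i) (g j) \<le> \<epsilon>"
proof -
  obtain \<epsilon> :: nat where \<epsilon>: "\<forall>p q. quasi_geodesic G X H m 1 0 p \<and> quasi_geodesic G X H m 1 0 q \<and>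
      efficient p \<and> efficient q \<and> similar G X (real k) p q \<longrightarrow>
      (\<forall>u\<in>phase_vertices G m p. \<exists>v\<in>phase_vertices G m q. dist u v \<le> \<epsilon>)"
    by (rule exE[OF bcp_phase[OF order_refl order_refl of_nat_0_le_iff]])
  have "\<exists>j\<le>n'. dist (f i) (g j) \<le> \<epsilon>" if f: "rel.geodesic f n u v" and g: "rel.geodesic g n' u' v'"
    and k: "dist u u' \<le> k" "dist v v' \<le> k" and i: "i \<le> n" for f n u v g n' u' v' i
  proof -
    note wf = walk_path_simps[OF geodesic_walk[OF f]] and wg = walk_path_simps[OF geodesic_walk[OF g]]
    have "similar G X (real k) (walk_path f n) (walk_path g n')"
      using k rel.geodesicD(1,2)[OF f] rel.geodesicD(1,2)[OF g]
      unfolding similar_def wf(4,5) wg(4,5) by simp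
    then have "\<forall>u\<in>phase_vertices G m (walk_path f n). \<exists>v\<in>phase_vertices G m (walk_path g n'). dist u v \<le> \<epsilon>"
      using \<epsilon> geodesic_walk_path(2)[OF f] geodesic_walk_path(2)[OF g] geodesic_efficient[OF f]
        geodesic_efficient[OF g] by blast
    moreover have "f i \<in> phase_vertices G m (walk_path f n)"
      using efficient_phase[OF wf(1) geodesic_efficient[OF f]] wf(2,3) i by (metis atMost_iff image_eqI)
    ultimately obtain v where "v \<in> phase_vertices G m (walk_path g n')" "dist (f i) v \<le> \<epsilon>" by blast
    then show ?thesis
      using efficient_phase[OF wg(1) geodesic_efficient[OF g]] wg(2,3) by auto
  qed
  then show ?thesis using that by blast
qed

definition stays_near :: "'a set \<Rightarrow> nat \<Rightarrow> nat \<Rightarrow> bool" where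
  "stays_near Q k \<sigma> \<longleftrightarrow> (\<forall>f n a b u q q' i. rel.geodesic f n a b \<and> u \<in> carrier G \<and> q \<in> Q \<and> q' \<in> Q \<and>
     dist a (u \<otimes> q) \<le> k \<and> dist b (u \<otimes> q') \<le> k \<and> i \<le> n \<longrightarrow> (\<exists>w\<in>Q. dist (f i) (u \<otimes> w) \<le> \<sigma>))"

lemma stays_nearD:
  assumes "stays_near Q k \<sigma>" "rel.geodesic f n a b" "u \<in> carrier G" "q \<in> Q" "q' \<in> Q"
    "dist a (u \<otimes> q) \<le> k" "dist b (u \<otimes> q') \<le> k" "i \<le> n"
  shows "\<exists>w\<in>Q. dist (f i) (u \<otimes> w) \<le> \<sigma>"
  using assms unfolding stays_near_def by blast

lemma stays_near_mono:
  assumes "stays_near Q k \<sigma>" "\<sigma> \<le> \<sigma>'" shows "stays_near Q k \<sigma>'"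
  using assms unfolding stays_near_def by (meson order_trans)

text \<open>A geodesic with ends near \<open>u Q\<close> travels along a geodesic with ends in \<open>u Q\<close>, and the latter is a
  translate of a geodesic with ends in \<open>Q\<close>.\<close>

lemma quasiconvex_stable:
  assumes Q: "relatively_quasiconvex G X H m Q"
  shows "\<exists>\<sigma>. stays_near Q k \<sigma>"
proof -
  obtain s :: real where Qc: "Q \<subseteq> carrier G" and s: "quasiconvex G X H m s Q"
    using Q subgroup.subset unfolding relatively_quasiconvex_def by blast
  obtain \<epsilon> where \<epsilon>: "\<And>f n u v g n' u' v' i. rel.geodesic f n u v \<Longrightarrow> rel.geodesic g n' u' v' \<Longrightarrow>
    dist u u' \<le> k \<Longrightarrow> dist v v' \<le> k \<Longrightarrow> i \<le> n \<Longrightarrow> \<exists>j\<le>n'. dist (f i) (g j) \<le> \<epsilon>"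
    using geodesics_fellow_travel[of k] by blast
  have "\<exists>w\<in>Q. dist (f i) (u \<otimes> w) \<le> \<epsilon> + nat \<lceil>s\<rceil>" if f: "rel.geodesic f n a b" and u: "u \<in> carrier G"
    and q: "q \<in> Q" "q' \<in> Q" and k: "dist a (u \<otimes> q) \<le> k" "dist b (u \<otimes> q') \<le> k" and i: "i \<le> n"
  for f n a b u q q' i
  proof -
    have qc: "q \<in> carrier G" "q' \<in> carrier G" using q Qc by auto
    then obtain g where g: "rel.geodesic g (d q q') q q'" using rel.geodesic_exists by blast
    note wg = walk_path_simps[OF geodesic_walk[OF g]]
    have ug: "rel.geodesic (\<lambda>i. u \<otimes> g i) (d q q') (u \<otimes> q) (u \<otimes> q')"
      using g u unfolding rel.geodesic_def by (auto simp: rel.dist_translate)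
    obtain j where j: "j \<le> d q q'" "dist (f i) (u \<otimes> g j) \<le> \<epsilon>" using \<epsilon>[OF f ug k i] by blast
    have "path_start G (walk_path g (d q q')) = q" "path_end G (walk_path g (d q q')) = q'"
      using wg(4,5) rel.geodesicD(1,2)[OF g] by auto
    then have "\<forall>l\<le>path_length (walk_path g (d q q')). \<exists>w\<in>Q.
        real (dist (path_vertex G (walk_path g (d q q')) l) w) \<le> s"
      using s geodesic_walk_path(1)[OF g] q unfolding quasiconvex_def by blast
    then obtain w where w: "w \<in> Q" "real (dist (g j) w) \<le> s"
      unfolding wg(2) using j(1) wg(3)[OF j(1)] by auto
    have c: "g j \<in> carrier G" "f i \<in> carrier G" "w \<in> carrier G"
      using rel.geodesicD(3)[OF g j(1)] rel.geodesicD(3)[OF f i] w Qc by auto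
    have "dist (f i) (u \<otimes> w) \<le> dist (f i) (u \<otimes> g j) + dist (u \<otimes> g j) (u \<otimes> w)"
      using dist_triangle u c by simp
    also have "dist (u \<otimes> g j) (u \<otimes> w) = dist (g j) w" using dist_translate u c by simp
    also have "\<dots> \<le> nat \<lceil>s\<rceil>" using w(2) by linarith
    finally have "dist (f i) (u \<otimes> w) \<le> \<epsilon> + nat \<lceil>s\<rceil>" using j(2) by linarith
    then show ?thesis using w(1) by blast
  qed
  then show ?thesis unfolding stays_near_def by blast
qed

definition left_coset :: "nat \<Rightarrow> 'a set \<Rightarrow> bool" where
  "left_coset i C \<longleftrightarrow> i \<in> {1..m} \<and> (\<exists>c\<in>carrier G. C = c <# H i)"

lemma left_cosetD:
  assumes "left_coset i C"
  shows "i \<in> {1..m}" "C \<subseteq> carrier G" "C \<noteq> {}"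
    "\<And>u v. u \<in> C \<Longrightarrow> v \<in> C \<Longrightarrow> inv u \<otimes> v \<in> H i"
    "\<And>u v. u \<in> C \<Longrightarrow> v \<in> carrier G \<Longrightarrow> inv u \<otimes> v \<in> H i \<Longrightarrow> v \<in> C"
    "\<And>u v. u \<in> C \<Longrightarrow> v \<in> C \<Longrightarrow> d u v \<le> 1"
proof -
  obtain c where i: "i \<in> {1..m}" and c: "c \<in> carrier G" "C = c <# H i"
    using assms unfolding left_coset_def by blast
  note sub = H_subgroup[OF i]
  show "i \<in> {1..m}" by fact
  show C: "C \<subseteq> carrier G" using c H_carrier[OF i] by (auto simp: l_coset_def)
  show "C \<noteq> {}" using c subgroup.one_closed[OF sub] by (auto simp: l_coset_def)
  show diff: "inv u \<otimes> v \<in> H i" if "u \<in> C" "v \<in> C" for u v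
    using common_coset[OF i c(1)] that c(2) by blast
  show "v \<in> C" if u: "u \<in> C" and v: "v \<in> carrier G" "inv u \<otimes> v \<in> H i" for u v
  proof -
    obtain a where a: "a \<in> H i" "u = c \<otimes> a" using u c(2) by (auto simp: l_coset_def)
    have ac: "a \<in> carrier G" using a H_carrier[OF i] by auto
    have "v = c \<otimes> (a \<otimes> (inv u \<otimes> v))"
      unfolding a(2) using ac c(1) v(1) by (simp add: group_word_simps)
    then show ?thesis using c(2) subgroup.m_closed[OF sub a(1) v(2)] by (auto simp: l_coset_def)
  qed
  show "d u v \<le> 1" if "u \<in> C" "v \<in> C" for u v
    using d_le_1_H[OF i diff[OF that]] .
qed

lemma single_edge_path:
  assumes i: "i \<in> {1..m}" and y: "y \<in> carrier G" "y' \<in> carrier G" "inv y \<otimes> y' \<in> H i" "y \<noteq> y'"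
  defines "e \<equiv> (y, [HLet i (inv y \<otimes> y')])"
  shows "is_path G X H m e" "path_length e = 1" "path_vertex G e 0 = y" "path_vertex G e 1 = y'"
    "efficient e" "0 \<le> c \<Longrightarrow> quasi_geodesic G X H m 1 c e" "path_start G e = y" "path_end G e = y'"
    "H_component i e (0, 1)" "H_component j e s \<Longrightarrow> j = i"
proof -
  have ne: "inv y \<otimes> y' \<noteq> \<one>" using y mult_inv_cancel[of y y'] by auto
  show p: "is_path G X H m e"
    using i y ne unfolding is_path_def e_def by (auto simp: alphabet_def)
  show l: "path_length e = 1" by (simp add: path_length_def e_def)
  show v0: "path_vertex G e 0 = y" by (simp add: path_vertex_def e_def)
  show v1: "path_vertex G e 1 = y'" using y by (simp add: path_vertex_def e_def mult_inv_cancel)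
  show "path_start G e = y" "path_end G e = y'"
    unfolding path_start_def path_end_def l v0 v1 by auto
  show "efficient e" unfolding efficient_def l by auto
  have "d y y' \<noteq> 0" using rel.dist_eq_0 y by simp
  then show "quasi_geodesic G X H m 1 c e" if "0 \<le> c"
    unfolding quasi_geodesic_iff[OF p] l
  proof (intro allI impI)
    fix i j :: nat assume ij: "i \<le> j \<and> j \<le> 1"
    show "real (j - i) \<le> 1 * real (d (path_vertex G e i) (path_vertex G e j)) + c"
    proof (cases "i = j")
      case False
      then have "i = 0" "j = 1" using ij by auto
      then show ?thesis using \<open>d y y' \<noteq> 0\<close> that v0 v1 by simp
    qed (use that in simp)
  qed
  show "H_component i e (0, 1)"
    unfolding H_component_def H_subpath_def l by (auto simp: e_def)
  show "j = i" if "H_component j e s"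
  proof -
    have "fst s < snd s" "snd s \<le> 1" "\<forall>n\<in>{fst s..<snd s}. \<exists>a. snd e ! n = HLet j a"
      using that l unfolding H_component_def H_subpath_def by auto
    moreover then have "0 \<in> {fst s..<snd s}" by auto
    ultimately show ?thesis unfolding e_def by fastforce
  qed
qed

text \<open>The steps of a walk from \<open>y\<close> to \<open>y'\<close> around a coset \<open>C\<close> that contains both: \<open>C\<close> is met only at the ends,
  and the direct step from \<open>y\<close> to \<open>y'\<close> is not allowed.\<close>

definition detour :: "'a set \<Rightarrow> 'a \<Rightarrow> 'a \<Rightarrow> ('a \<times> 'a) set" where
  "detour C y y' = {(u, v). u \<in> carrier G \<and> v \<in> carrier G \<and> d u v = 1 \<and> \<not> (u \<in> C \<and> v \<in> C) \<and>
     {u, v} \<inter> C \<subseteq> {y, y'}}"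

text \<open>The bridge from bounded coset penetration to geometry. A shortest detour has no shortcuts except
  possibly the forbidden step from \<open>y\<close> to \<open>y'\<close>, so it is efficient. Being of bounded length, it is
  a quasi-geodesic. If \<open>y\<close> and \<open>y'\<close> were far apart, the edge from \<open>y\<close> to \<open>y'\<close> would be connected to a
  component of the detour, which would then make a step inside \<open>C\<close>.\<close>

lemma detour_bound:
  obtains \<epsilon> :: nat where "\<And>i C y y' n. left_coset i C \<Longrightarrow> y \<in> C \<Longrightarrow> y' \<in> C \<Longrightarrow> n \<le> L \<Longrightarrow>
    (y, y') \<in> detour C y y' ^^ n \<Longrightarrow> dist y y' \<le> \<epsilon>"
proof -
  obtain \<epsilon> :: nat where \<epsilon>0: "\<forall>p q. quasi_geodesic G X H m 1 (real L) p \<and> quasi_geodesic G X H m 1 (real L) q \<and>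
      efficient p \<and> efficient q \<and> similar G X 0 p q \<longrightarrow>
      (\<forall>s. component m p s \<and> \<epsilon> < dist (path_vertex G p (fst s)) (path_vertex G p (snd s)) \<longrightarrow>
         (\<exists>t. connected_components G H m p s q t))"
    by (rule exE[OF bcp_component[OF order_refl of_nat_0_le_iff order_refl]])
  then have \<epsilon>: "\<exists>t. connected_components G H m p s q t"
    if "quasi_geodesic G X H m 1 (real L) p" "quasi_geodesic G X H m 1 (real L) q"
      "efficient p" "efficient q" "similar G X 0 p q" "component m p s"
      "\<epsilon> < dist (path_vertex G p (fst s)) (path_vertex G p (snd s))" for p q s
    using that by blast
  have "dist y y' \<le> \<epsilon>" if C: "left_coset i C" and y: "y \<in> C" "y' \<in> C" and n: "n \<le> L"
    and det: "(y, y') \<in> detour C y y' ^^ n" for i C y y' n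
  proof (rule ccontr)
    assume far: "\<not> dist y y' \<le> \<epsilon>"
    note i = left_cosetD(1)[OF C]
    let ?E = "detour C y y'"
    have yc: "y \<in> carrier G" "y' \<in> carrier G" using y left_cosetD(2)[OF C] by auto
    have ne: "y \<noteq> y'" using far yc by auto
    have yH: "inv y \<otimes> y' \<in> H i" using left_cosetD(4)[OF C y] .
    define N where "N = (LEAST n. (y, y') \<in> ?E ^^ n)"
    have NE: "(y, y') \<in> ?E ^^ N" and Nle: "\<And>k. (y, y') \<in> ?E ^^ k \<Longrightarrow> N \<le> k"
      using LeastI[of "\<lambda>n. (y, y') \<in> ?E ^^ n", OF det] Least_le[of "\<lambda>n. (y, y') \<in> ?E ^^ n"]
      unfolding N_def by auto
    have NL: "N \<le> L" using Nle[OF det] n by simp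
    obtain f where f: "f 0 = y" "f N = y'" "\<And>k. k < N \<Longrightarrow> (f k, f (Suc k)) \<in> ?E"
      using NE unfolding relpow_fun_conv by blast
    have sub: "(f a, f b) \<in> ?E ^^ (b - a)" if "a \<le> b" "b \<le> N" for a b
      unfolding relpow_fun_conv by (rule exI[of _ "\<lambda>k. f (a + k)"]) (use f(3) that in auto)
    have short: "b - a \<le> k" if "a \<le> b" "b \<le> N" "(f a, f b) \<in> ?E ^^ k" for a b k
    proof -
      have "(f 0, f b) \<in> ?E ^^ (a + k)" using sub[of 0 a] that by (auto simp: relpow_add)
      then have "(f 0, f N) \<in> ?E ^^ (a + k + (N - b))"
        using sub[of b N] that by (subst relpow_add) auto
      then show ?thesis using Nle f that by force
    qed
    have inj: "a = b" if "f a = f b" "a \<le> N" "b \<le> N" for a b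
    proof -
      have "(f a, f b) \<in> ?E ^^ 0" "(f b, f a) \<in> ?E ^^ 0" using that(1) by simp_all
      then show ?thesis
        using short[of a b 0] short[of b a 0] that(2,3) by linarith
    qed
    have fc: "f k \<in> carrier G \<and> (f k \<in> C \<longrightarrow> f k \<in> {y, y'})" if "k \<le> N" for k
      using that f(2) yc f(3)[of k] by (cases "k = N") (auto simp: detour_def)
    have w: "walk f N" using fc f(3) by (auto simp: walk_def detour_def)
    note wp = walk_path_simps[OF w]
    let ?p = "walk_path f N"
    have qg: "quasi_geodesic G X H m 1 (real L) ?p"
      unfolding quasi_geodesic_iff[OF wp(1)] wp(2) using NL by auto
    have stend: "path_start G ?p = y" "path_end G ?p = y'" using wp(4,5) f by auto
    \<comment> \<open>The subgroup \<open>H i\<close> and another \<open>H j\<close> cannot share a long element: compare the two edges.\<close>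
    have other: "False" if j: "j \<in> {1..m}" "inv y \<otimes> y' \<in> H j" "j \<noteq> i" for j
    proof -
      note ei = single_edge_path[OF i yc yH ne] and ej = single_edge_path[OF j(1) yc j(2) ne]
      have "similar G X 0 (y, [HLet i (inv y \<otimes> y')]) (y, [HLet j (inv y \<otimes> y')])"
        unfolding similar_def ei(7,8) ej(7,8) using yc by simp
      moreover have "component m (y, [HLet i (inv y \<otimes> y')]) (0, 1)"
        using ei(9) i unfolding component_def by blast
      ultimately obtain t where
        "connected_components G H m (y, [HLet i (inv y \<otimes> y')]) (0, 1) (y, [HLet j (inv y \<otimes> y')]) t"
        using \<epsilon>[OF ei(6) ej(6) ei(5) ej(5), of "(0, 1)"] far ei(3,4) by auto
      then show False using ei(10) ej(10) j(3) unfolding connected_components_def by metis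
    qed
    have coset_step: False if a: "a < N" "f a \<in> C" "f (Suc a) \<in> C" for a
      using f(3)[OF a(1)] a by (auto simp: detour_def)
    have eff: "efficient ?p"
      unfolding efficient_def wp(2)
    proof (intro ballI allI impI, elim conjE)
      fix j a b x
      assume j: "j \<in> {1..m}" and ab: "a < b" "b \<le> N" and x: "snd ?p ! a = HLet j x"
        and "inv (path_vertex G ?p a) \<otimes> path_vertex G ?p b \<in> H j"
      then have fab: "inv (f a) \<otimes> f b \<in> H j" using wp(3) by simp
      have "f a \<noteq> f b" using inj[of a b] ab by auto
      then have d1: "d (f a) (f b) = 1"
        using d_le_1_H[OF j fab] rel.dist_eq_0[of "f a" "f b"] fc[of a] fc[of b] ab by linarith
      show "b = Suc a"
      \<comment> \<open>A shortcut inside \<open>C\<close> joins the ends of the walk; it would have to be labelled by \<open>H i\<close>.\<close>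
      proof (cases "f a \<in> C \<and> f b \<in> C")
        case False
        then have "(f a, f b) \<in> ?E ^^ 1" using d1 fc[of a] fc[of b] ab by (auto simp: detour_def)
        then show ?thesis using short[of a b 1] ab by simp
      next
        case True
        then have "f a \<in> {f 0, f N}" "f b \<in> {f 0, f N}" using fc[of a] fc[of b] ab f(1,2) by auto
        then have "a \<in> {0, N}" "b \<in> {0, N}" using inj[of a 0] inj[of a N] inj[of b 0] inj[of b N] ab by auto
        then have "a = 0" "b = N" using ab by auto
        then have "j = i" using other[OF j] fab f(1,2) by auto
        have aN: "a < path_length ?p" using wp(2) ab by simp
        have "letter_val (snd ?p ! a) \<in> H i"
          using path_letter(1)[OF wp(1) aN] x \<open>j = i\<close> by (auto simp: alphabet_def)
        then have "inv (f a) \<otimes> f (Suc a) \<in> H i"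
          using path_letter(3)[OF wp(1) aN] wp(3) ab by simp
        then have "f (Suc a) \<in> C" using left_cosetD(5)[OF C] True fc[of "Suc a"] ab by auto
        then show ?thesis using coset_step[of a] True ab by auto
      qed
    qed
    note ei = single_edge_path[OF i yc yH ne]
    let ?e = "(y, [HLet i (inv y \<otimes> y')])"
    have "similar G X 0 ?e ?p"
      unfolding similar_def ei(7,8) stend using yc by simp
    moreover have "component m ?e (0, 1)"
      using ei(9) i unfolding component_def by blast
    ultimately obtain t where "connected_components G H m ?e (0, 1) ?p t"
      using \<epsilon>[OF ei(6) qg ei(5) eff, of "(0, 1)"] far ei(3,4) by auto
    then obtain k g where k: "k \<in> {1..m}" "H_component k ?e (0, 1)" "H_component k ?p t" and g: "g \<in> carrier G"
      "path_vertex G ?e ` {fst (0::nat, 1::nat)..snd (0::nat, 1::nat)} \<union> path_vertex G ?p ` {fst t..snd t} \<subseteq> g <# H k"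
      unfolding connected_components_def by (elim bexE conjE)
    have ki: "k = i" using ei(10) k(2) by blast
    have t: "fst t < snd t" "snd t \<le> N" using k(3) wp(2) by (auto simp: H_component_def H_subpath_def)
    have gC: "v \<in> C" if "v \<in> g <# H k" "v \<in> carrier G" for v
    proof -
      have "path_vertex G ?e 0 \<in> g <# H k" using g(2) by (auto simp: subset_eq)
      then show ?thesis
        using left_cosetD(5)[OF C y(1) that(2)] common_coset[OF k(1) g(1), of y v] that ei(3) ki by auto
    qed
    have "f v \<in> C" if "fst t \<le> v" "v \<le> snd t" for v
    proof -
      have "path_vertex G ?p v \<in> g <# H k" using g(2) that by (auto simp: subset_eq)
      then show ?thesis using gC[of "f v"] wp(3)[of v] fc[of v] that t by auto
    qed
    then show False using coset_step[of "fst t"] t by auto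
  qed
  then show ?thesis using that by blast
qed

end

section \<open>Entries into peripheral cosets\<close>

context relative_cayley begin

text \<open>Nearest points of \<open>C\<close> are entries, but an entry may be farther away by one. Entries
  have the advantage that every geodesic that reaches \<open>C\<close> exhibits one.\<close>

definition entry :: "'a set \<Rightarrow> 'a \<Rightarrow> 'a \<Rightarrow> bool" where
  "entry C x y \<longleftrightarrow> y \<in> C \<and> (\<exists>f n. rel.geodesic f n x y \<and> (\<forall>i<n. f i \<notin> C))"

lemma entry_carrier: "entry C x y \<Longrightarrow> x \<in> carrier G \<and> y \<in> carrier G \<and> y \<in> C"
  unfolding entry_def using rel.geodesicD(4,5) by blast

lemma entry_inside: "entry C x y \<Longrightarrow> x \<in> C \<Longrightarrow> y = x"
  unfolding entry_def using rel.geodesicD(1,2) by (metis gr0I)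

lemma first_entry:
  assumes f: "rel.geodesic f n x z" and k: "k \<le> n" "f k \<in> C"
  obtains j where "j \<le> k" "entry C x (f j)" "\<And>i. i < j \<Longrightarrow> f i \<notin> C"
proof -
  define j where "j = (LEAST j. f j \<in> C)"
  have j: "f j \<in> C" "j \<le> k" "\<And>i. i < j \<Longrightarrow> f i \<notin> C"
    using LeastI[of "\<lambda>j. f j \<in> C", OF k(2)] Least_le[of "\<lambda>j. f j \<in> C", OF k(2)] not_less_Least
    unfolding j_def by auto
  have "rel.geodesic f j x (f j)"
    using rel.geodesic_sub[OF f, of 0 j] j(2) k(1) rel.geodesicD(1)[OF f] by simp
  then show ?thesis using that[of j] j unfolding entry_def by blast
qed

lemma last_entry:
  assumes f: "rel.geodesic f n x z" and k: "k \<le> n" "f k \<in> C"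
  obtains j where "k \<le> j" "j \<le> n" "entry C z (f j)" "\<And>i. j < i \<Longrightarrow> i \<le> n \<Longrightarrow> f i \<notin> C"
proof -
  obtain j where j: "j \<le> n - k" "entry C z (f (n - j))" "\<And>i. i < j \<Longrightarrow> f (n - i) \<notin> C"
    using first_entry[OF rel.geodesic_rev[OF f], of "n - k" C] k by auto
  show ?thesis
  proof (rule that[of "n - j"])
    show "f i \<notin> C" if "n - j < i" "i \<le> n" for i
      using j(3)[of "n - i"] that by auto
  qed (use j k in auto)
qed

lemma entry_exists:
  assumes "x \<in> carrier G" "C \<subseteq> carrier G" "C \<noteq> {}"
  obtains y where "entry C x y"
proof -
  obtain z where z: "z \<in> C" "z \<in> carrier G" using assms by auto
  obtain f where f: "rel.geodesic f (d x z) x z" using rel.geodesic_exists assms(1) z(2) .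
  then show ?thesis using first_entry[OF f order_refl, of C] rel.geodesicD(2)[OF f] z that by metis
qed

text \<open>Unlike \<open>detour\<close>, this relation can be composed freely, as it does not depend on the ends of a
  walk.\<close>

definition avoiding :: "'a set \<Rightarrow> ('a \<times> 'a) set" where
  "avoiding C = {(u, v). u \<in> carrier G \<and> v \<in> carrier G \<and> d u v = 1 \<and> u \<notin> C \<and> v \<notin> C}"

definition reach :: "'a set \<Rightarrow> nat \<Rightarrow> 'a \<Rightarrow> 'a \<Rightarrow> bool" where
  "reach C n u v \<longleftrightarrow> u \<in> carrier G \<and> v \<in> carrier G \<and> (\<exists>k\<le>n. (u, v) \<in> avoiding C ^^ k)"

lemma reach_mono: "reach C n u v \<Longrightarrow> n \<le> n' \<Longrightarrow> reach C n' u v"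
  unfolding reach_def using order_trans by blast

lemma reach_trans:
  assumes "reach C n u v" "reach C k v w"
  shows "reach C (n + k) u w"
proof -
  obtain a b where "a \<le> n" "b \<le> k" "(u, v) \<in> avoiding C ^^ a" "(v, w) \<in> avoiding C ^^ b"
    using assms unfolding reach_def by blast
  then have "(u, w) \<in> avoiding C ^^ (a + b)" "a + b \<le> n + k" by (auto simp: relpow_add)
  then show ?thesis using assms unfolding reach_def by blast
qed

lemma reach_sym:
  assumes "reach C n u v"
  shows "reach C n v u"
proof -
  have "sym (avoiding C)" using rel.dist_sym by (auto simp: sym_def avoiding_def)
  then have "sym (avoiding C ^^ k)" for k
    by (induction k) (auto simp: sym_def relpow_commute, metis relpow_Suc_I2 relpow.simps(2) relcompI)
  then show ?thesis using assms unfolding reach_def by (meson symD)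
qed

lemma reach_geodesic:
  assumes f: "rel.geodesic f n u v" and ab: "a \<le> b" "b \<le> n" and "\<And>i. a \<le> i \<Longrightarrow> i \<le> b \<Longrightarrow> f i \<notin> C"
  shows "reach C (b - a) (f a) (f b)"
proof -
  have "(f a, f b) \<in> avoiding C ^^ (b - a)"
    unfolding relpow_fun_conv
    by (rule exI[of _ "\<lambda>i. f (a + i)"])
      (use assms rel.geodesicD(3,7)[OF f] in \<open>auto simp: avoiding_def\<close>)
  then show ?thesis using rel.geodesicD(3)[OF f] ab unfolding reach_def by auto
qed

lemma reach_geodesic':
  assumes f: "rel.geodesic f n u v" and "a \<le> n" "b \<le> n" and "\<And>i. i \<le> n \<Longrightarrow> f i \<notin> C"
  shows "reach C (d (f a) (f b)) (f a) (f b)"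
proof (cases "a \<le> b")
  case True
  then show ?thesis using reach_geodesic[OF f, of a b C] assms rel.geodesicD(7)[OF f] by simp
next
  case False
  then show ?thesis
    using reach_sym[OF reach_geodesic[OF f, of b a C]] assms rel.geodesicD(7)[OF f, of b a]
      rel.dist_sym rel.geodesicD(3)[OF f] by simp
qed

lemma reach_dist:
  assumes "reach C n u v" shows "d u v \<le> n"
proof -
  have "(u, v) \<in> avoiding C ^^ k \<Longrightarrow> u \<in> carrier G \<Longrightarrow> v \<in> carrier G \<Longrightarrow> d u v \<le> k" for k
  proof (induction k arbitrary: v)
    case (Suc k)
    then obtain w where w: "(u, w) \<in> avoiding C ^^ k" "(w, v) \<in> avoiding C" by auto
    then have "w \<in> carrier G" "d w v = 1" by (auto simp: avoiding_def)
    then show ?case using Suc.IH[OF w(1)] Suc.prems rel.dist_triangle[of u w v] by simp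
  qed simp
  then show ?thesis using assms unfolding reach_def by fastforce
qed

end

context relatively_hyperbolic_group begin

text \<open>In a quadrilateral with vertices \<open>x\<close>, \<open>y\<close>, \<open>y'\<close>, \<open>x'\<close> and \<open>y, y' \<in> C\<close>, go from \<open>y\<close> towards \<open>x\<close> until the
  distance from \<open>C\<close> exceeds \<open>2 \<delta>\<close>, if possible. The point \<open>u\<close> that is reached is at distance at
  most \<open>2 \<delta>\<close> from one of the other sides, but it is too far from the side \<open>y y'\<close>. So a short walk outside \<open>C\<close>
  leads either to the side \<open>x x'\<close>, or to the opposite side and along it to the neighbour
  of \<open>y'\<close>.\<close>

lemma corner:
  assumes slim: "slim_constant \<delta>"
    and C: "left_coset i C" and s: "rel.geodesic s n x x'" "\<And>j. j \<le> n \<Longrightarrow> s j \<notin> C"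
    and f: "rel.geodesic f (Suc a) x y" "y \<in> C" "\<And>j. j \<le> a \<Longrightarrow> f j \<notin> C"
    and g: "rel.geodesic g (Suc b) x' y'" "y' \<in> C" "\<And>j. j \<le> b \<Longrightarrow> g j \<notin> C"
  shows "reach C (8 * \<delta> + 6) (f a) (g b) \<or> (\<exists>j\<le>n. reach C (4 * \<delta> + 2) (f a) (s j))"
proof (cases "a < 2 * \<delta> + 2")
  case True
  have "reach C a (f 0) (f a)" using reach_geodesic[OF f(1), of 0 a C] f(3) by simp
  then have "reach C a (f a) (s 0)"
    using reach_sym rel.geodesicD(1)[OF f(1)] rel.geodesicD(1)[OF s(1)] by metis
  then have "reach C (4 * \<delta> + 2) (f a) (s 0)" using True by (elim reach_mono) simp
  then show ?thesis by blast
next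
  case False
  \<comment> \<open>Elements of \<open>C\<close> are at distance at most 1 from \<open>y\<close>, so \<open>d (f u) y = 2 \<delta> + 2\<close> keeps \<open>f u\<close> at distance more than \<open>2 \<delta>\<close> from \<open>C\<close>.\<close>
  define u where "u = Suc a - (2 * \<delta> + 2)"
  note fc = rel.geodesicD(3)[OF f(1)] and gc = rel.geodesicD(3)[OF g(1)] and sc = rel.geodesicD(3)[OF s(1)]
  have y: "y \<in> carrier G" "y' \<in> carrier G" "x \<in> carrier G" "f u \<in> carrier G"
    using rel.geodesicD(4,5)[OF f(1)] rel.geodesicD(5)[OF g(1)] fc[of u] by (auto simp: u_def)
  have uy: "d (f u) y = 2 * \<delta> + 2"
    using rel.geodesicD(7)[OF f(1), of u "Suc a"] rel.geodesicD(2)[OF f(1)] False by (simp add: u_def)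
  have far: "2 * \<delta> < d (f u) c" if "c \<in> C" for c
  proof -
    have "c \<in> carrier G" using left_cosetD(2)[OF C] that by auto
    then show ?thesis
      using rel.dist_triangle[of "f u" c y] y uy left_cosetD(6)[OF C that f(2)] by linarith
  qed
  have fu: "reach C (2 * \<delta> + 1) (f a) (f u)"
    using reach_sym[OF reach_geodesic[OF f(1), of u a C]] f(3) False by (simp add: u_def)
  have short: "reach C (2 * \<delta>) (f u) w" if w: "w \<in> carrier G" "d (f u) w \<le> 2 * \<delta>" for w
  proof -
    obtain h where h: "rel.geodesic h (d (f u) w) (f u) w" using rel.geodesic_exists y(4) w(1) .
    have "h j \<notin> C" if "j \<le> d (f u) w" for j
      using far[of "h j"] rel.geodesicD(7)[OF h, of 0 j] rel.geodesicD(1)[OF h] w(2) that by auto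
    then have "reach C (d (f u) w) (f u) w"
      using reach_geodesic[OF h, of 0 "d (f u) w" C] rel.geodesicD(1,2)[OF h] by simp
    then show ?thesis using w(2) by (elim reach_mono)
  qed
  obtain e where e: "rel.geodesic e (d y y') y y'" using rel.geodesic_exists y(1,2) .
  obtain k where k: "rel.geodesic k (d y' x) y' x" using rel.geodesic_exists y(2,3) .
  have near: "(\<exists>w j. w = s j \<and> j \<le> n \<and> d (f u) w \<le> 2 * \<delta>) \<or> (\<exists>w j. w = g j \<and> j \<le> Suc b \<and> d (f u) w \<le> 2 * \<delta>)"
  proof -
    have "\<not> (\<exists>j\<le>d y y'. d (f u) (e j) \<le> \<delta>)"
    proof
      assume "\<exists>j\<le>d y y'. d (f u) (e j) \<le> \<delta>"
      then obtain j where j: "j \<le> d y y'" "d (f u) (e j) \<le> \<delta>" by blast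
      moreover have "d y (e j) = j"
        using rel.geodesicD(7)[OF e, of 0 j] rel.geodesicD(1)[OF e] j by simp
      moreover have "e j \<in> carrier G" using rel.geodesicD(3)[OF e j(1)] .
      ultimately show False
        using rel.dist_triangle[of "f u" "e j" y] rel.dist_sym[of y "e j"] y uy
          left_cosetD(6)[OF C f(2) g(2)] by linarith
    qed
    then obtain j where j: "j \<le> d y' x" "d (f u) (k j) \<le> \<delta>"
      using slim_constantD[OF slim f(1) e k, of u] unfolding u_def by (meson diff_le_self)
    have kc: "k j \<in> carrier G" using rel.geodesicD(3)[OF k j(1)] .
    consider l where "l \<le> n" "d (k j) (s l) \<le> \<delta>" | l where "l \<le> Suc b" "d (k j) (g l) \<le> \<delta>"
      using slim_constantD[OF slim k s(1) g(1) j(1)] by blast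
    then show ?thesis
    proof cases
      case 1
      then have "d (f u) (s l) \<le> 2 * \<delta>"
        using rel.dist_triangle[OF y(4) kc sc[of l]] j by simp
      then show ?thesis using 1 by blast
    next
      case 2
      then have "d (f u) (g l) \<le> 2 * \<delta>"
        using rel.dist_triangle[OF y(4) kc gc[of l]] j by simp
      then show ?thesis using 2 by blast
    qed
  qed
  then show ?thesis
  proof (elim disjE exE conjE)
    fix w j assume w: "w = s j" "j \<le> n" "d (f u) w \<le> 2 * \<delta>"
    then have "reach C (2 * \<delta> + 1 + 2 * \<delta>) (f a) (s j)"
      using reach_trans[OF fu short[of w]] sc by simp
    then have "reach C (4 * \<delta> + 2) (f a) (s j)" by (elim reach_mono) simp
    then show ?thesis using w(2) by blast
  next
    fix w j assume w: "w = g j" "j \<le> Suc b" "d (f u) w \<le> 2 * \<delta>"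
    have wc: "w \<in> carrier G" using gc w by simp
    have "w \<notin> C" using far[of w] w by auto
    then have jb: "j \<le> b" using w rel.geodesicD(2)[OF g(1)] g(2) by (metis le_SucE)
    have "d w y' = Suc b - j" using rel.geodesicD(7)[OF g(1), of j "Suc b"] rel.geodesicD(2)[OF g(1)] w by simp
    moreover have "d w y' \<le> d w (f u) + d (f u) y + d y y'"
      using rel.dist_triangle[of w "f u" y'] rel.dist_triangle[of "f u" y y'] wc y by linarith
    ultimately have l: "b - j \<le> 4 * \<delta> + 2"
      using uy w(3) left_cosetD(6)[OF C f(2) g(2)] rel.dist_sym[OF wc y(4)] by linarith
    have "reach C (b - j) w (g b)" using reach_geodesic[OF g(1) jb, of C] g(3) w(1) by simp
    then have "reach C (2 * \<delta> + 1 + 2 * \<delta> + (b - j)) (f a) (g b)"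
      using reach_trans[OF reach_trans[OF fu short[OF wc w(3)]]] by blast
    then have "reach C (8 * \<delta> + 6) (f a) (g b)" using l by (elim reach_mono) simp
    then show ?thesis by blast
  qed
qed

text \<open>Coarsely, a geodesic that avoids a coset has a bounded projection to it.\<close>

definition projection_constant :: "nat \<Rightarrow> bool" where
  "projection_constant \<kappa> \<longleftrightarrow> (\<forall>i C x x' y y' s n. left_coset i C \<and> entry C x y \<and> entry C x' y' \<and>
     rel.geodesic s n x x' \<and> (\<forall>j\<le>n. s j \<notin> C) \<longrightarrow> dist y y' \<le> \<kappa>)"

text \<open>By \<open>corner\<close>, applied at \<open>y\<close> and at \<open>y'\<close>, the neighbours of \<open>y\<close> and \<open>y'\<close> can be joined by a walk of
  bounded length outside \<open>C\<close>: either directly, or through the side from \<open>x\<close> to \<open>x'\<close>,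
  where the distance that has to be covered is bounded by the triangle inequality. Then
  \<open>detour_bound\<close> applies.\<close>

lemma projection_constant_exists: "\<exists>\<kappa>. projection_constant \<kappa>"
proof -
  obtain \<delta> where slim: "slim_constant \<delta>" using slim_constant_exists ..
  obtain \<epsilon> :: nat where \<epsilon>: "\<And>i C y y' n. left_coset i C \<Longrightarrow> y \<in> C \<Longrightarrow> y' \<in> C \<Longrightarrow> n \<le> 16 * \<delta> + 20 \<Longrightarrow>
    (y, y') \<in> detour C y y' ^^ n \<Longrightarrow> dist y y' \<le> \<epsilon>"
    using detour_bound[of "16 * \<delta> + 20"] by blast
  have "dist y y' \<le> \<epsilon>" if C: "left_coset i C" and en: "entry C x y" "entry C x' y'" and
    s: "rel.geodesic s n x x'" "\<And>j. j \<le> n \<Longrightarrow> s j \<notin> C" for i C x x' y y' s n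
  proof -
    note sc = rel.geodesicD(3)[OF s(1)]
    have suc: "\<exists>f a. rel.geodesic f (Suc a) x y \<and> (\<forall>j\<le>a. f j \<notin> C)" if xy: "entry C x y" "x \<notin> C" for x y
    proof -
      obtain f a where f: "rel.geodesic f a x y" "\<forall>j<a. f j \<notin> C" "y \<in> C"
        using xy unfolding entry_def by blast
      have "a \<noteq> 0"
      proof
        assume "a = 0"
        then show False using rel.geodesicD(1,2)[OF f(1)] f(3) xy(2) by simp
      qed
      then obtain b where "a = Suc b" using not0_implies_Suc by blast
      then show ?thesis using f less_Suc_eq_le by blast
    qed
    have yC: "y \<in> C" "y' \<in> C" using en by (auto simp: entry_def)
    have "x \<notin> C" "x' \<notin> C" using s(2)[of 0] s(2)[of n] rel.geodesicD(1,2)[OF s(1)] by auto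
    obtain f a where f: "rel.geodesic f (Suc a) x y" "\<And>j. j \<le> a \<Longrightarrow> f j \<notin> C"
      using suc[OF en(1) \<open>x \<notin> C\<close>] by blast
    obtain g b where g: "rel.geodesic g (Suc b) x' y'" "\<And>j. j \<le> b \<Longrightarrow> g j \<notin> C"
      using suc[OF en(2) \<open>x' \<notin> C\<close>] by blast
    have fc: "f a \<in> carrier G" "g b \<in> carrier G" using rel.geodesicD(3)[OF f(1)] rel.geodesicD(3)[OF g(1)] by auto
    have yc: "y \<in> carrier G" "y' \<in> carrier G" using rel.geodesicD(5)[OF f(1)] rel.geodesicD(5)[OF g(1)] by auto
    have fy: "d (f a) y = 1" using rel.geodesicD(7)[OF f(1), of a "Suc a"] rel.geodesicD(2)[OF f(1)] by simp
    have gy: "d (g b) y' = 1" using rel.geodesicD(7)[OF g(1), of b "Suc b"] rel.geodesicD(2)[OF g(1)] by simp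
    have c1: "reach C (8 * \<delta> + 6) (f a) (g b) \<or> (\<exists>j\<le>n. reach C (4 * \<delta> + 2) (f a) (s j))"
      by (rule corner[OF slim C s f(1) yC(1) f(2) g(1) yC(2) g(2)])
    have c2: "reach C (8 * \<delta> + 6) (g b) (f a) \<or> (\<exists>j\<le>n. reach C (4 * \<delta> + 2) (g b) (s (n - j)))"
      by (rule corner[OF slim C rel.geodesic_rev[OF s(1)] _ g(1) yC(2) g(2) f(1) yC(1) f(2)])
        (use s(2) in simp)
    have "reach C (16 * \<delta> + 18) (f a) (g b)"
    proof -
      from c1 show ?thesis
      proof (elim disjE)
        assume "reach C (8 * \<delta> + 6) (f a) (g b)"
        then show ?thesis by (elim reach_mono) simp
      next
        assume "\<exists>j\<le>n. reach C (4 * \<delta> + 2) (f a) (s j)"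
        then obtain j where j: "j \<le> n" "reach C (4 * \<delta> + 2) (f a) (s j)" by blast
        from c2 show ?thesis
        proof (elim disjE)
          assume "reach C (8 * \<delta> + 6) (g b) (f a)"
          from reach_sym[OF this] show ?thesis by (elim reach_mono) simp
        next
          assume "\<exists>j\<le>n. reach C (4 * \<delta> + 2) (g b) (s (n - j))"
          then obtain l where l: "l \<le> n" "reach C (4 * \<delta> + 2) (g b) (s l)"
            using diff_le_self by blast
          have jl: "s j \<in> carrier G" "s l \<in> carrier G" using sc j l by auto
          have "d (s j) (s l) \<le> d (s j) (f a) + d (f a) y + d y y' + d y' (g b) + d (g b) (s l)"
            using rel.dist_triangle[of "s j" "f a" "s l"] rel.dist_triangle[of "f a" y "s l"]
              rel.dist_triangle[of y y' "s l"] rel.dist_triangle[of y' "g b" "s l"] jl fc yc by linarith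
          moreover have "d (s j) (f a) \<le> 4 * \<delta> + 2" "d (g b) (s l) \<le> 4 * \<delta> + 2"
            using reach_dist[OF reach_sym[OF j(2)]] reach_dist[OF l(2)] by auto
          moreover have "d y' (g b) = 1" using rel.dist_sym gy yc fc by simp
          ultimately have dl: "d (s j) (s l) \<le> 8 * \<delta> + 7"
            using fy left_cosetD(6)[OF C yC] by linarith
          have "reach C (4 * \<delta> + 2 + d (s j) (s l) + (4 * \<delta> + 2)) (f a) (g b)"
            using reach_trans[OF reach_trans[OF j(2) reach_geodesic'[OF s(1) j(1) l(1) s(2)]] reach_sym[OF l(2)]] .
          then show ?thesis using dl by (elim reach_mono) simp
        qed
      qed
    qed
    then obtain k where k: "k \<le> 16 * \<delta> + 18" "(f a, g b) \<in> avoiding C ^^ k" unfolding reach_def by blast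
    let ?E = "detour C y y'"
    have "avoiding C \<subseteq> ?E" by (auto simp: avoiding_def detour_def)
    then have k': "(f a, g b) \<in> ?E ^^ k"
      using k(2) unfolding relpow_fun_conv by blast
    have "(y, f a) \<in> ?E" "(g b, y') \<in> ?E"
      using fy gy fc yc f(2)[of a] g(2)[of b] rel.dist_sym by (auto simp: detour_def)
    then have "(y, y') \<in> ?E ^^ Suc (Suc k)"
      using relpow_Suc_I[OF relpow_Suc_I2[OF _ k']] by blast
    then show ?thesis using \<epsilon>[OF C yC, of "Suc (Suc k)"] k(1) by simp
  qed
  then show ?thesis unfolding projection_constant_def by blast
qed

lemma projection_constantD:
  assumes "projection_constant \<kappa>" "left_coset i C" "entry C x y" "entry C x' y'" "rel.geodesic s n x x'"
    "\<kappa> < dist y y'"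
  obtains j where "j \<le> n" "s j \<in> C"
  using assms unfolding projection_constant_def by (meson not_le)

text \<open>The instances of the contraction property in which the geodesic is trivial or a single edge. They
  say that a point, or a disjoint coset of the same subgroup, has a bounded projection.\<close>

lemma entries_adjacent:
  assumes \<kappa>: "projection_constant \<kappa>" and C: "left_coset i C" and en: "entry C x y" "entry C x' y'"
    and "x = x' \<or> x \<notin> C \<and> x' \<notin> C \<and> d x x' \<le> 1"
  shows "dist y y' \<le> \<kappa>"
proof (cases "x \<in> C")
  case True
  then have "y = x" "y' = x" using assms entry_inside by blast+
  then show ?thesis using entry_carrier[OF en(1)] by simp
next
  case False
  have x: "x \<in> carrier G" "x' \<in> carrier G" using entry_carrier en by auto
  obtain s where s: "rel.geodesic s (d x x') x x'" using rel.geodesic_exists x .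
  have "d x x' \<le> 1" using assms(5) x by auto
  then have "s j \<in> {x, x'}" if that: "j \<le> d x x'" for j
  proof (cases "j = 0")
    case False
    then have "j = d x x'" using \<open>d x x' \<le> 1\<close> that by linarith
    then show ?thesis using rel.geodesicD(2)[OF s] by simp
  qed (use rel.geodesicD(1)[OF s] in simp)
  then have "s j \<notin> C" if "j \<le> d x x'" for j using that False assms(5) by blast
  then show ?thesis using \<kappa> C en s unfolding projection_constant_def by blast
qed

end

section \<open>Chains of cosets\<close>

context relatively_hyperbolic_group begin

text \<open>A broken line through the cosets \<open>S 1, \<dots>, S n\<close> enters \<open>S k\<close> at \<open>p k\<close> and leaves it at \<open>q k\<close>. Taking the
  two ends as the singletons \<open>S 0\<close> and \<open>S (n + 1)\<close> lets them be treated like the neighbouring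
  cosets.\<close>

definition chain :: "nat \<Rightarrow> nat \<Rightarrow> (nat \<Rightarrow> 'a set) \<Rightarrow> nat \<Rightarrow> (nat \<Rightarrow> 'a) \<Rightarrow> (nat \<Rightarrow> 'a) \<Rightarrow> bool" where
  "chain \<kappa> i S n p q \<longleftrightarrow> is_singleton (S 0) \<and> is_singleton (S (Suc n)) \<and>
     (\<forall>k\<in>{1..n}. left_coset i (S k)) \<and> (\<forall>k\<in>{1..<n}. S k \<inter> S (Suc k) = {}) \<and>
     (\<forall>k\<in>{1..n}. (\<exists>u\<in>S (k - 1). entry (S k) u (p k)) \<and> (\<exists>u\<in>S (Suc k). entry (S k) u (q k)) \<and>
        3 * \<kappa> < dist (p k) (q k))"

lemma chain_rev:
  assumes "chain \<kappa> i S n p q"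
  shows "chain \<kappa> i (\<lambda>k. S (Suc n - k)) n (\<lambda>k. q (Suc n - k)) (\<lambda>k. p (Suc n - k))"
proof -
  have dis: "S (Suc n - k) \<inter> S (Suc n - Suc k) = {}" if "k \<in> {1..<n}" for k
  proof -
    have "n - k \<in> {1..<n}" "Suc (n - k) = Suc n - k" using that by auto
    then show ?thesis using assms unfolding chain_def by (metis Int_commute diff_Suc_Suc)
  qed
  have pq: "(\<exists>u\<in>S (Suc n - (k - 1)). entry (S (Suc n - k)) u (q (Suc n - k))) \<and>
      (\<exists>u\<in>S (Suc n - Suc k). entry (S (Suc n - k)) u (p (Suc n - k))) \<and>
      3 * \<kappa> < dist (q (Suc n - k)) (p (Suc n - k))" if "k \<in> {1..n}" for k
  proof -
    have k: "Suc n - k \<in> {1..n}" "Suc n - (k - 1) = Suc (Suc n - k)" "Suc n - Suc k = Suc n - k - 1"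
      using that by auto
    then have e: "(\<exists>u\<in>S (Suc n - k - 1). entry (S (Suc n - k)) u (p (Suc n - k)))"
      "(\<exists>u\<in>S (Suc (Suc n - k)). entry (S (Suc n - k)) u (q (Suc n - k)))"
      "3 * \<kappa> < dist (p (Suc n - k)) (q (Suc n - k))"
      using assms unfolding chain_def by blast+
    then have "p (Suc n - k) \<in> carrier G" "q (Suc n - k) \<in> carrier G" using entry_carrier by blast+
    then show ?thesis unfolding k(2,3) using e dist_sym by simp
  qed
  have "left_coset i (S (Suc n - k))" if "k \<in> {1..n}" for k
  proof -
    have "Suc n - k \<in> {1..n}" using that by auto
    then show ?thesis using assms unfolding chain_def by blast
  qed
  then show ?thesis using assms dis pq unfolding chain_def by simp
qed

context
  fixes \<kappa> i S n p q
  assumes ch: "chain \<kappa> i S n p q"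
begin

lemma chain_coset: "k \<in> {1..n} \<Longrightarrow> left_coset i (S k)"
  using ch unfolding chain_def by blast

lemma chain_long: "k \<in> {1..n} \<Longrightarrow> 3 * \<kappa> < dist (p k) (q k)"
  using ch unfolding chain_def by blast

lemma chain_carrier:
  assumes "k \<in> {1..n}"
  shows "p k \<in> carrier G" "q k \<in> carrier G"
  using ch assms entry_carrier unfolding chain_def by blast+

lemma chain_neighbours:
  assumes "k \<le> n" "u \<in> S k" "u' \<in> S k" "k \<noteq> 0 \<Longrightarrow> D \<inter> S k = {}"
  shows "u = u' \<or> u \<notin> D \<and> u' \<notin> D \<and> d u u' \<le> 1"
proof (cases "k = 0")
  case True
  then show ?thesis using ch assms(2,3) unfolding chain_def is_singleton_def by auto
next
  case False
  then have "left_coset i (S k)" using assms(1) chain_coset by simp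
  then show ?thesis using assms left_cosetD(6) False by blast
qed

end

lemma entry_from_previous:
  assumes \<kappa>: "projection_constant \<kappa>" and ch: "chain \<kappa> i S n p q"
    and k: "k \<in> {1..n}" and u: "u \<in> S (k - 1)" "entry (S k) u c"
  shows "dist c (p k) \<le> \<kappa>"
proof -
  obtain u' where u': "u' \<in> S (k - 1)" "entry (S k) u' (p k)" using ch k unfolding chain_def by blast
  have "S k \<inter> S (k - 1) = {}" if "k - 1 \<noteq> 0"
  proof -
    have "k - 1 \<in> {1..<n}" "Suc (k - 1) = k" using that k by auto
    then show ?thesis using ch unfolding chain_def by (metis Int_commute)
  qed
  then have "u = u' \<or> u \<notin> S k \<and> u' \<notin> S k \<and> d u u' \<le> 1"
    by (intro chain_neighbours[OF ch _ u(1) u'(1)]) (use k in auto)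
  then show ?thesis using entries_adjacent[OF \<kappa> chain_coset[OF ch k] u(2) u'(2)] by blast
qed

lemma entry_from_next:
  assumes \<kappa>: "projection_constant \<kappa>" and ch: "chain \<kappa> i S n p q"
    and k: "k \<in> {1..n}" and u: "u \<in> S (Suc k)" "entry (S k) u c"
  shows "dist c (q k) \<le> \<kappa>"
proof -
  have "Suc n - k \<in> {1..n}" "Suc n - (Suc n - k - 1) = Suc k" "Suc n - (Suc n - k) = k"
    using k by auto
  then show ?thesis
    using entry_from_previous[OF \<kappa> chain_rev[OF ch], of "Suc n - k" u c] u by simp
qed

text \<open>The entries of \<open>x\<close> and \<open>c\<close> are near \<open>p k\<close> and \<open>q k\<close>, hence farther apart than \<open>\<kappa>\<close>, so the geodesic has to
  meet \<open>S k\<close>. Its first and last points in \<open>S k\<close> are themselves entries of \<open>x\<close> and \<open>c\<close>; so they are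
  different, and adjacent as they belong to one coset.\<close>

lemma chain_crossing:
  assumes \<kappa>: "projection_constant \<kappa>" and ch: "chain \<kappa> i S n p q" and k: "k \<in> {1..n}"
    and f: "rel.geodesic f l x c"
    and x: "\<And>y. entry (S k) x y \<Longrightarrow> dist y (p k) \<le> \<kappa>"
    and c: "\<And>y. entry (S k) c y \<Longrightarrow> dist y (q k) \<le> \<kappa>"
  obtains t where "Suc t \<le> l" "dist (f t) (p k) \<le> \<kappa>" "dist (f (Suc t)) (q k) \<le> \<kappa>"
    "\<And>j. j \<le> l \<Longrightarrow> f j \<in> S k \<longleftrightarrow> j = t \<or> j = Suc t"
proof -
  note C = chain_coset[OF ch k]
  note long = chain_long[OF ch k] and pq = chain_carrier[OF ch k]
  have far: "\<kappa> < dist y y'" if "entry (S k) x y" "entry (S k) c y'" for y y'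
  proof -
    have "y \<in> carrier G" "y' \<in> carrier G" using that entry_carrier by blast+
    then show ?thesis
      using long x[OF that(1)] c[OF that(2)] dist_triangle[of "p k" y "q k"] dist_triangle[of y y' "q k"]
        dist_sym[of y "p k"] pq by linarith
  qed
  obtain y where y: "entry (S k) x y"
    using entry_exists[OF rel.geodesicD(4)[OF f] left_cosetD(2,3)[OF C]] .
  obtain y' where y': "entry (S k) c y'"
    using entry_exists[OF rel.geodesicD(5)[OF f] left_cosetD(2,3)[OF C]] .
  obtain j where j: "j \<le> l" "f j \<in> S k"
    using projection_constantD[OF \<kappa> C y y' f far[OF y y']] .
  obtain a where a: "a \<le> j" "entry (S k) x (f a)" "\<And>i. i < a \<Longrightarrow> f i \<notin> S k"
    using first_entry[OF f j] by blast
  obtain b where b: "j \<le> b" "b \<le> l" "entry (S k) c (f b)" "\<And>i. b < i \<Longrightarrow> i \<le> l \<Longrightarrow> f i \<notin> S k"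
    using last_entry[OF f j] by blast
  have "a \<noteq> b" using far[OF a(2) b(3)] entry_carrier[OF a(2)] by auto
  moreover have "b - a \<le> 1"
    using rel.geodesicD(7)[OF f, of a b] a(1) b(1,2) left_cosetD(6)[OF C, of "f a" "f b"]
      entry_carrier[OF a(2)] entry_carrier[OF b(3)] by simp
  ultimately have ab: "b = Suc a" using a(1) b(1) by linarith
  show ?thesis
  proof (rule that[of a])
    show "Suc a \<le> l" using ab b(2) by simp
    show "dist (f a) (p k) \<le> \<kappa>" using x[OF a(2)] .
    show "dist (f (Suc a)) (q k) \<le> \<kappa>" using c[OF b(3)] ab by simp
    show "f j \<in> S k \<longleftrightarrow> j = a \<or> j = Suc a" if "j \<le> l" for j
      using a(3)[of j] b(4)[of j] that ab entry_carrier[OF a(2)] entry_carrier[OF b(3)]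
      by (metis not_less_eq nat_neq_iff)
  qed
qed

text \<open>Induction along the chain with a constant that does not grow: the geodesic from \<open>x\<close> to its entry \<open>c\<close> into
  \<open>S (k + 1)\<close> crosses \<open>S k\<close>, so \<open>c\<close> is also an entry of a point of \<open>S k\<close>, and as such it is near
  \<open>p (k + 1)\<close>.\<close>

lemma entry_from_start:
  assumes \<kappa>: "projection_constant \<kappa>" and ch: "chain \<kappa> i S n p q" and x: "x \<in> S 0"
    and k: "1 \<le> k" "k \<le> n" and c: "entry (S k) x c"
  shows "dist c (p k) \<le> \<kappa>"
  using k c
proof (induction k arbitrary: c rule: dec_induct)
  case base
  then show ?case using entry_from_previous[OF \<kappa> ch, of 1 x c] x by simp
next
  case (step k)
  have k: "k \<in> {1..n}" "Suc k \<in> {1..n}" using step by auto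
  obtain f l where f: "rel.geodesic f l x c" "\<forall>i<l. f i \<notin> S (Suc k)" "c \<in> S (Suc k)"
    using step.prems(2) unfolding entry_def by blast
  obtain t where t: "Suc t \<le> l" "\<And>j. j \<le> l \<Longrightarrow> f j \<in> S k \<longleftrightarrow> j = t \<or> j = Suc t"
    by (rule chain_crossing[OF \<kappa> ch k(1) f(1)])
      (use step.IH step.prems entry_from_next[OF \<kappa> ch k(1) f(3)] in auto)
  have "rel.geodesic (\<lambda>j. f (t + j)) (l - t) (f t) c"
    using rel.geodesic_sub[OF f(1), of t l] t(1) rel.geodesicD(2)[OF f(1)] by simp
  then have "entry (S (Suc k)) (f t) c" using f(2,3) unfolding entry_def by fastforce
  moreover have "f t \<in> S k" using t by auto
  ultimately show ?case using entry_from_previous[OF \<kappa> ch k(2), of "f t" c] by simp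
qed

lemma entry_from_end:
  assumes \<kappa>: "projection_constant \<kappa>" and ch: "chain \<kappa> i S n p q" and z: "z \<in> S (Suc n)"
    and k: "k \<in> {1..n}" and c: "entry (S k) z c"
  shows "dist c (q k) \<le> \<kappa>"
  using entry_from_start[OF \<kappa> chain_rev[OF ch], of z "Suc n - k" c] z k c
  by (auto simp: Suc_diff_Suc Suc_diff_le)

text \<open>The crossings occur in the right order because already the initial part of the geodesic that ends at its first
  point of \<open>S (k + 1)\<close> has to cross \<open>S k\<close>.\<close>

lemma chain_geodesic:
  assumes \<kappa>: "projection_constant \<kappa>" and ch: "chain \<kappa> i S n p q"
    and x: "x \<in> S 0" and z: "z \<in> S (Suc n)" and f: "rel.geodesic f l x z"
  obtains t where
    "\<And>k. k \<in> {1..n} \<Longrightarrow> Suc (t k) \<le> l \<and> dist (f (t k)) (p k) \<le> \<kappa> \<and> dist (f (Suc (t k))) (q k) \<le> \<kappa>"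
    "\<And>k. k \<in> {1..<n} \<Longrightarrow> Suc (t k) \<le> t (Suc k)"
proof -
  have "\<exists>t. Suc t \<le> l \<and> dist (f t) (p k) \<le> \<kappa> \<and> dist (f (Suc t)) (q k) \<le> \<kappa> \<and>
      (\<forall>j\<le>l. f j \<in> S k \<longleftrightarrow> j = t \<or> j = Suc t)" if k: "k \<in> {1..n}" for k
  proof -
    have "1 \<le> k" "k \<le> n" using k by auto
    note s = entry_from_start[OF \<kappa> ch x this] and e = entry_from_end[OF \<kappa> ch z k]
    show ?thesis using chain_crossing[OF \<kappa> ch k f s e] by metis
  qed
  then obtain t where t: "\<And>k. k \<in> {1..n} \<Longrightarrow> Suc (t k) \<le> l \<and> dist (f (t k)) (p k) \<le> \<kappa> \<and>
    dist (f (Suc (t k))) (q k) \<le> \<kappa> \<and> (\<forall>j\<le>l. f j \<in> S k \<longleftrightarrow> j = t k \<or> j = Suc (t k))"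
    by metis
  have "Suc (t k) \<le> t (Suc k)" if k: "k \<in> {1..<n}" for k
  proof -
    have k1: "k \<in> {1..n}" "Suc k \<in> {1..n}" "1 \<le> k" "k \<le> n" using k by auto
    have tl: "t (Suc k) \<le> l" "f (t (Suc k)) \<in> S (Suc k)" using t[OF k1(2)] by auto
    then have f': "rel.geodesic f (t (Suc k)) x (f (t (Suc k)))"
      using rel.geodesic_sub[OF f, of 0 "t (Suc k)"] rel.geodesicD(1)[OF f] by simp
    obtain s where s: "Suc s \<le> t (Suc k)"
      "\<And>j. j \<le> t (Suc k) \<Longrightarrow> f j \<in> S k \<longleftrightarrow> j = s \<or> j = Suc s"
      by (rule chain_crossing[OF \<kappa> ch k1(1) f' entry_from_start[OF \<kappa> ch x k1(3,4)]
        entry_from_next[OF \<kappa> ch k1(1) tl(2)]]) blast+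
    have "f s \<in> S k" "f (Suc s) \<in> S k" using s by auto
    moreover have "\<And>j. j \<le> l \<Longrightarrow> f j \<in> S k \<longleftrightarrow> j = t k \<or> j = Suc (t k)" using t[OF k1(1)] by blast
    moreover have "s \<le> l" "Suc s \<le> l" using s(1) tl(1) by auto
    ultimately have "s = t k \<or> s = Suc (t k)" "Suc s = t k \<or> Suc s = Suc (t k)" by blast+
    then show ?thesis using s(1) by linarith
  qed
  then show ?thesis using that[of t] t by blast
qed

lemma chain_length:
  assumes \<kappa>: "projection_constant \<kappa>" and ch: "chain \<kappa> i S n p q"
    and x: "x \<in> S 0" and z: "z \<in> S (Suc n)" and xz: "x \<in> carrier G" "z \<in> carrier G"
  shows "n \<le> d x z"
proof -
  obtain f where f: "rel.geodesic f (d x z) x z" using rel.geodesic_exists[OF xz] .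
  obtain t where t: "\<And>k. k \<in> {1..n} \<Longrightarrow> Suc (t k) \<le> d x z" "\<And>k. k \<in> {1..<n} \<Longrightarrow> Suc (t k) \<le> t (Suc k)"
    using chain_geodesic[OF \<kappa> ch x z f] by metis
  have le: "k \<le> Suc (t k)" if "1 \<le> k" "k \<le> n" for k
    using that
  proof (induction k rule: dec_induct)
    case (step k)
    then show ?case using t(2)[of k] by simp
  qed simp
  show ?thesis
  proof (cases "n = 0")
    case False
    then show ?thesis using le[of n] t(1)[of n] by simp
  qed simp
qed

text \<open>The crossings are single edges, so that every vertex lies in a piece of the geodesic that starts near
  an exit \<open>q k\<close> and ends near the next entrance \<open>p (k + 1)\<close>.\<close>

lemma chain_covering:
  assumes \<kappa>: "projection_constant \<kappa>" and ch: "chain \<kappa> i S n p q"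
    and x: "x \<in> S 0" and z: "z \<in> S (Suc n)" and f: "rel.geodesic f l x z" and j: "j \<le> l"
  obtains k a b where "k \<le> n" "a \<le> j" "j \<le> b" "b \<le> l"
    "k = 0 \<and> a = 0 \<or> 1 \<le> k \<and> dist (f a) (q k) \<le> \<kappa>"
    "k = n \<and> b = l \<or> k < n \<and> dist (f b) (p (Suc k)) \<le> \<kappa>"
proof -
  obtain t where t: "\<And>k. k \<in> {1..n} \<Longrightarrow> Suc (t k) \<le> l \<and> dist (f (t k)) (p k) \<le> \<kappa> \<and> dist (f (Suc (t k))) (q k) \<le> \<kappa>"
    "\<And>k. k \<in> {1..<n} \<Longrightarrow> Suc (t k) \<le> t (Suc k)"
    using chain_geodesic[OF \<kappa> ch x z f] by metis
  define k where "k = Max {k. k \<le> n \<and> (k = 0 \<or> Suc (t k) \<le> j)}"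
  have fin: "finite {k. k \<le> n \<and> (k = 0 \<or> Suc (t k) \<le> j)}" by simp
  have kin: "k \<le> n" "k = 0 \<or> Suc (t k) \<le> j"
  proof -
    have "0 \<in> {k. k \<le> n \<and> (k = 0 \<or> Suc (t k) \<le> j)}" by simp
    then have "k \<in> {k. k \<le> n \<and> (k = 0 \<or> Suc (t k) \<le> j)}"
      using Max_in[OF fin] unfolding k_def by blast
    then show "k \<le> n" "k = 0 \<or> Suc (t k) \<le> j" by auto
  qed
  have kmax: "\<not> Suc (t (Suc k)) \<le> j" if "k < n"
  proof
    assume "Suc (t (Suc k)) \<le> j"
    then have "Suc k \<le> k" using Max_ge[OF fin, of "Suc k"] that unfolding k_def by simp
    then show False by simp
  qed
  show ?thesis
  proof (rule that[of k "if k = 0 then 0 else Suc (t k)" "if k = n then l else t (Suc k)"])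
    show "(if k = n then l else t (Suc k)) \<le> l" using t(1)[of "Suc k"] kin by auto
    show "j \<le> (if k = n then l else t (Suc k))" using kmax j kin by auto
    show "k = n \<and> (if k = n then l else t (Suc k)) = l \<or> k < n \<and> dist (f (if k = n then l else t (Suc k))) (p (Suc k)) \<le> \<kappa>"
      using t(1)[of "Suc k"] kin by auto
    show "k = 0 \<and> (if k = 0 then 0 else Suc (t k)) = 0 \<or> 1 \<le> k \<and> dist (f (if k = 0 then 0 else Suc (t k))) (q k) \<le> \<kappa>"
      using t(1)[of k] kin by auto
  qed (use kin in auto)
qed

end

section \<open>Normal forms in amalgamated products\<close>

context group begin

lemma conj_set_eq: "conj_set G u K = (\<lambda>g. u \<otimes> g \<otimes> inv u) ` K"
  unfolding conj_set_def by (auto simp: l_coset_def r_coset_def)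

lemma conj_set_subgroup:
  assumes K: "subgroup K G" and u: "u \<in> carrier G"
  shows "subgroup (conj_set G u K) G"
proof (rule subgroupI)
  note Kc = subgroup.subset[OF K]
  show "conj_set G u K \<subseteq> carrier G" unfolding conj_set_eq using Kc u by auto
  show "conj_set G u K \<noteq> {}" unfolding conj_set_eq using subgroup.one_closed[OF K] by auto
  show "inv a \<in> conj_set G u K" if a: "a \<in> conj_set G u K" for a
  proof -
    obtain g where g: "g \<in> K" "a = u \<otimes> g \<otimes> inv u" using a unfolding conj_set_eq by blast
    have "g \<in> carrier G" using Kc g(1) by blast
    then have "inv a = u \<otimes> inv g \<otimes> inv u" using u g(2) by (simp add: inv_mult_group m_assoc)
    then show ?thesis unfolding conj_set_eq using subgroup.m_inv_closed[OF K g(1)] by blast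
  qed
  show "a \<otimes> a' \<in> conj_set G u K" if aa: "a \<in> conj_set G u K" "a' \<in> conj_set G u K" for a a'
  proof -
    obtain g where g: "g \<in> K" "a = u \<otimes> g \<otimes> inv u" using aa(1) unfolding conj_set_eq by blast
    obtain h where h: "h \<in> K" "a' = u \<otimes> h \<otimes> inv u" using aa(2) unfolding conj_set_eq by blast
    have "g \<in> carrier G" "h \<in> carrier G" using g h Kc by auto
    then have "a \<otimes> a' = u \<otimes> (g \<otimes> h) \<otimes> inv u"
      using u g(2) h(2) by (simp add: m_assoc inv_mult_cancel)
    then show ?thesis unfolding conj_set_eq using subgroup.m_closed[OF K g(1) h(1)] by blast
  qed
qed

end

locale amalgamated_pair = group G for G (structure) +
  fixes A B R :: "'a set"
  assumes A_subgroup: "subgroup A G" and B_subgroup: "subgroup B G" and R_subgroup: "subgroup R G"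
    and R_A: "R \<subseteq> A" and R_B: "R \<subseteq> B"
begin

abbreviation word_eq :: "('a + 'a) list \<Rightarrow> ('a + 'a) list \<Rightarrow> bool" (infix "\<sim>" 50) where
  "v \<sim> w \<equiv> (v, w) \<in> amalgam_rel (G\<lparr>carrier := A\<rparr>) (G\<lparr>carrier := B\<rparr>) R"

abbreviation eval_word :: "('a + 'a) list \<Rightarrow> 'a" where
  "eval_word \<equiv> amalgam_eval G (\<lambda>x. x) (\<lambda>x. x)"

text \<open>The two factors are indexed by \<open>bool\<close>, so that negation passes to the other factor and the two halves of
  each argument become one.\<close>

definition factor :: "bool \<Rightarrow> 'a set" where "factor b = (if b then B else A)"
definition tag :: "bool \<Rightarrow> 'a \<Rightarrow> 'a + 'a" where "tag b x = (if b then Inr x else Inl x)"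

definition syllable_words :: "('a + 'a) list set" where
  "syllable_words = amalgam_words (G\<lparr>carrier := A\<rparr>) (G\<lparr>carrier := B\<rparr>)"

lemma factor_subgroup: "subgroup (factor b) G"
  using A_subgroup B_subgroup by (simp add: factor_def)

lemma R_factor: "r \<in> R \<Longrightarrow> r \<in> factor b"
  using R_A R_B by (auto simp: factor_def)

lemma factor_carrier: "x \<in> factor b \<Longrightarrow> x \<in> carrier G"
  using subgroup.subset[OF factor_subgroup] by blast

lemma R_carrier: "r \<in> R \<Longrightarrow> r \<in> carrier G"
  using subgroup.subset[OF R_subgroup] by blast

lemmas factor_closed = subgroup.m_closed[OF factor_subgroup] subgroup.m_inv_closed[OF factor_subgroup]
  subgroup.one_closed[OF factor_subgroup]
lemmas R_closed = subgroup.m_closed[OF R_subgroup] subgroup.m_inv_closed[OF R_subgroup]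
  subgroup.one_closed[OF R_subgroup]

lemma R_mult_iff:
  assumes "r \<in> R" "x \<in> carrier G"
  shows "r \<otimes> x \<in> R \<longleftrightarrow> x \<in> R" "x \<otimes> r \<in> R \<longleftrightarrow> x \<in> R"
proof -
  have "x = inv r \<otimes> (r \<otimes> x)" "x = (x \<otimes> r) \<otimes> inv r"
    using assms R_carrier by (simp_all add: inv_mult_cancel m_assoc)
  then show "r \<otimes> x \<in> R \<longleftrightarrow> x \<in> R" "x \<otimes> r \<in> R \<longleftrightarrow> x \<in> R"
    using assms(1) R_closed by metis+
qed

lemma syllable_words_iff: "w \<in> syllable_words \<longleftrightarrow> (\<forall>s\<in>set w. \<exists>b x. s = tag b x \<and> x \<in> factor b)"
proof -
  have "s \<in> A <+> B \<longleftrightarrow> (\<exists>b x. s = tag b x \<and> x \<in> factor b)" for s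
    by (cases s) (auto simp: tag_def factor_def split: if_splits)
  then show ?thesis unfolding syllable_words_def amalgam_words_def in_lists_conv_set by simp
qed

lemma words_simps [simp]:
  "[] \<in> syllable_words" "tag b x # w \<in> syllable_words \<longleftrightarrow> x \<in> factor b \<and> w \<in> syllable_words"
  "v @ w \<in> syllable_words \<longleftrightarrow> v \<in> syllable_words \<and> w \<in> syllable_words"
  by (auto simp: syllable_words_iff) (auto simp: tag_def split: if_splits)

lemma word_induct [consumes 1, case_names Nil Cons]:
  assumes "w \<in> syllable_words" "P []"
    "\<And>b x w. x \<in> factor b \<Longrightarrow> w \<in> syllable_words \<Longrightarrow> P w \<Longrightarrow> P (tag b x # w)"
  shows "P w"
  using assms(1)
proof (induction w)
  case (Cons s w)
  then obtain b x where "s = tag b x" "x \<in> factor b" by (auto simp: syllable_words_iff)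
  then show ?case using Cons assms(3) by auto
qed (rule assms(2))

lemma word_eq_refl: "w \<in> syllable_words \<Longrightarrow> w \<sim> w"
  unfolding syllable_words_def by (rule amalgam_rel.refl)

lemma word_eq_mult: "x \<in> factor b \<Longrightarrow> y \<in> factor b \<Longrightarrow> [tag b x, tag b y] \<sim> [tag b (x \<otimes> y)]"
  using amalgam_rel.mult_left[of x "G\<lparr>carrier := A\<rparr>" y "G\<lparr>carrier := B\<rparr>" R]
    amalgam_rel.mult_right[of x "G\<lparr>carrier := B\<rparr>" y "G\<lparr>carrier := A\<rparr>" R]
  by (cases b) (auto simp: tag_def factor_def)

lemma word_eq_one: "[tag b \<one>] \<sim> []"
  using amalgam_rel.one_left[of "G\<lparr>carrier := A\<rparr>" "G\<lparr>carrier := B\<rparr>" R]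
    amalgam_rel.one_right[of "G\<lparr>carrier := B\<rparr>" "G\<lparr>carrier := A\<rparr>" R]
  by (cases b) (auto simp: tag_def)

lemma word_eq_glue: "r \<in> R \<Longrightarrow> [tag b r] \<sim> [tag b' r]"
proof (cases "b = b'")
  case True
  then show ?thesis if "r \<in> R" using word_eq_refl R_factor that by simp
next
  case False
  moreover have "[Inl r] \<sim> [Inr r]" "[Inr r] \<sim> [Inl r]" if "r \<in> R"
    using amalgam_rel.glue[OF that] amalgam_rel.sym by blast+
  ultimately show ?thesis if "r \<in> R" using that by (cases b) (auto simp: tag_def)
qed

lemma word_eq_cong: "v \<sim> v' \<Longrightarrow> u \<in> syllable_words \<Longrightarrow> w \<in> syllable_words \<Longrightarrow> u @ v @ w \<sim> u @ v' @ w"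
  using amalgam_rel.append word_eq_refl by metis

lemma eval_word_closed: "w \<in> syllable_words \<Longrightarrow> eval_word w \<in> carrier G"
  by (induction w rule: word_induct) (auto simp: tag_def dest: factor_carrier)

lemma case_sum_tag [simp]: "case_sum (\<lambda>x. x) (\<lambda>x. x) (tag b x) = x"
  by (simp add: tag_def)

lemma eval_word_append:
  "v \<in> syllable_words \<Longrightarrow> w \<in> syllable_words \<Longrightarrow> eval_word (v @ w) = eval_word v \<otimes> eval_word w"
  by (induction v rule: word_induct) (auto simp: eval_word_closed m_assoc factor_carrier)

lemma word_eq_sound: "v \<sim> w \<Longrightarrow> v \<in> syllable_words \<and> w \<in> syllable_words \<and> eval_word v = eval_word w"
proof (induction rule: amalgam_rel.induct)
  case (mult_left x y)
  then have "x \<in> factor False" "y \<in> factor False" by (auto simp: factor_def)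
  then show ?case
    using words_simps(2)[of False] factor_closed(1)[of x False y] factor_carrier[of x False] factor_carrier[of y False]
    by (simp add: tag_def)
next
  case (mult_right x y)
  then have "x \<in> factor True" "y \<in> factor True" by (auto simp: factor_def)
  then show ?case
    using words_simps(2)[of True] factor_closed(1)[of x True y] factor_carrier[of x True] factor_carrier[of y True]
    by (simp add: tag_def)
next
  case (glue r)
  then show ?case
    using words_simps(2)[of True r "[]"] words_simps(2)[of False r "[]"] R_factor by (simp add: tag_def)
next
  case one_left
  then show ?case using words_simps(2)[of False \<one> "[]"] factor_closed(3)[of False] by (simp add: tag_def)
next
  case one_right
  then show ?case using words_simps(2)[of True \<one> "[]"] factor_closed(3)[of True] by (simp add: tag_def)
qed (auto simp: syllable_words_def[symmetric] eval_word_append)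

text \<open>The indices are the length of the word and the factors of its first and last syllables.\<close>

inductive reduced_word :: "nat \<Rightarrow> bool \<Rightarrow> bool \<Rightarrow> ('a + 'a) list \<Rightarrow> bool" where
  single: "x \<in> factor b - R \<Longrightarrow> reduced_word 1 b b [tag b x]"
| cons: "x \<in> factor b - R \<Longrightarrow> reduced_word n (\<not> b) c w \<Longrightarrow> reduced_word (Suc n) b c (tag b x # w)"

lemma reduced_word_words: "reduced_word n b c w \<Longrightarrow> w \<in> syllable_words"
  by (induction rule: reduced_word.induct) auto

lemma reduced_word_pos: "reduced_word n b c w \<Longrightarrow> 1 \<le> n"
  by (induction rule: reduced_word.induct) auto

lemma reduced_word_append:
  "reduced_word n b c v \<Longrightarrow> reduced_word k (\<not> c) e w \<Longrightarrow> reduced_word (n + k) b e (v @ w)"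
  by (induction rule: reduced_word.induct) (auto intro: reduced_word.intros)

lemma reduced_word_head:
  assumes "reduced_word n b c w"
  obtains x w' where "x \<in> factor b - R" "w = tag b x # w'" "n = 1" "w' = []" "c = b"
  | x w' where "x \<in> factor b - R" "w = tag b x # w'" "reduced_word (n - 1) (\<not> b) c w'" "2 \<le> n"
  using assms
proof cases
  case (cons x k v)
  then show ?thesis using that(2)[of x v] reduced_word_pos[of k "\<not> b" c v] by simp
qed (use that(1) in auto)

lemma reduced_word_change_head:
  assumes "reduced_word n b c (tag b x # w)" "y \<in> factor b - R"
  shows "reduced_word n b c (tag b y # w)"
  using assms(1)
proof cases
  case (single z)
  then show ?thesis using assms(2) reduced_word.single by simp
next
  case (cons z k)
  then show ?thesis using assms(2) reduced_word.cons by simp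
qed

text \<open>A syllable from \<open>R\<close> can be moved to the factor of the next syllable and be multiplied into it.\<close>

lemma absorb:
  assumes "r \<in> R" "reduced_word n b c w"
  obtains w' where "reduced_word n b c w'" "tag e r # w \<sim> w'"
proof -
  obtain x v where x: "x \<in> factor b - R" "w = tag b x # v" using reduced_word_head[OF assms(2)] by metis
  then have v: "v \<in> syllable_words" using reduced_word_words[OF assms(2)] by simp
  have rx: "r \<otimes> x \<in> factor b - R"
    using factor_closed(1) R_factor assms(1) x R_mult_iff(1)[OF assms(1)] factor_carrier by auto
  have "[tag e r] @ (tag b x # v) \<sim> [tag b r] @ (tag b x # v)"
    using word_eq_cong[OF word_eq_glue[OF assms(1)], of "[]" "tag b x # v"] x v by simp
  moreover have "[tag b r, tag b x] @ v \<sim> [tag b (r \<otimes> x)] @ v"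
    using word_eq_cong[OF word_eq_mult, of r b x "[]" v] x v R_factor assms(1) by simp
  ultimately have "tag e r # w \<sim> tag b (r \<otimes> x) # v"
    using x(2) amalgam_rel.trans by fastforce
  then show ?thesis using that reduced_word_change_head assms(2) rx x(2) by blast
qed

text \<open>The new syllable stays in front, or it is absorbed, or it merges with the first syllable; in the last
  case the product may lie in \<open>R\<close>, and then it is absorbed by the second syllable.\<close>

lemma multiply_reduced_word:
  assumes y: "y \<in> factor e" and w: "reduced_word n b c w"
  shows "(n = 1 \<and> (\<exists>r\<in>R. tag e y # w \<sim> [tag False r])) \<or>
    (\<exists>k b' w'. reduced_word k b' c w' \<and> tag e y # w \<sim> w' \<and> n - 1 \<le> k \<and> (e = b \<longrightarrow> k \<le> n))"
proof (cases "y \<in> R")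
  case True
  then obtain w' where "reduced_word n b c w'" "tag e y # w \<sim> w'" using absorb[OF _ w] by metis
  then show ?thesis by (intro disjI2 exI[of _ n] exI[of _ b] exI[of _ w']) simp
next
  case yR: False
  note ww = reduced_word_words[OF w]
  show ?thesis
  proof (cases "e = b")
    case False
    then have "reduced_word (Suc n) e c (tag e y # w)" using yR y w reduced_word.cons[of y e] by simp
    moreover have "tag e y # w \<sim> tag e y # w" using word_eq_refl y ww by simp
    ultimately show ?thesis
      using False by (intro disjI2 exI[of _ "Suc n"] exI[of _ e] exI[of _ "tag e y # w"]) simp
  next
    case True
    obtain x v where x: "x \<in> factor b - R" "w = tag b x # v" using reduced_word_head[OF w] by metis
    then have v: "v \<in> syllable_words" using ww by simp
    have eq: "tag e y # w \<sim> tag b (y \<otimes> x) # v"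
      using word_eq_cong[OF word_eq_mult, of y b x "[]" v] x v y True by simp
    have yx: "y \<otimes> x \<in> factor b" using factor_closed(1) y x True by simp
    show ?thesis
    proof (cases "y \<otimes> x \<in> R")
      case False
      then have "reduced_word n b c (tag b (y \<otimes> x) # v)"
        using reduced_word_change_head w x(2) yx by blast
      then show ?thesis using eq by (intro disjI2 exI[of _ n] exI[of _ b] exI[of _ "tag b (y \<otimes> x) # v"]) simp
    next
      case yxR: True
      show ?thesis
      proof (rule reduced_word_head[OF w])
        fix x' w' assume "w = tag b x' # w'" "n = 1" "w' = []"
        then have "tag e y # w \<sim> [tag b (y \<otimes> x)]" using eq x by simp
        then have "tag e y # w \<sim> [tag False (y \<otimes> x)]"
          using word_eq_glue[OF yxR] amalgam_rel.trans by blast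
        then show ?thesis using yxR \<open>n = 1\<close> by blast
      next
        fix x' w' assume "w = tag b x' # w'" "reduced_word (n - 1) (\<not> b) c w'"
        then have "reduced_word (n - 1) (\<not> b) c v" using x(2) by simp
        then obtain u where "reduced_word (n - 1) (\<not> b) c u" "tag b (y \<otimes> x) # v \<sim> u"
          using absorb[OF yxR] by metis
        moreover from this have "tag e y # w \<sim> u" using eq amalgam_rel.trans by blast
        ultimately show ?thesis by (intro disjI2 exI[of _ "n - 1"] exI[of _ "\<not> b"] exI[of _ u]) simp
      qed
    qed
  qed
qed

lemma normal_form:
  assumes "w \<in> syllable_words"
  shows "(\<exists>r\<in>R. w \<sim> [tag False r]) \<or> (\<exists>n b c w'. reduced_word n b c w' \<and> w \<sim> w')"
  using assms
proof (induction w rule: word_induct)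
  case Nil
  then show ?case using amalgam_rel.sym[OF word_eq_one] R_closed(3) by blast
next
  case (Cons b x w)
  have tw: "tag b x # v \<sim> tag b x # v'" if "v \<sim> v'" for v v'
    using word_eq_cong[OF that, of "[tag b x]" "[]"] Cons(1) by simp
  from Cons.IH show ?case
  proof (elim disjE bexE exE conjE)
    fix r assume r: "r \<in> R" "w \<sim> [tag False r]"
    have "tag b x # w \<sim> tag b x # [tag False r]" using tw r by blast
    moreover have "[tag b x, tag False r] \<sim> [tag b x, tag b r]"
      using tw word_eq_glue[OF r(1)] by blast
    moreover have "[tag b x, tag b r] \<sim> [tag b (x \<otimes> r)]" using word_eq_mult Cons(1) R_factor r by blast
    ultimately have eq: "tag b x # w \<sim> [tag b (x \<otimes> r)]" using amalgam_rel.trans by blast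
    show ?thesis
    proof (cases "x \<otimes> r \<in> R")
      case True
      then show ?thesis using eq amalgam_rel.trans word_eq_glue by blast
    next
      case False
      then have "reduced_word 1 b b [tag b (x \<otimes> r)]"
        using reduced_word.single factor_closed(1) Cons(1) R_factor r by simp
      then show ?thesis using eq by blast
    qed
  next
    fix n b' c w' assume w': "reduced_word n b' c w'" "w \<sim> w'"
    then have "tag b x # w \<sim> tag b x # w'" using tw by blast
    then show ?thesis using multiply_reduced_word[OF Cons(1) w'(1)] amalgam_rel.trans by meson
  qed
qed

lemma inverse_word:
  assumes "w \<in> syllable_words"
  obtains w' where "w' \<in> syllable_words" "w @ w' \<sim> []" "w' @ w \<sim> []"
proof -
  have "\<exists>w'\<in>syllable_words. w @ w' \<sim> [] \<and> w' @ w \<sim> []"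
    using assms
  proof (induction w rule: word_induct)
    case Nil
    then show ?case using word_eq_refl[of "[]"] by (intro bexI[of _ "[]"]) auto
  next
    case (Cons b x w)
    then obtain w' where w': "w' \<in> syllable_words" "w @ w' \<sim> []" "w' @ w \<sim> []" by blast
    have ix: "inv x \<in> factor b" using Cons factor_closed(2) by blast
    have "[tag b x, tag b (inv x)] \<sim> [tag b \<one>]" "[tag b (inv x), tag b x] \<sim> [tag b \<one>]"
      using word_eq_mult[OF Cons(1) ix] word_eq_mult[OF ix Cons(1)] factor_carrier[OF Cons(1)] by simp_all
    then have xx: "[tag b x, tag b (inv x)] \<sim> []" "[tag b (inv x), tag b x] \<sim> []"
      using word_eq_one amalgam_rel.trans by blast+
    have "[tag b x] @ (w @ w') @ [tag b (inv x)] \<sim> [tag b x] @ [] @ [tag b (inv x)]"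
      using word_eq_cong[OF w'(2), of "[tag b x]" "[tag b (inv x)]"] Cons(1) ix by simp
    moreover have "w' @ [tag b (inv x), tag b x] @ w \<sim> w' @ [] @ w"
      using word_eq_cong[OF xx(2) w'(1) Cons(2)] .
    ultimately have "(tag b x # w) @ (w' @ [tag b (inv x)]) \<sim> []" "(w' @ [tag b (inv x)]) @ (tag b x # w) \<sim> []"
      using xx(1) w'(3) amalgam_rel.trans by fastforce+
    then show ?case using w'(1) ix by (intro bexI[of _ "w' @ [tag b (inv x)]"]) auto
  qed
  then show ?thesis using that by blast
qed

abbreviation word_class :: "('a + 'a) list \<Rightarrow> ('a + 'a) list set" where
  "word_class w \<equiv> amalgam_rel (G\<lparr>carrier := A\<rparr>) (G\<lparr>carrier := B\<rparr>) R `` {w}"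

abbreviation amalgamated_product :: "('a + 'a) list set monoid" where
  "amalgamated_product \<equiv> amalgam (G\<lparr>carrier := A\<rparr>) (G\<lparr>carrier := B\<rparr>) R"

abbreviation lift :: "('a + 'a) list set \<Rightarrow> 'a" where
  "lift \<equiv> amalgam_lift G (\<lambda>x. x) (\<lambda>x. x)"

lemma carrier_amalgamated_product: "carrier amalgamated_product = word_class ` syllable_words"
  unfolding amalgam_def syllable_words_def by (auto simp: quotient_def)

lemma lift_word_class:
  assumes "w \<in> syllable_words" shows "lift (word_class w) = eval_word w"
proof -
  have "eval_word ` word_class w = {eval_word w}"
  proof (intro equalityI subsetI)
    fix g assume "g \<in> eval_word ` word_class w"
    then obtain v where "w \<sim> v" "g = eval_word v" by blast
    then show "g \<in> {eval_word w}" using word_eq_sound by simp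
  qed (use word_eq_refl[OF assms] in blast)
  then show ?thesis by (simp add: amalgam_lift_def)
qed

lemma word_class_eq: "u \<sim> v \<Longrightarrow> word_class u = word_class v"
  unfolding Image_singleton using amalgam_rel.sym amalgam_rel.trans by blast

lemma mult_word_class:
  assumes "u \<in> syllable_words" "v \<in> syllable_words"
  shows "word_class u \<otimes>\<^bsub>amalgamated_product\<^esub> word_class v = word_class (u @ v)"
proof -
  have "word_class (u' @ v') = word_class (u @ v)" if "u \<sim> u'" "v \<sim> v'" for u' v'
    using word_class_eq amalgam_rel.append that by metis
  moreover have "u \<in> word_class u" "v \<in> word_class v" using word_eq_refl assms by auto
  ultimately have "(\<Union>u'\<in>word_class u. \<Union>v'\<in>word_class v. word_class (u' @ v')) = word_class (u @ v)"
    by blast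
  then show ?thesis by (simp add: amalgam_def)
qed

lemma lift_hom: "lift \<in> hom amalgamated_product G"
  by (rule homI)
    (auto simp: carrier_amalgamated_product lift_word_class mult_word_class eval_word_append eval_word_closed)

lemma lift_image: "lift ` carrier amalgamated_product = generate G (A \<union> B)"
proof -
  have "lift ` carrier amalgamated_product = eval_word ` syllable_words"
    unfolding carrier_amalgamated_product image_image using lift_word_class by auto
  also have "\<dots> = generate G (A \<union> B)"
  proof (intro equalityI subsetI)
    fix g assume "g \<in> eval_word ` syllable_words"
    then obtain w where w: "w \<in> syllable_words" "g = eval_word w" by blast
    from w(1) have "eval_word w \<in> generate G (A \<union> B)"
    proof (induction w rule: word_induct)
      case (Cons b x w)
      then have "x \<in> A \<union> B" by (simp add: factor_def split: if_splits)
      then have "x \<otimes> eval_word w \<in> generate G (A \<union> B)"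
        using generate.eng[OF generate.incl Cons.IH] by blast
      then show ?case by simp
    qed (simp add: generate.one)
    then show "g \<in> generate G (A \<union> B)" using w(2) by simp
  next
    fix g assume "g \<in> generate G (A \<union> B)"
    then show "g \<in> eval_word ` syllable_words"
    proof (induction rule: generate.induct)
      case one
      then show ?case by (intro image_eqI[of _ _ "[]"]) auto
    next
      case (incl h)
      then obtain b where "h \<in> factor b" unfolding factor_def by (metis Un_iff)
      then show ?case using factor_carrier by (intro image_eqI[of _ _ "[tag b h]"]) auto
    next
      case (inv h)
      then obtain b where "h \<in> factor b" unfolding factor_def by (metis Un_iff)
      then have "inv h \<in> factor b" using factor_closed(2) by blast
      then show ?case using factor_carrier by (intro image_eqI[of _ _ "[tag b (inv h)]"]) auto
    next
      case (eng g h)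
      then obtain v w where "v \<in> syllable_words" "g = eval_word v" "w \<in> syllable_words" "h = eval_word w" by blast
      then show ?case by (intro image_eqI[of _ _ "v @ w"]) (auto simp: eval_word_append)
    qed
  qed
  finally show ?thesis .
qed

definition reduced :: "nat \<Rightarrow> bool \<Rightarrow> bool \<Rightarrow> 'a \<Rightarrow> bool" where
  "reduced n b c g \<longleftrightarrow> (\<exists>w. reduced_word n b c w \<and> eval_word w = g)"

text \<open>Two words with the same value differ by a word of value \<open>\<one>\<close>. Its normal form cannot be a reduced word, so
  it is a syllable from \<open>R\<close>, and this syllable is \<open>\<one>\<close>.\<close>

lemma lift_inj:
  assumes "\<And>n b c. \<not> reduced n b c \<one>"
  shows "inj_on lift (carrier amalgamated_product)"
proof (rule inj_onI)
  have triv: "w \<sim> []" if w: "w \<in> syllable_words" "eval_word w = \<one>" for w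
    using normal_form[OF w(1)]
  proof (elim disjE bexE exE conjE)
    fix r assume r: "r \<in> R" "w \<sim> [tag False r]"
    then have "r = \<one>" using word_eq_sound[OF r(2)] w(2) R_carrier by simp
    then show ?thesis using r(2) word_eq_one amalgam_rel.trans by blast
  next
    fix n b c w' assume "reduced_word n b c w'" "w \<sim> w'"
    then have "reduced n b c \<one>" using word_eq_sound w(2) unfolding reduced_def by metis
    then show ?thesis using assms by blast
  qed
  fix S T assume "S \<in> carrier amalgamated_product" "T \<in> carrier amalgamated_product" and eq: "lift S = lift T"
  then obtain u v where u: "u \<in> syllable_words" "S = word_class u" and v: "v \<in> syllable_words" "T = word_class v"
    unfolding carrier_amalgamated_product by blast
  obtain v' where v': "v' \<in> syllable_words" "v @ v' \<sim> []" "v' @ v \<sim> []" using inverse_word[OF v(1)] .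
  have "eval_word (v' @ u) = eval_word (v' @ v)"
    using eq lift_word_class u v v' by (simp add: eval_word_append)
  also have "\<dots> = \<one>" using word_eq_sound[OF v'(3)] by simp
  finally have "v' @ u \<sim> []" using triv v'(1) u(1) by simp
  then have "v @ (v' @ u) \<sim> v" using word_eq_cong[of "v' @ u" "[]" v "[]"] v(1) by simp
  moreover have "(v @ v') @ u \<sim> u" using word_eq_cong[OF v'(2), of "[]" u] u(1) by simp
  ultimately have "u \<sim> v" using amalgam_rel.sym amalgam_rel.trans by (metis append_assoc)
  then show "S = T" using u v word_class_eq by simp
qed

abbreviation generated :: "'a set" where "generated \<equiv> generate G (A \<union> B)"

lemma factor_generated: "x \<in> factor b \<Longrightarrow> x \<in> generated"
  using generate.incl[of x "A \<union> B"] by (auto simp: factor_def split: if_splits)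

lemma generated_subgroup: "subgroup generated G"
  using subgroup.subset[OF A_subgroup] subgroup.subset[OF B_subgroup] by (intro generate_is_subgroup) simp

lemma reduced_carrier: "reduced n b c g \<Longrightarrow> g \<in> carrier G"
  unfolding reduced_def using reduced_word_words eval_word_closed by blast

lemma reduced_pos: "reduced n b c g \<Longrightarrow> 1 \<le> n"
  unfolding reduced_def using reduced_word_pos by blast

lemma reduced_single: "x \<in> factor b - R \<Longrightarrow> reduced 1 b b x"
  unfolding reduced_def using reduced_word.single factor_carrier by (intro exI[of _ "[tag b x]"]) auto

lemma reduced_mult:
  assumes "reduced n b c g" "reduced k (\<not> c) e h"
  shows "reduced (n + k) b e (g \<otimes> h)"
proof -
  obtain v w where "reduced_word n b c v" "eval_word v = g" "reduced_word k (\<not> c) e w" "eval_word w = h"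
    using assms unfolding reduced_def by blast
  then have "reduced_word (n + k) b e (v @ w)" "eval_word (v @ w) = g \<otimes> h"
    using reduced_word_append eval_word_append reduced_word_words by blast+
  then show ?thesis unfolding reduced_def by blast
qed

lemma reduced_head:
  assumes "reduced n b c g"
  obtains "g \<in> factor b - R" "n = 1" "c = b"
  | x h where "x \<in> factor b - R" "g = x \<otimes> h" "reduced (n - 1) (\<not> b) c h" "2 \<le> n"
proof -
  obtain w where w: "reduced_word n b c w" "eval_word w = g" using assms unfolding reduced_def by blast
  show ?thesis
    by (rule reduced_word_head[OF w(1)])
      (use w(2) that factor_carrier in \<open>auto simp: reduced_def\<close>)
qed

lemma reduced_induct [consumes 1, case_names single cons]:
  assumes "reduced n b c g"
    and "\<And>b x. x \<in> factor b - R \<Longrightarrow> P 1 b b x"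
    and "\<And>n b c x h. x \<in> factor b - R \<Longrightarrow> reduced n (\<not> b) c h \<Longrightarrow> P n (\<not> b) c h \<Longrightarrow> P (Suc n) b c (x \<otimes> h)"
  shows "P n b c g"
proof -
  have "P n b c (eval_word w)" if "reduced_word n b c w" for w
    using that
  proof (induction rule: reduced_word.induct)
    case (single x b)
    then have "x \<in> carrier G" using factor_carrier by blast
    then show ?case using assms(2)[OF single] by simp
  next
    case (cons x b n c w)
    then show ?case using assms(3)[of x b n c "eval_word w"] unfolding reduced_def by simp blast
  qed
  then show ?thesis using assms(1) unfolding reduced_def by blast
qed

lemma reduced_inv: "reduced n b c g \<Longrightarrow> reduced n c b (inv g)"
proof (induction rule: reduced_induct)
  case (single b x)
  then have "inv x \<in> factor b - R"
    using factor_closed(2) R_closed(2) factor_carrier by (metis Diff_iff inv_inv)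
  then show ?case by (rule reduced_single)
next
  case (cons n b c x h)
  then have "inv x \<in> factor b - R"
    using factor_closed(2) R_closed(2) factor_carrier by (metis Diff_iff inv_inv)
  then have "reduced 1 (\<not> \<not> b) b (inv x)" using reduced_single[of "inv x" b] by simp
  then have "reduced (n + 1) c b (inv h \<otimes> inv x)" using reduced_mult cons by blast
  moreover have "x \<in> carrier G" "h \<in> carrier G" using cons factor_carrier reduced_carrier by blast+
  ultimately show ?case by (simp add: inv_mult_group)
qed

lemma multiply_reduced:
  assumes "y \<in> factor e" "reduced n b c g"
  shows "(n = 1 \<and> y \<otimes> g \<in> R) \<or> (\<exists>k b'. reduced k b' c (y \<otimes> g) \<and> n - 1 \<le> k \<and> (e = b \<longrightarrow> k \<le> n))"
proof -
  obtain w where w: "reduced_word n b c w" "eval_word w = g" using assms(2) unfolding reduced_def by blast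
  have ev: "eval_word w' = y \<otimes> g" if "tag e y # w \<sim> w'" for w'
    using word_eq_sound[OF that] w(2) by simp
  show ?thesis using multiply_reduced_word[OF assms(1) w(1)]
  proof (elim disjE conjE bexE exE)
    fix r assume "n = 1" "r \<in> R" "tag e y # w \<sim> [tag False r]"
    then show ?thesis using ev[of "[tag False r]"] R_carrier by simp
  next
    fix k b' w' assume "reduced_word k b' c w'" "tag e y # w \<sim> w'" "n - 1 \<le> k" "e = b \<longrightarrow> k \<le> n"
    then show ?thesis using ev[of w'] unfolding reduced_def by blast
  qed
qed

lemma multiply_reduced_R:
  assumes "r \<in> R" "reduced n b c g"
  shows "reduced n b c (r \<otimes> g)"
proof -
  obtain w where w: "reduced_word n b c w" "eval_word w = g" using assms(2) unfolding reduced_def by blast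
  obtain w' where "reduced_word n b c w'" "tag b r # w \<sim> w'" using absorb[OF assms(1) w(1)] .
  then show ?thesis using word_eq_sound[of "tag b r # w" w'] w(2) unfolding reduced_def by auto
qed

lemma generated_reduced:
  assumes "g \<in> generated"
  shows "g \<in> R \<or> (\<exists>n b c. reduced n b c g)"
proof -
  have "g \<in> lift ` word_class ` syllable_words"
    using assms unfolding lift_image[symmetric] carrier_amalgamated_product .
  then obtain w where w: "w \<in> syllable_words" "g = eval_word w"
    using lift_word_class by blast
  show ?thesis using normal_form[OF w(1)]
  proof (elim disjE bexE exE conjE)
    fix r assume "r \<in> R" "w \<sim> [tag False r]"
    then show ?thesis using word_eq_sound[of w "[tag False r]"] w(2) R_carrier by simp
  next
    fix n b c w' assume "reduced_word n b c w'" "w \<sim> w'"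
    then show ?thesis using word_eq_sound[of w w'] w(2) unfolding reduced_def by metis
  qed
qed

context
  assumes one_not_reduced: "\<And>n b c. \<not> reduced n b c \<one>"
begin

lemma R_not_reduced:
  assumes "r \<in> R" shows "\<not> reduced n b c r"
proof
  assume "reduced n b c r"
  then have "reduced n b c (inv r \<otimes> r)" using multiply_reduced_R R_closed(2) assms by blast
  then show False using one_not_reduced R_carrier[OF assms] by simp
qed

text \<open>Cancelling a reduced word of length \<open>n'\<close> from one of length \<open>n > n'\<close>, syllable by syllable, leaves a
  reduced word of positive length, whereas the quotient of the two values is \<open>\<one>\<close>.\<close>

lemma reduced_length_le:
  assumes "reduced n b c g" "reduced n' b' c' g"
  shows "n \<le> n'"
proof (rule ccontr)
  assume "\<not> n \<le> n'"
  moreover have "\<exists>k b''. reduced k b'' c (inv h \<otimes> g)" if "reduced n' b' c' h" "reduced n b c g" "n' < n" for n' b' c' h n b g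
    using that
  proof (induction arbitrary: n b g rule: reduced_induct)
    case (single b' x)
    then have "inv x \<in> factor b'" using factor_closed(2) by blast
    then show ?case using multiply_reduced[of "inv x" b' n b c g] single by auto
  next
    case (cons n' b' c' x h)
    then have x: "inv x \<in> factor b'" "x \<in> carrier G" "h \<in> carrier G" "g \<in> carrier G"
      using factor_closed(2) factor_carrier reduced_carrier by blast+
    obtain k b'' where k: "reduced k b'' c (inv x \<otimes> g)" "n - 1 \<le> k"
      using multiply_reduced[OF x(1) cons.prems(1)] cons.prems(2) reduced_pos[OF cons.hyps(2)] by auto
    then obtain k' e where "reduced k' e c (inv h \<otimes> (inv x \<otimes> g))"
    proof -
      have "n' < k" using k(2) cons.prems(2) by linarith
      then show ?thesis using cons.IH[OF k(1)] that by blast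
    qed
    then show ?case using x by (auto simp: inv_mult_group m_assoc)
  qed
  ultimately have "\<exists>k b''. reduced k b'' c (inv g \<otimes> g)" using assms by (meson not_le)
  then show False using one_not_reduced reduced_carrier[OF assms(1)] by simp
qed

lemma reduced_length_unique: "reduced n b c g \<Longrightarrow> reduced n' b' c' g \<Longrightarrow> n = n'"
  using reduced_length_le by (meson le_antisym)

lemma factor_reduced_length:
  assumes "x \<in> factor b" "reduced n b' c' x" shows "n = 1"
  using assms reduced_single[of x b] R_not_reduced reduced_length_unique by blast

text \<open>One step towards the centre of a bounded orbit in the Bass-Serre tree. Let \<open>f\<close> have maximal
  length \<open>N\<close> in \<open>K\<close> and let \<open>x\<close> be its first syllable, from the factor \<open>b\<close>. If the
  reduced word of an element of \<open>K\<close> ended in the other factor, its product with \<open>f\<close> would be reduced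
  as it stands and longer than \<open>N\<close>. With inverses, all reduced words of elements of \<open>K\<close> start and end in
  the factor \<open>b\<close>. For the same
  reason, the words of length at least two start in \<open>x R\<close> and end in \<open>R (inv x)\<close>. So conjugation by
  \<open>inv x\<close> shortens these words, and it maps the factor \<open>b\<close> to itself.\<close>

lemma shorten:
  assumes K: "subgroup K G" "K \<subseteq> generated"
    and bound: "\<And>g n b c. g \<in> K \<Longrightarrow> reduced n b c g \<Longrightarrow> n \<le> N"
    and f: "f \<in> K" "reduced N b c f" and N: "2 \<le> N"
  obtains x where "x \<in> factor b"
    "\<And>g n b c. g \<in> K \<Longrightarrow> reduced n b c (inv x \<otimes> g \<otimes> x) \<Longrightarrow> n \<le> N - 1"
proof -
  obtain x f' where x: "x \<in> factor b - R" "f = x \<otimes> f'" "reduced (N - 1) (\<not> b) c f'"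
    by (rule reduced_head[OF f(2)]) (use N in auto)
  have xc: "x \<in> carrier G" "inv x \<in> factor b" using x factor_carrier factor_closed(2) by blast+
  have fc: "f' \<in> carrier G" using reduced_carrier x(3) by blast
  \<comment> \<open>Otherwise \<open>g \<otimes> f\<close> would be reduced as it stands, and longer than \<open>N\<close>.\<close>
  have last: "c' = b" if g: "g \<in> K" "reduced n b' c' g" for g n b' c'
  proof (rule ccontr)
    assume "c' \<noteq> b"
    then have "(\<not> c') = b" by blast
    then have "reduced (n + N) b' c (g \<otimes> f)" using reduced_mult[OF g(2)] f(2) by simp
    moreover have "g \<otimes> f \<in> K" using g f subgroup.m_closed[OF K(1)] by blast
    ultimately show False using bound reduced_pos[OF g(2)] by fastforce
  qed
  have first: "b' = b" if g: "g \<in> K" "reduced n b' c' g" for g n b' c'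
    using last[of "inv g"] reduced_inv[OF g(2)] subgroup.m_inv_closed[OF K(1) g(1)] by blast
  have "n \<le> N - 1" if g: "g \<in> K" and red: "reduced n b' c' (inv x \<otimes> g \<otimes> x)" for g n b' c'
  proof -
    have gc: "g \<in> carrier G" using g subgroup.subset[OF K(1)] by blast
    have in_factor: "n \<le> N - 1" if "g \<in> factor b"
    proof -
      have "inv x \<otimes> g \<otimes> x \<in> factor b" using that xc x(1) factor_closed(1) by blast
      then show ?thesis using factor_reduced_length[OF _ red] N by simp
    qed
    show ?thesis
    proof (cases "g \<in> R")
      case True
      then show ?thesis using in_factor R_factor by blast
    next
      case False
      then obtain k b1 c1 where "reduced k b1 c1 g" using generated_reduced g K(2) by blast
      then have k: "reduced k b b g" using first[OF g] last[OF g] by blast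
      then show ?thesis
      proof (cases rule: reduced_head)
        case 1
        then show ?thesis using in_factor by blast
      next
        case (2 y h)
        have yc: "y \<in> carrier G" "h \<in> carrier G" using 2 factor_carrier reduced_carrier by blast+
        have xy: "inv x \<otimes> y \<in> R"
        proof (rule ccontr)
          assume "inv x \<otimes> y \<notin> R"
          then have "reduced 1 b b (inv x \<otimes> y)" using reduced_single factor_closed(1) xc(2) 2(1) by blast
          then have "reduced (1 + (k - 1)) b b (inv x \<otimes> y \<otimes> h)" using reduced_mult 2(3) by blast
          then have "reduced (N - 1 + (1 + (k - 1))) c b (inv f' \<otimes> (inv x \<otimes> y \<otimes> h))"
            using reduced_mult[OF reduced_inv[OF x(3)], of "1 + (k - 1)" b] by (simp only: not_not)
          moreover have "inv f' \<otimes> (inv x \<otimes> y \<otimes> h) = inv f \<otimes> g"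
            unfolding x(2) 2(2) using xc(1) fc yc by (simp add: inv_mult_group m_assoc)
          moreover have "inv f \<otimes> g \<in> K"
            using g f subgroup.m_closed[OF K(1)] subgroup.m_inv_closed[OF K(1)] by blast
          ultimately show False using bound 2(4) N by fastforce
        qed
        then have "reduced (k - 1) (\<not> b) b (inv x \<otimes> g)"
          using multiply_reduced_R[OF xy 2(3)] unfolding 2(2) using xc(1) yc by (simp add: m_assoc)
        then have "reduced (k - 1) b (\<not> b) (inv (inv x \<otimes> g))" by (rule reduced_inv)
        note multiply_reduced[OF xc(2) this]
        moreover have inv_eq: "inv x \<otimes> inv (inv x \<otimes> g) = inv (inv x \<otimes> g \<otimes> x)"
          using xc(1) gc by (simp add: inv_mult_group m_assoc)
        moreover have "inv (inv x \<otimes> g \<otimes> x) \<notin> R" using R_not_reduced reduced_inv[OF red] by blast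
        ultimately obtain l e where "reduced l e (\<not> b) (inv (inv x \<otimes> g \<otimes> x))" "l \<le> k - 1"
          by auto
        then have "n \<le> k - 1" using reduced_length_unique[OF reduced_inv[OF red]] by blast
        moreover have "k \<le> N" using bound g k by blast
        ultimately show ?thesis by linarith
      qed
    qed
  qed
  then show ?thesis using that[of x] x(1) by blast
qed

text \<open>Iterating \<open>shorten\<close> leads to a conjugate of \<open>K\<close> in which all elements have length at most one, that is,
  to a subgroup contained in the union of the two factors. A group is not the union of two proper
  subgroups.\<close>

lemma bounded_subgroup_in_factor:
  assumes K: "subgroup K G" "K \<subseteq> generated"
    and bound: "\<And>g n b c. g \<in> K \<Longrightarrow> reduced n b c g \<Longrightarrow> n \<le> N"
  shows "\<exists>u\<in>generated. \<exists>b. conj_set G u K \<subseteq> factor b"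
  using assms
proof (induction N arbitrary: K rule: less_induct)
  case (less N)
  note Kc = subgroup.subset[OF less.prems(1)]
  consider "\<exists>M<N. \<forall>g n b c. g \<in> K \<longrightarrow> reduced n b c g \<longrightarrow> n \<le> M" | f b c where "2 \<le> N" "f \<in> K" "reduced N b c f"
    | "N \<le> 1" 
  proof -
    show ?thesis
    proof (cases "N \<le> 1")
      case True
      then show ?thesis by (rule that(3))
    next
      case N1: False
      show ?thesis
      proof (cases "\<exists>M<N. \<forall>g n b c. g \<in> K \<longrightarrow> reduced n b c g \<longrightarrow> n \<le> M")
        case True
        then show ?thesis by (rule that(1))
      next
        case False
        have "N - 1 < N" using N1 by simp
        then obtain f n b c where f: "f \<in> K" "reduced n b c f" "\<not> n \<le> N - 1" using False by blast
        then have "n = N" using less.prems(3)[OF f(1,2)] by linarith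
        then show ?thesis using that(2)[of f b c] f N1 by simp
      qed
    qed
  qed
  then show ?case
  proof cases
    case 1
    then show ?thesis using less.IH[OF _ less.prems(1,2)] by blast
  next
    case 3
    have "g \<in> factor False \<or> g \<in> factor True" if gK: "g \<in> K" for g
    proof (cases "g \<in> R")
      case False
      then obtain n b c where r: "reduced n b c g" using generated_reduced gK less.prems(2) by blast
      then show ?thesis
      proof (cases rule: reduced_head)
        case 1
        then show ?thesis by (cases b) auto
      next
        case 2
        then show ?thesis using less.prems(3)[OF gK r] \<open>N \<le> 1\<close> by simp
      qed
    qed (use R_factor in blast)
    moreover have "K \<subseteq> factor False \<or> K \<subseteq> factor True"
    proof (rule ccontr)
      assume "\<not> ?thesis"
      then obtain g h where g: "g \<in> K" "g \<notin> factor False" and h: "h \<in> K" "h \<notin> factor True" by blast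
      then have gh: "g \<in> factor True" "h \<in> factor False" using calculation by blast+
      have c: "g \<in> carrier G" "h \<in> carrier G" using g h Kc by auto
      have "g \<otimes> h \<in> factor False \<or> g \<otimes> h \<in> factor True"
        using calculation g h subgroup.m_closed[OF less.prems(1)] by blast
      then show False
      proof
        assume "g \<otimes> h \<in> factor False"
        then have "(g \<otimes> h) \<otimes> inv h \<in> factor False" using factor_closed gh by blast
        then show False using g c by (simp add: m_assoc)
      next
        assume "g \<otimes> h \<in> factor True"
        then have "inv g \<otimes> (g \<otimes> h) \<in> factor True" using factor_closed gh by blast
        then show False using h c by (simp add: inv_mult_cancel)
      qed
    qed
    moreover have "conj_set G \<one> K = K" using Kc by (force simp: conj_set_eq)
    ultimately show ?thesis using generate.one by (intro bexI[of _ \<one>]) auto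
  next
    case (2 f b c)
    obtain x where x: "x \<in> factor b"
      "\<And>g n b c. g \<in> K \<Longrightarrow> reduced n b c (inv x \<otimes> g \<otimes> x) \<Longrightarrow> n \<le> N - 1"
      by (rule shorten[OF less.prems(1,2) _ 2(2,3,1)]) (use less.prems(3) in blast)+
    have xc: "x \<in> carrier G" "x \<in> generated" using x(1) factor_carrier factor_generated by blast+
    have ix: "inv x \<in> generated" using subgroup.m_inv_closed[OF generated_subgroup] xc by blast
    let ?L = "conj_set G (inv x) K"
    have L: "?L = (\<lambda>g. inv x \<otimes> g \<otimes> x) ` K" using xc by (simp add: conj_set_eq)
    have "subgroup ?L G" using conj_set_subgroup[OF less.prems(1)] xc(1) by simp
    moreover have "?L \<subseteq> generated"
      using L less.prems(2) ix xc(2) subgroup.m_closed[OF generated_subgroup] by (auto simp: subset_eq)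
    moreover have "n \<le> N - 1" if g: "g \<in> ?L" "reduced n b c g" for g n b c
    proof -
      obtain g' where "g' \<in> K" "g = inv x \<otimes> g' \<otimes> x" using g(1) unfolding L by blast
      then show ?thesis using x(2) g(2) by blast
    qed
    ultimately obtain u e where u: "u \<in> generated" "conj_set G u ?L \<subseteq> factor e"
      using less.IH[of "N - 1" ?L] 2(1) by auto
    have uc: "u \<in> carrier G" using subgroup.subset[OF generated_subgroup] u(1) by blast
    have "conj_set G (u \<otimes> inv x) K = conj_set G u ?L"
      unfolding conj_set_eq image_image
      using uc xc(1) Kc by (intro image_cong refl) (auto simp: inv_mult_group m_assoc)
    moreover have "u \<otimes> inv x \<in> generated" using u(1) ix subgroup.m_closed[OF generated_subgroup] by blast
    ultimately show ?thesis using u(2) by auto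
  qed
qed

end

end

section \<open>Alternating products and quasiconvex subgroups meeting a parabolic one\<close>

context amalgamated_pair begin

text \<open>\<open>T\<close> lists the partial products of an alternating product with \<open>n + 1\<close> syllables. It is required to
  begin and to end with a syllable from the first factor; syllables in \<open>R\<close>, such as \<open>\<one>\<close>, are allowed
  at these two places, so that every alternating product can be completed to one of this form.\<close>

definition zigzag :: "(nat \<Rightarrow> 'a) \<Rightarrow> nat \<Rightarrow> bool" where
  "zigzag T n \<longleftrightarrow> even n \<and> (\<forall>j\<le>Suc n. T j \<in> carrier G) \<and>
     (\<forall>j\<le>n. inv (T j) \<otimes> T (Suc j) \<in> factor (odd j)) \<and>
     (\<forall>j. 1 \<le> j \<and> j < n \<longrightarrow> inv (T j) \<otimes> T (Suc j) \<notin> R)"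

lemma reduced_parity: "reduced n b c g \<Longrightarrow> c = (b \<noteq> even n)"
  by (induction rule: reduced_induct) auto

lemma reduced_prefixes:
  "reduced n b c g \<Longrightarrow> u \<in> carrier G \<Longrightarrow>
    \<exists>t. t 0 = u \<and> t n = u \<otimes> g \<and> (\<forall>j\<le>n. t j \<in> carrier G) \<and>
      (\<forall>j<n. inv (t j) \<otimes> t (Suc j) \<in> factor (b \<noteq> odd j) - R)"
proof (induction arbitrary: u rule: reduced_induct)
  case (single b x)
  then have "x \<in> carrier G" using factor_carrier by blast
  then show ?case using single
    by (intro exI[of _ "\<lambda>j. if j = 0 then u else u \<otimes> x"]) (auto simp: inv_mult_cancel)
next
  case (cons n b c x h)
  have x: "x \<in> carrier G" "h \<in> carrier G"
    using cons.hyps(1) factor_carrier reduced_carrier[OF cons.hyps(2)] by blast+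
  obtain t where t: "t 0 = u \<otimes> x" "t n = u \<otimes> x \<otimes> h" "\<And>j. j \<le> n \<Longrightarrow> t j \<in> carrier G"
    "\<And>j. j < n \<Longrightarrow> inv (t j) \<otimes> t (Suc j) \<in> factor ((\<not> b) \<noteq> odd j) - R"
    using cons.IH[OF m_closed[OF cons.prems x(1)]] by blast
  have "inv (case_nat u t j) \<otimes> case_nat u t (Suc j) \<in> factor (b \<noteq> odd j) - R" if "j < Suc n" for j
  proof (cases j)
    case 0
    then show ?thesis using t(1) cons.hyps(1) cons.prems x by (simp add: inv_mult_cancel)
  next
    case (Suc k)
    then have "((\<not> b) \<noteq> odd k) = (b \<noteq> odd j)" by auto
    then show ?thesis using t(4)[of k] that Suc by simp
  qed
  moreover have "case_nat u t j \<in> carrier G" if "j \<le> Suc n" for j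
    using that t(3) cons.prems by (cases j) auto
  ultimately show ?case using t(1,2) x cons.prems
    by (intro exI[of _ "case_nat u t"]) (simp add: m_assoc)
qed

text \<open>If necessary, the product is completed by a syllable \<open>\<one>\<close> at the beginning or at the end: \<open>a\<close>
  tells whether it is needed at the beginning.\<close>

lemma zigzag_reduced:
  assumes "reduced k b c g" "u \<in> carrier G"
  obtains T n where "zigzag T n" "T 0 = u" "T (Suc n) = u \<otimes> g" "k \<le> Suc n"
proof -
  obtain t where t: "t 0 = u" "t k = u \<otimes> g" "\<And>j. j \<le> k \<Longrightarrow> t j \<in> carrier G"
    "\<And>j. j < k \<Longrightarrow> inv (t j) \<otimes> t (Suc j) \<in> factor (b \<noteq> odd j) - R"
    using reduced_prefixes[OF assms] by blast
  define a where "a = (if b then 1 else 0 :: nat)"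
  define n where "n = a + k + (if c then 1 else 0) - 1"
  define T where "T j = t (min (j - a) k)" for j
  have k: "1 \<le> k" using reduced_pos assms(1) .
  have step: "inv (T j) \<otimes> T (Suc j) \<in> factor (odd j) \<and> (1 \<le> j \<and> j < n \<longrightarrow> inv (T j) \<otimes> T (Suc j) \<notin> R)"
    if "j \<le> n" for j
  proof -
    consider "j < a" | "a \<le> j" "j < a + k" | "a + k \<le> j" by linarith
    then show ?thesis
    proof cases
      case 1
      then have "j = 0" "a = 1" by (auto simp: a_def split: if_splits)
      then have "inv (T j) \<otimes> T (Suc j) = \<one>" using t(3)[of 0] by (simp add: T_def)
      then show ?thesis using \<open>j = 0\<close> factor_closed(3) by simp
    next
      case 2
      then have "T j = t (j - a)" "T (Suc j) = t (Suc (j - a))" "j - a < k"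
        by (auto simp: T_def Suc_diff_le)
      moreover have "(b \<noteq> odd (j - a)) = odd j"
        using 2(1) by (cases b) (auto simp: a_def)
      ultimately show ?thesis using t(4)[of "j - a"] by simp
    next
      case 3
      then have j: "j = n" "j = a + k" "c" using that k by (auto simp: n_def split: if_splits)
      have "c = (b \<noteq> even k)" using reduced_parity assms(1) .
      then have "even j" using j(2,3) by (cases b) (auto simp: a_def)
      moreover have "inv (T j) \<otimes> T (Suc j) = \<one>" using t(3)[of k] j(2) by (simp add: T_def)
      ultimately show ?thesis using j(1) factor_closed(3) by simp
    qed
  qed
  have "even n"
    using reduced_parity[OF assms(1)] k by (cases b; cases c) (auto simp: n_def a_def)
  moreover have "T j \<in> carrier G" for j using t(3) by (simp add: T_def)
  ultimately have "zigzag T n"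
    using step unfolding zigzag_def by (intro conjI allI impI) (simp_all add: less_imp_le)
  moreover have "T 0 = u" using t(1) by (simp add: T_def)
  moreover have "T (Suc n) = u \<otimes> g" using t(2) k by (auto simp: T_def n_def)
  moreover have "k \<le> Suc n" by (auto simp: n_def)
  ultimately show ?thesis using that by blast
qed

lemma zigzag_generated:
  assumes "g \<in> generated" "u \<in> carrier G"
  obtains T n where "zigzag T n" "T 0 = u" "T (Suc n) = u \<otimes> g"
proof (cases "g \<in> R")
  case True
  \<comment> \<open>Elements of \<open>R\<close> belong to the first factor, so one syllable suffices.\<close>
  let ?T = "\<lambda>j::nat. if j = 0 then u else u \<otimes> g"
  have "zigzag ?T 0"
    using True R_factor[of g False] assms(2) R_carrier by (auto simp: zigzag_def inv_mult_cancel)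
  then show ?thesis using that[of ?T 0] by simp
next
  case False
  then obtain n b c where "reduced n b c g" using generated_reduced assms(1) by blast
  then show ?thesis using zigzag_reduced[OF _ assms(2)] that by metis
qed

lemma zigzag_in_generated:
  assumes "zigzag T n" "T 0 \<in> generated" "j \<le> Suc n"
  shows "T j \<in> generated"
  using assms(3)
proof (induction j)
  case (Suc j)
  then have "inv (T j) \<otimes> T (Suc j) \<in> generated" "T j \<in> carrier G" "T (Suc j) \<in> carrier G"
    using assms(1) factor_generated unfolding zigzag_def by auto
  then show ?case
    using Suc subgroup.m_closed[OF generated_subgroup, of "T j" "inv (T j) \<otimes> T (Suc j)"]
    by (simp add: mult_inv_cancel)
qed (rule assms(2))

end

text \<open>The constants of the theorem are found in this context, before \<open>h\<close> is chosen.\<close>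

locale parabolic_pair = relatively_hyperbolic_group +
  fixes i g Q\<^sub>1 Q\<^sub>2 P R
  assumes i: "i \<in> {1..m}" and g: "g \<in> carrier G" and P_eq: "P = conj_set G g (H i)"
    and Q\<^sub>1: "relatively_quasiconvex G X H m Q\<^sub>1" and Q\<^sub>2: "relatively_quasiconvex G X H m Q\<^sub>2"
    and R\<^sub>1: "R = Q\<^sub>1 \<inter> P" and R\<^sub>2: "R = Q\<^sub>2 \<inter> P"
begin

definition Q :: "bool \<Rightarrow> 'a set" where "Q b = (if b then Q\<^sub>2 else Q\<^sub>1)"

lemma Q_subgroup: "subgroup (Q b) G"
  using Q\<^sub>1 Q\<^sub>2 by (simp add: Q_def relatively_quasiconvex_def)

lemma Q_carrier: "q \<in> Q b \<Longrightarrow> q \<in> carrier G"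
  using subgroup.subset[OF Q_subgroup] by blast

lemma R_eq: "R = Q b \<inter> P"
  using R\<^sub>1 R\<^sub>2 by (simp add: Q_def)

lemma P_subgroup: "subgroup P G"
  unfolding P_eq using conj_set_subgroup H_subgroup i g by blast

lemma P_carrier: "p \<in> P \<Longrightarrow> p \<in> carrier G"
  using subgroup.subset[OF P_subgroup] by blast

lemma R_carrier: "r \<in> R \<Longrightarrow> r \<in> carrier G"
  using R_eq P_carrier by blast

lemma R_subgroup: "subgroup R G"
  unfolding R_eq[of False] using subgroups_Inter_pair Q_subgroup P_subgroup by blast

lemma P_iff: "p \<in> carrier G \<Longrightarrow> p \<in> P \<longleftrightarrow> inv g \<otimes> p \<otimes> g \<in> H i"
proof -
  assume p: "p \<in> carrier G"
  have "p = g \<otimes> (inv g \<otimes> p \<otimes> g) \<otimes> inv g" using p g by (simp add: m_assoc mult_inv_cancel)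
  moreover have "inv g \<otimes> (g \<otimes> k \<otimes> inv g) \<otimes> g = k" if "k \<in> H i" for k
    using that H_carrier[OF i] g by (auto simp: m_assoc inv_mult_cancel subset_eq)
  ultimately show ?thesis unfolding P_eq conj_set_eq by (metis (no_types, lifting) image_iff)
qed

definition decomposes :: "nat \<Rightarrow> nat \<Rightarrow> bool \<Rightarrow> bool" where
  "decomposes \<sigma> M b \<longleftrightarrow> (\<forall>k q. k \<in> H i \<and> q \<in> Q b \<and> dist (g \<otimes> k) q \<le> \<sigma> \<longrightarrow>
    (\<exists>r\<in>R. \<exists>s\<in>carrier G. g \<otimes> k = r \<otimes> s \<and> len s \<le> M))"

text \<open>Only finitely many \<open>y\<close> have length at most \<open>\<sigma>\<close>. For each of them, fix one element of \<open>g H\<^sub>i\<close> of the form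
  \<open>q' y\<close> with \<open>q' \<in> Q\<close>, if there is one; any other such element differs from it by a left factor in
  \<open>Q \<inter> P = R\<close>.\<close>

lemma decomposes_exists: "\<exists>M. decomposes \<sigma> M b"
proof -
  define Y where "Y = {y \<in> carrier G. len y \<le> \<sigma>}"
  define c where "c y = (SOME s. \<exists>k\<in>H i. \<exists>q\<in>Q b. s = g \<otimes> k \<and> s = q \<otimes> y)" for y
  \<comment> \<open>For the \<open>y\<close> without such an element the value of \<open>c y\<close> is arbitrary; it may enlarge \<open>M\<close>, which does no harm.\<close>
  define M where "M = Max (insert 0 (len ` c ` Y))"
  have "finite Y" using finite_ball[OF X_finite] by (simp add: Y_def)
  have "\<exists>r\<in>R. \<exists>s\<in>carrier G. g \<otimes> k = r \<otimes> s \<and> len s \<le> M"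
    if k: "k \<in> H i" and q: "q \<in> Q b" and near: "dist (g \<otimes> k) q \<le> \<sigma>" for k q
  proof -
    have kc: "k \<in> carrier G" "q \<in> carrier G" using k q H_carrier[OF i] Q_carrier by auto
    define y where "y = inv q \<otimes> (g \<otimes> k)"
    have y: "y \<in> Y" "g \<otimes> k = q \<otimes> y"
      using near kc g dist_sym[of "g \<otimes> k" q] by (auto simp: y_def Y_def word_dist_def mult_inv_cancel)
    then have yc: "y \<in> carrier G" by (simp add: Y_def)
    have "\<exists>s. \<exists>k\<in>H i. \<exists>q\<in>Q b. s = g \<otimes> k \<and> s = q \<otimes> y" using k q y(2) by blast
    from someI_ex[OF this] obtain k' q' where k': "k' \<in> H i" "q' \<in> Q b" "c y = g \<otimes> k'" "c y = q' \<otimes> y"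
      unfolding c_def[symmetric] by blast
    have k'c: "k' \<in> carrier G" "q' \<in> carrier G" using k' H_carrier[OF i] Q_carrier by auto
    have r: "q \<otimes> inv q' = g \<otimes> (k \<otimes> inv k') \<otimes> inv g"
    proof -
      have "q' \<otimes> y = g \<otimes> k'" using k'(3,4) by simp
      moreover have "q = (q \<otimes> y) \<otimes> inv y" "q' = (q' \<otimes> y) \<otimes> inv y"
        using kc k'c yc by (simp_all add: m_assoc)
      ultimately have "q = (g \<otimes> k) \<otimes> inv y" "q' = (g \<otimes> k') \<otimes> inv y"
        using y(2) by simp_all
      then show ?thesis using g kc k'c yc by (simp add: group_word_simps)
    qed
    have "q \<otimes> inv q' \<in> Q b"
      using q k' subgroup.m_closed[OF Q_subgroup] subgroup.m_inv_closed[OF Q_subgroup] by blast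
    moreover have "k \<otimes> inv k' \<in> H i"
      using k k' subgroup.m_closed[OF H_subgroup[OF i]] subgroup.m_inv_closed[OF H_subgroup[OF i]] by blast
    then have "q \<otimes> inv q' \<in> P" unfolding P_eq conj_set_eq r by blast
    ultimately have "q \<otimes> inv q' \<in> R" using R_eq by blast
    moreover have "g \<otimes> k = (q \<otimes> inv q') \<otimes> c y"
      using k'(4) k'c kc yc y(2) by (simp add: m_assoc inv_mult_cancel)
    moreover have "c y \<in> carrier G" using k'(3) g k'c by simp
    moreover have "len (c y) \<le> M"
      unfolding M_def using \<open>finite Y\<close> y(1) by (intro Max_ge) auto
    ultimately show ?thesis by blast
  qed
  then show ?thesis unfolding decomposes_def by blast
qed

lemma stays_near_exists: "\<exists>\<sigma>. \<forall>b. stays_near (Q b) k \<sigma>"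
proof -
  obtain s t where "stays_near Q\<^sub>1 k s" "stays_near Q\<^sub>2 k t"
    using quasiconvex_stable[OF Q\<^sub>1] quasiconvex_stable[OF Q\<^sub>2] by blast
  then have "stays_near (Q b) k (max s t)" for b
    using stays_near_mono by (cases b) (auto simp: Q_def)
  then show ?thesis by blast
qed

lemma constants_exist:
  "\<exists>\<kappa> \<sigma> M. projection_constant \<kappa> \<and> (\<forall>b. stays_near (Q b) (len g) \<sigma> \<and> decomposes \<sigma> M b)"
proof -
  obtain \<kappa> where \<kappa>: "projection_constant \<kappa>" using projection_constant_exists ..
  obtain \<sigma> where \<sigma>: "\<And>b. stays_near (Q b) (len g) \<sigma>" using stays_near_exists by blast
  obtain M N where "decomposes \<sigma> M True" "decomposes \<sigma> N False" using decomposes_exists by blast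
  then have "decomposes \<sigma> (max M N) b" for b
    by (cases b) (simp_all add: decomposes_def le_max_iff_disj, meson+)
  then show ?thesis using \<kappa> \<sigma> by blast
qed

end

section \<open>The combination\<close>

text \<open>Products of elements of \<open>Q\<^sub>1\<close> and \<open>h Q\<^sub>2 h\<inverse>\<close> for a fixed \<open>h\<close>; the last assumption is the second
  hypothesis on \<open>h\<close> for the constant that is chosen in the end.\<close>

locale combination = parabolic_pair +
  fixes h \<kappa> \<sigma> M
  assumes h: "h \<in> P" and h_conj: "conj_set G h R = R"
    and \<kappa>: "projection_constant \<kappa>"
    and \<sigma>: "stays_near (Q b) (len g) \<sigma>" and M: "decomposes \<sigma> M b"
    and long: "r \<in> R \<Longrightarrow> r' \<in> R \<Longrightarrow> 3 * \<kappa> + 2 * M < len (r \<otimes> h \<otimes> r')"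

sublocale combination \<subseteq> pair: amalgamated_pair G Q\<^sub>1 "conj_set G h Q\<^sub>2" R
proof (intro amalgamated_pair.intro amalgamated_pair_axioms.intro is_group)
  show "subgroup Q\<^sub>1 G" using Q_subgroup[of False] by (simp add: Q_def)
  show "subgroup (conj_set G h Q\<^sub>2) G"
    using conj_set_subgroup Q_subgroup[of True] P_carrier[OF h] by (simp add: Q_def)
  show "subgroup R G" by (rule R_subgroup)
  show "R \<subseteq> Q\<^sub>1" using R\<^sub>1 by blast
  have "conj_set G h R \<subseteq> conj_set G h Q\<^sub>2" using R\<^sub>2 by (auto simp: conj_set_eq)
  then show "R \<subseteq> conj_set G h Q\<^sub>2" using h_conj by simp
qed

context combination begin

text \<open>With this element, the factor \<open>b\<close> is the conjugate of \<open>Q b\<close> by \<open>twist b\<close>, and \<open>t\<close> times the factor is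
  near the coset \<open>t (twist b) (Q b)\<close>.\<close>

definition twist :: "bool \<Rightarrow> 'a" where "twist b = (if b then h else \<one>)"

lemma twist_P: "twist b \<in> P"
  using h subgroup.one_closed[OF P_subgroup] by (simp add: twist_def)

lemma twist_carrier [simp]: "twist b \<in> carrier G"
  using P_carrier twist_P by blast

lemma factor_iff: "x \<in> pair.factor b \<longleftrightarrow> (\<exists>q\<in>Q b. x = twist b \<otimes> q \<otimes> inv (twist b))"
  using Q_carrier[of _ b] unfolding pair.factor_def
  by (cases b) (auto simp: twist_def Q_def conj_set_eq)

lemma factor_Int_P:
  assumes "x \<in> pair.factor b" "x \<in> P" shows "x \<in> R"
proof -
  obtain q where q: "q \<in> Q b" "x = twist b \<otimes> q \<otimes> inv (twist b)" using assms(1) factor_iff by blast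
  have qc: "q \<in> carrier G" using q(1) Q_carrier by blast
  have "q = inv (twist b) \<otimes> x \<otimes> twist b" using q(2) qc by (simp add: m_assoc inv_mult_cancel)
  then have "q \<in> P"
    using assms(2) twist_P subgroup.m_closed[OF P_subgroup] subgroup.m_inv_closed[OF P_subgroup] by metis
  then have "q \<in> R" using q(1) R_eq by blast
  then show ?thesis
  proof (cases b)
    case True
    then have "x \<in> conj_set G h R" using q(2) \<open>q \<in> R\<close> by (auto simp: conj_set_eq twist_def)
    then show ?thesis using h_conj by simp
  next
    case False
    then show ?thesis using q(2) \<open>q \<in> R\<close> qc by (simp add: twist_def)
  qed
qed

definition peripheral :: "'a \<Rightarrow> 'a set" where "peripheral t = (t \<otimes> g) <# H i"

lemma peripheral_coset: "t \<in> carrier G \<Longrightarrow> left_coset i (peripheral t)"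
  unfolding left_coset_def peripheral_def using i g by blast

lemma peripheral_iff:
  assumes "t \<in> carrier G" "v \<in> carrier G"
  shows "v \<in> peripheral t \<longleftrightarrow> inv t \<otimes> v \<otimes> inv g \<in> P"
proof -
  have "v \<in> peripheral t \<longleftrightarrow> inv (t \<otimes> g) \<otimes> v \<in> H i"
  proof -
    have "t \<otimes> g \<in> peripheral t"
      unfolding peripheral_def l_coset_def using assms g subgroup.one_closed[OF H_subgroup[OF i]] by force
    then show ?thesis using left_cosetD(4,5)[OF peripheral_coset[OF assms(1)]] assms(2) by blast
  qed
  also have "\<dots> \<longleftrightarrow> inv t \<otimes> v \<otimes> inv g \<in> P"
    using assms g P_iff[of "inv t \<otimes> v \<otimes> inv g"] by (simp add: group_word_simps)
  finally show ?thesis .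
qed

text \<open>The twist does not change the coset because it belongs to \<open>P\<close>.\<close>

lemma peripheral_base: "t \<in> carrier G \<Longrightarrow> t \<otimes> twist b \<otimes> g \<in> peripheral t"
  using peripheral_iff[of t "t \<otimes> twist b \<otimes> g"] g twist_P[of b] by (simp add: m_assoc inv_mult_cancel)

lemma peripheral_disjoint:
  assumes t: "t \<in> carrier G" "t' \<in> carrier G" "inv t \<otimes> t' \<in> pair.factor b" "inv t \<otimes> t' \<notin> R"
  shows "peripheral t \<inter> peripheral t' = {}"
proof (rule ccontr)
  assume "peripheral t \<inter> peripheral t' \<noteq> {}"
  then obtain v where v: "v \<in> peripheral t" "v \<in> peripheral t'" by blast
  have vc: "v \<in> carrier G" using v(1) left_cosetD(2)[OF peripheral_coset[OF t(1)]] by blast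
  have "inv t \<otimes> v \<otimes> inv g \<in> P" "inv t' \<otimes> v \<otimes> inv g \<in> P" using v t vc peripheral_iff by auto
  then have "(inv t \<otimes> v \<otimes> inv g) \<otimes> inv (inv t' \<otimes> v \<otimes> inv g) \<in> P"
    using subgroup.m_closed[OF P_subgroup] subgroup.m_inv_closed[OF P_subgroup] by blast
  then have "inv t \<otimes> t' \<in> P" using t vc g by (simp add: group_word_simps)
  then show False using factor_Int_P t by blast
qed

text \<open>The constant \<open>\<sigma>\<close> does not depend on \<open>h\<close>, as \<open>v\<close> is compared with a coset of \<open>Q b\<close> and not with one
  of its conjugate.\<close>

definition near :: "'a \<Rightarrow> 'a \<Rightarrow> bool \<Rightarrow> bool" where
  "near v t b \<longleftrightarrow> v \<in> carrier G \<and> (\<exists>w\<in>Q b. dist v (t \<otimes> twist b \<otimes> w) \<le> \<sigma>)"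

lemma near_shift:
  assumes "near v t b" "t \<in> carrier G" "t' \<in> carrier G" "inv t \<otimes> t' \<in> pair.factor b"
  shows "near v t' b"
proof -
  obtain w where w: "w \<in> Q b" "dist v (t \<otimes> twist b \<otimes> w) \<le> \<sigma>" using assms(1) near_def by blast
  obtain q where q: "q \<in> Q b" "inv t \<otimes> t' = twist b \<otimes> q \<otimes> inv (twist b)" using assms(4) factor_iff by blast
  have c: "w \<in> carrier G" "q \<in> carrier G" using w q Q_carrier by auto
  have "t' = t \<otimes> (twist b \<otimes> q \<otimes> inv (twist b))"
    using q(2) assms(2,3) mult_inv_cancel[of t t'] by simp
  then have "t \<otimes> twist b \<otimes> w = t' \<otimes> twist b \<otimes> (inv q \<otimes> w)"
    using c assms(2) by (simp add: group_word_simps)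
  moreover have "inv q \<otimes> w \<in> Q b"
    using w q subgroup.m_closed[OF Q_subgroup] subgroup.m_inv_closed[OF Q_subgroup] by blast
  ultimately show ?thesis using assms(1) w(2) unfolding near_def by metis
qed

lemma near_peripheral:
  assumes "near v t b" "v \<in> peripheral t" "t \<in> carrier G"
  obtains r s where "r \<in> R" "s \<in> carrier G" "v = t \<otimes> twist b \<otimes> r \<otimes> s" "len s \<le> M"
proof -
  obtain w where w: "w \<in> Q b" "dist v (t \<otimes> twist b \<otimes> w) \<le> \<sigma>" using assms(1) near_def by blast
  have vc: "v \<in> carrier G" "w \<in> carrier G" using assms(1) w Q_carrier near_def by auto
  define y where "y = inv (t \<otimes> twist b) \<otimes> v"
  have v: "v = t \<otimes> twist b \<otimes> y" using vc assms(3) by (simp add: y_def group_word_simps)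
  have yc: "y \<in> carrier G" using vc assms(3) by (simp add: y_def)
  have "inv t \<otimes> v \<otimes> inv g \<in> P" using assms peripheral_iff vc by blast
  then have "inv (twist b) \<otimes> (inv t \<otimes> v \<otimes> inv g) \<in> P"
    using twist_P subgroup.m_closed[OF P_subgroup] subgroup.m_inv_closed[OF P_subgroup] by blast
  moreover have "inv (twist b) \<otimes> (inv t \<otimes> v \<otimes> inv g) = y \<otimes> inv g"
    using vc assms(3) g by (simp add: y_def group_word_simps)
  ultimately have "inv g \<otimes> (y \<otimes> inv g) \<otimes> g \<in> H i" using P_iff yc g by simp
  moreover have "inv g \<otimes> (y \<otimes> inv g) \<otimes> g = inv g \<otimes> y" using yc g by (simp add: group_word_simps)
  ultimately have k: "inv g \<otimes> y \<in> H i" by simp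
  have "dist y w \<le> \<sigma>"
    using w(2) dist_translate[of "t \<otimes> twist b" y w] v yc vc assms(3) by simp
  then obtain r s where "r \<in> R" "s \<in> carrier G" "y = r \<otimes> s" "len s \<le> M"
    using M[of b] k w(1) mult_inv_cancel[OF g yc] unfolding decomposes_def by metis
  moreover from this have "r \<in> carrier G" using R_carrier by blast
  ultimately show ?thesis using that[of r s] v assms(3) by (simp add: m_assoc)
qed

text \<open>By \<open>near_peripheral\<close> the difference of the two points is \<open>s\<inverse> r\<inverse> h r' s'\<close>, or the inverse of such a product, with
  \<open>s\<close> and \<open>s'\<close> of length at most \<open>M\<close>.\<close>

lemma far_apart:
  assumes t: "t \<in> carrier G" and v: "near v t b" "v \<in> peripheral t"
    and v': "near v' t (\<not> b)" "v' \<in> peripheral t"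
  shows "3 * \<kappa> < dist v v'"
proof -
  have *: "3 * \<kappa> < dist v v'" if v: "near v t False" "v \<in> peripheral t"
    and v': "near v' t True" "v' \<in> peripheral t" for v v'
  proof -
    obtain r s where r: "r \<in> R" "s \<in> carrier G" "v = t \<otimes> twist False \<otimes> r \<otimes> s" "len s \<le> M"
      using near_peripheral[OF v t] .
    obtain r' s' where r': "r' \<in> R" "s' \<in> carrier G" "v' = t \<otimes> twist True \<otimes> r' \<otimes> s'" "len s' \<le> M"
      using near_peripheral[OF v' t] .
    have c: "r \<in> carrier G" "r' \<in> carrier G" "h \<in> carrier G" using r r' R_carrier P_carrier h by auto
    let ?x = "inv r \<otimes> h \<otimes> r'"
    have x: "?x \<in> carrier G" using c by simp
    have "?x = s \<otimes> (inv v \<otimes> v') \<otimes> inv s'"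
      unfolding r(3) r'(3) twist_def using c r(2) r'(2) t by (simp add: group_word_simps)
    moreover have vv: "inv v \<otimes> v' \<in> carrier G" using v v' by (simp add: near_def)
    ultimately have "len ?x \<le> len s + len (inv v \<otimes> v') + len (inv s')"
      using len_mult_le[of "s \<otimes> (inv v \<otimes> v')" "inv s'"] len_mult_le[of s "inv v \<otimes> v'"] r(2) r'(2) by simp
    moreover have "3 * \<kappa> + 2 * M < len ?x"
      using long[of "inv r" r'] subgroup.m_inv_closed[OF R_subgroup r(1)] r'(1) by simp
    ultimately show ?thesis using r(4) r'(2,4) unfolding word_dist_def by simp
  qed
  show ?thesis
  proof (cases b)
    case True
    have "dist v v' = dist v' v" using v v' dist_sym by (simp add: near_def)
    then show ?thesis using *[of v' v] v v' True by simp
  next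
    case False
    then show ?thesis using *[of v v'] v v' by simp
  qed
qed

definition stations :: "(nat \<Rightarrow> 'a) \<Rightarrow> nat \<Rightarrow> nat \<Rightarrow> 'a set" where
  "stations T n k = (if k = 0 \<or> k = Suc n then {T k} else peripheral (T k))"

text \<open>The segment from the coset of \<open>T j\<close> to that of \<open>T (j + 1)\<close> is a geodesic between points that differ by
  \<open>g\<close> from points of \<open>T j (twist b) (Q b)\<close>. At the two ends of the zigzag the points \<open>T 0\<close> and
  \<open>T (n + 1)\<close> themselves are taken; there \<open>b\<close> is false, as \<open>n\<close> is even, and the twist is trivial.\<close>

lemma zigzag_segment:
  assumes T: "pair.zigzag T n" and j: "j \<le> n"
  obtains f l where "rel.geodesic f l (f 0) (f l)" "f 0 \<in> stations T n j" "f l \<in> stations T n (Suc j)"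
    "\<And>k. k \<le> l \<Longrightarrow> near (f k) (T j) (odd j)"
proof -
  let ?b = "odd j"
  have Tc: "T k \<in> carrier G" if "k \<le> Suc n" for k using T that unfolding pair.zigzag_def by blast
  have Tj: "T j \<in> carrier G" "T (Suc j) \<in> carrier G" using Tc j by auto
  have "inv (T j) \<otimes> T (Suc j) \<in> pair.factor ?b" using T j unfolding pair.zigzag_def by blast
  then obtain q where q: "q \<in> Q ?b" "inv (T j) \<otimes> T (Suc j) = twist ?b \<otimes> q \<otimes> inv (twist ?b)"
    using factor_iff by blast
  have qc: "q \<in> carrier G" using q Q_carrier by blast
  have "T (Suc j) = T j \<otimes> (twist ?b \<otimes> q \<otimes> inv (twist ?b))"
    using q(2) Tj mult_inv_cancel[of "T j" "T (Suc j)"] by simp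
  then have Tq: "T (Suc j) \<otimes> twist ?b = T j \<otimes> twist ?b \<otimes> q" using Tj(1) qc by (simp add: group_word_simps)
  define a where "a = (if j = 0 then T j else T j \<otimes> twist ?b \<otimes> g)"
  define c where "c = (if j = n then T (Suc j) else T (Suc j) \<otimes> twist ?b \<otimes> g)"
  have ac: "a \<in> carrier G" "c \<in> carrier G" using Tj g by (auto simp: a_def c_def)
  have even_n: "even n" using T unfolding pair.zigzag_def by blast
  have one: "\<one> \<in> Q ?b" using subgroup.one_closed[OF Q_subgroup] .
  have "dist a (T j \<otimes> twist ?b \<otimes> \<one>) \<le> len g"
  proof (cases "j = 0")
    case True
    then show ?thesis using Tj by (simp add: a_def twist_def)
  next
    case False
    then show ?thesis
      using Tj g dist_mult_right[of "T j \<otimes> twist ?b" g] dist_sym[of a "T j \<otimes> twist ?b"] ac by (simp add: a_def)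
  qed
  moreover have "dist c (T j \<otimes> twist ?b \<otimes> q) \<le> len g"
  proof (cases "j = n")
    case True
    then show ?thesis using even_n Tq Tj by (simp add: c_def twist_def)
  next
    case False
    then show ?thesis
      using Tj g dist_mult_right[of "T (Suc j) \<otimes> twist ?b" g] dist_sym[of c "T (Suc j) \<otimes> twist ?b"] ac
      unfolding Tq[symmetric] by (simp add: c_def)
  qed
  moreover obtain f where f: "rel.geodesic f (d a c) a c" using rel.geodesic_exists ac .
  ultimately have "near (f k) (T j) ?b" if "k \<le> d a c" for k
    using stays_nearD[OF \<sigma> f _ one q(1) _ _ that] rel.geodesicD(3)[OF f that] Tj
    unfolding near_def by simp
  moreover have "a \<in> stations T n j"
    using peripheral_base[OF Tj(1)] j by (auto simp: a_def stations_def)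
  moreover have "c \<in> stations T n (Suc j)"
    using peripheral_base[OF Tj(2)] by (auto simp: c_def stations_def)
  ultimately show ?thesis using that[of f "d a c"] f rel.geodesicD(1,2)[OF f] by simp
qed

text \<open>The segment before \<open>C\<^sub>k\<close> provides the entry \<open>p k\<close> and the segment after it the entry \<open>q k\<close>. As they
  belong to different factors, \<open>far_apart\<close> applies.\<close>

lemma zigzag_chain:
  assumes T: "pair.zigzag T n"
  obtains p q where "chain \<kappa> i (stations T n) n p q"
    "\<And>k. k \<in> {1..n} \<Longrightarrow> near (p k) (T (k - 1)) (odd (k - 1)) \<and> near (q k) (T k) (odd k)"
proof -
  let ?S = "stations T n"
  have Tc: "T k \<in> carrier G" if "k \<le> Suc n" for k using T that unfolding pair.zigzag_def by blast
  have S: "?S k = peripheral (T k)" if "k \<in> {1..n}" for k using that by (auto simp: stations_def)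
  have "\<exists>p. (\<exists>u\<in>?S (k - 1). entry (?S k) u p) \<and> near p (T (k - 1)) (odd (k - 1))" if k: "k \<in> {1..n}" for k
  proof -
    have "k - 1 \<le> n" "Suc (k - 1) = k" using k by auto
    then obtain f l where f: "rel.geodesic f l (f 0) (f l)" "f 0 \<in> ?S (k - 1)" "f l \<in> ?S k"
      "\<And>j. j \<le> l \<Longrightarrow> near (f j) (T (k - 1)) (odd (k - 1))"
      using zigzag_segment[OF T, of "k - 1"] by metis
    show ?thesis by (rule first_entry[OF f(1) order_refl f(3)]) (use f(2,4) in blast)
  qed
  then obtain p where p: "\<And>k. k \<in> {1..n} \<Longrightarrow> (\<exists>u\<in>?S (k - 1). entry (?S k) u (p k)) \<and> near (p k) (T (k - 1)) (odd (k - 1))"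
    by metis
  have "\<exists>q. (\<exists>u\<in>?S (Suc k). entry (?S k) u q) \<and> near q (T k) (odd k)" if k: "k \<in> {1..n}" for k
  proof -
    have "k \<le> n" using k by auto
    then obtain f l where f: "rel.geodesic f l (f 0) (f l)" "f 0 \<in> ?S k" "f l \<in> ?S (Suc k)"
      "\<And>j. j \<le> l \<Longrightarrow> near (f j) (T k) (odd k)"
      using zigzag_segment[OF T, of k] by metis
    show ?thesis by (rule last_entry[OF f(1) le0 f(2)]) (use f(3,4) in blast)
  qed
  then obtain q where q: "\<And>k. k \<in> {1..n} \<Longrightarrow> (\<exists>u\<in>?S (Suc k). entry (?S k) u (q k)) \<and> near (q k) (T k) (odd k)"
    by metis
  have "chain \<kappa> i ?S n p q"
    unfolding chain_def
  proof (intro conjI ballI)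
    show "is_singleton (?S 0)" "is_singleton (?S (Suc n))" by (simp_all add: stations_def)
    show "left_coset i (?S k)" if "k \<in> {1..n}" for k
      using S[OF that] peripheral_coset Tc that by simp
    show "?S k \<inter> ?S (Suc k) = {}" if k: "k \<in> {1..<n}" for k
    proof -
      have "inv (T k) \<otimes> T (Suc k) \<in> pair.factor (odd k)" "inv (T k) \<otimes> T (Suc k) \<notin> R"
        using T k unfolding pair.zigzag_def by auto
      moreover have "T k \<in> carrier G" "T (Suc k) \<in> carrier G" using Tc k by auto
      moreover have "k \<in> {1..n}" "Suc k \<in> {1..n}" using k by auto
      ultimately show ?thesis using S peripheral_disjoint by metis
    qed
    show "\<exists>u\<in>?S (k - 1). entry (?S k) u (p k)" "\<exists>u\<in>?S (Suc k). entry (?S k) u (q k)" if "k \<in> {1..n}" for k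
      using p[OF that] q[OF that] by auto
    show "3 * \<kappa> < dist (p k) (q k)" if k: "k \<in> {1..n}" for k
    proof -
      have c: "T (k - 1) \<in> carrier G" "T k \<in> carrier G" using Tc k by auto
      have "k - 1 \<le> n" "Suc (k - 1) = k" using k by auto
      then have "inv (T (k - 1)) \<otimes> T k \<in> pair.factor (odd (k - 1))" using T unfolding pair.zigzag_def by metis
      then have "near (p k) (T k) (odd (k - 1))" using near_shift p[OF k] c by blast
      moreover have "near (q k) (T k) (\<not> odd (k - 1))" using q[OF k] k by (cases k) auto
      moreover have "p k \<in> peripheral (T k)" "q k \<in> peripheral (T k)"
        using p[OF k] q[OF k] S[OF k] entry_carrier by blast+
      ultimately show ?thesis using far_apart[OF c(2)] by blast
    qed
  qed
  then show ?thesis using that p q by blast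
qed

lemma zigzag_length:
  assumes T: "pair.zigzag T n"
  shows "n \<le> d (T 0) (T (Suc n))"
proof -
  obtain p q where "chain \<kappa> i (stations T n) n p q" using zigzag_chain[OF T] by blast
  then show ?thesis
    using T chain_length[OF \<kappa>, of i "stations T n" n p q "T 0" "T (Suc n)"]
    by (simp add: stations_def pair.zigzag_def)
qed

lemma reduced_length:
  assumes "pair.reduced k b c x"
  shows "k \<le> Suc (rel.len x)"
proof -
  obtain T n where T: "pair.zigzag T n" "T 0 = \<one>" "T (Suc n) = \<one> \<otimes> x" "k \<le> Suc n"
    using pair.zigzag_reduced[OF assms one_closed] .
  have "d \<one> (\<one> \<otimes> x) = rel.len x" using pair.reduced_carrier[OF assms] by (simp add: word_dist_def)
  then show ?thesis using zigzag_length[OF T(1)] T(2-) by simp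
qed

lemma one_not_reduced: "\<not> pair.reduced k b c \<one>"
proof
  assume red: "pair.reduced k b c \<one>"
  then have "k \<le> 1" using reduced_length[OF red] by simp
  from red show False
    by (rule pair.reduced_head) (use \<open>k \<le> 1\<close> subgroup.one_closed[OF R_subgroup] in auto)
qed

text \<open>Each vertex of a geodesic lies in a piece whose ends are near a coset of \<open>Q b\<close>. This coset is
  contained in \<open>J (twist b)\<close>, so it is within \<open>len h\<close> of \<open>J\<close>.\<close>

lemma generated_quasiconvex: "relatively_quasiconvex G X H m pair.generated"
proof -
  obtain \<tau> where \<tau>: "\<And>b. stays_near (Q b) (\<kappa> + \<sigma>) \<tau>" using stays_near_exists by blast
  let ?J = pair.generated and ?N = "\<tau> + len h"
  have Jc: "x \<in> carrier G" if "x \<in> ?J" for x using that subgroup.subset[OF pair.generated_subgroup] by blast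
  have hc: "h \<in> carrier G" using h P_carrier by blast
  have near_J: "\<exists>w\<in>?J. dist (f j) w \<le> ?N"
    if f: "rel.geodesic f l x z" and x: "x \<in> ?J" and z: "z \<in> ?J" and j: "j \<le> l" for f l x z j
  proof -
    have "inv x \<otimes> z \<in> ?J"
      using x z subgroup.m_closed[OF pair.generated_subgroup] subgroup.m_inv_closed[OF pair.generated_subgroup] by blast
    then obtain T n where T: "pair.zigzag T n" "T 0 = x" "T (Suc n) = z"
      using pair.zigzag_generated[of "inv x \<otimes> z" x] Jc[OF x] Jc[OF z] by (metis mult_inv_cancel)
    have Tc: "T k \<in> carrier G" if "k \<le> Suc n" for k using T(1) that unfolding pair.zigzag_def by blast
    obtain p q where ch: "chain \<kappa> i (stations T n) n p q" and
      pq: "\<And>k. k \<in> {1..n} \<Longrightarrow> near (p k) (T (k - 1)) (odd (k - 1)) \<and> near (q k) (T k) (odd k)"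
      using zigzag_chain[OF T(1)] by blast
    obtain k a c where k: "k \<le> n" "a \<le> j" "j \<le> c" "c \<le> l"
      "k = 0 \<and> a = 0 \<or> 1 \<le> k \<and> dist (f a) (q k) \<le> \<kappa>"
      "k = n \<and> c = l \<or> k < n \<and> dist (f c) (p (Suc k)) \<le> \<kappa>"
      using chain_covering[OF \<kappa> ch _ _ f j] T(2,3) by (auto simp: stations_def)
    let ?b = "odd k"
    let ?u = "T k \<otimes> twist ?b"
    have fc: "f a \<in> carrier G" "f c \<in> carrier G" "f j \<in> carrier G"
      using rel.geodesicD(3)[OF f] k by auto
    have uc: "T k \<in> carrier G" "?u \<in> carrier G" "T (Suc k) \<in> carrier G" using Tc k(1) by auto
    have close: "\<exists>w\<in>Q ?b. dist v (?u \<otimes> w) \<le> \<kappa> + \<sigma>"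
      if v: "v \<in> carrier G" "near v' (T k) ?b" "dist v v' \<le> \<kappa>" for v v'
    proof -
      obtain w where w: "w \<in> Q ?b" "dist v' (?u \<otimes> w) \<le> \<sigma>" "v' \<in> carrier G" using v(2) near_def by blast
      have "w \<in> carrier G" using w(1) Q_carrier by blast
      then have "dist v (?u \<otimes> w) \<le> dist v v' + dist v' (?u \<otimes> w)" using dist_triangle v(1) w(3) uc by simp
      then show ?thesis using w v(3) by (meson add_mono order_trans)
    qed
    have start: "\<exists>w\<in>Q ?b. dist (f a) (?u \<otimes> w) \<le> \<kappa> + \<sigma>"
      using k(5)
    proof (elim disjE conjE)
      assume "k = 0" "a = 0"
      then have "f a = ?u \<otimes> \<one>" using rel.geodesicD(1)[OF f] T(2) uc by (simp add: twist_def)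
      then show ?thesis using subgroup.one_closed[OF Q_subgroup] uc by force
    next
      assume "1 \<le> k" "dist (f a) (q k) \<le> \<kappa>"
      then show ?thesis using close[of "f a" "q k"] pq[of k] k(1) fc(1) by simp
    qed
    have stop: "\<exists>w\<in>Q ?b. dist (f c) (?u \<otimes> w) \<le> \<kappa> + \<sigma>"
      using k(6)
    proof (elim disjE conjE)
      assume kn: "k = n" "c = l"
      have "inv (T k) \<otimes> T (Suc k) \<in> pair.factor ?b" "\<not> ?b" using T(1) kn unfolding pair.zigzag_def by auto
      then have "inv (T k) \<otimes> T (Suc k) \<in> Q ?b" "twist ?b = \<one>" by (auto simp: pair.factor_def Q_def twist_def)
      moreover have "f c = ?u \<otimes> (inv (T k) \<otimes> T (Suc k))"
        using rel.geodesicD(2)[OF f] T(3) kn uc \<open>twist ?b = \<one>\<close> by (simp add: mult_inv_cancel)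
      ultimately show ?thesis using fc(2) by (metis dist_refl le0)
    next
      assume "k < n" "dist (f c) (p (Suc k)) \<le> \<kappa>"
      then show ?thesis using close[of "f c" "p (Suc k)"] pq[of "Suc k"] fc(2) by simp
    qed
    have "rel.geodesic (\<lambda>j. f (a + j)) (c - a) (f a) (f c)" using rel.geodesic_sub[OF f] k by simp
    moreover obtain w0 where "w0 \<in> Q ?b" "dist (f a) (?u \<otimes> w0) \<le> \<kappa> + \<sigma>" using start by blast
    moreover obtain w1 where "w1 \<in> Q ?b" "dist (f c) (?u \<otimes> w1) \<le> \<kappa> + \<sigma>" using stop by blast
    moreover have "j - a \<le> c - a" "a + (j - a) = j" using k(2,3) by auto
    ultimately obtain w where w: "w \<in> Q ?b" "dist (f j) (?u \<otimes> w) \<le> \<tau>"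
      using stays_nearD[OF \<tau>[of ?b], of "\<lambda>j. f (a + j)" "c - a" "f a" "f c" ?u w0 w1 "j - a"] uc(2) by auto
    have wc: "w \<in> carrier G" using w(1) Q_carrier by blast
    have "twist ?b \<otimes> w \<otimes> inv (twist ?b) \<in> ?J" using pair.factor_generated factor_iff w(1) by blast
    moreover have "T k \<in> ?J" using pair.zigzag_in_generated[OF T(1)] T(2) x k(1) by simp
    ultimately have J: "T k \<otimes> (twist ?b \<otimes> w \<otimes> inv (twist ?b)) \<in> ?J"
      using subgroup.m_closed[OF pair.generated_subgroup] by blast
    let ?v = "T k \<otimes> (twist ?b \<otimes> w \<otimes> inv (twist ?b))"
    have "?v = ?u \<otimes> w \<otimes> inv (twist ?b)" using uc wc by (simp add: m_assoc)
    then have "dist (?u \<otimes> w) ?v = len (twist ?b)" using dist_mult_right uc wc by simp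
    moreover have "len (twist ?b) \<le> len h" by (simp add: twist_def)
    moreover have "dist (f j) ?v \<le> dist (f j) (?u \<otimes> w) + dist (?u \<otimes> w) ?v"
      using dist_triangle fc(3) uc wc by simp
    ultimately have "dist (f j) ?v \<le> ?N" using w(2) by linarith
    then show ?thesis using J by blast
  qed
  have "quasiconvex G X H m (real ?N) ?J"
    unfolding quasiconvex_def
  proof (intro ballI allI impI, elim conjE)
    fix x z p k
    assume x: "x \<in> ?J" and z: "z \<in> ?J" and p: "geodesic_path G X H m p" "path_start G p = x" "path_end G p = z"
      and k: "k \<le> path_length p"
    have "rel.geodesic (path_vertex G p) (path_length p) x z" using geodesic_path_geodesic[OF p(1)] p(2,3) by simp
    from near_J[OF this x z k] show "\<exists>w\<in>?J. real (dist (path_vertex G p k) w) \<le> real ?N"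
      unfolding of_nat_le_iff .
  qed
  then show ?thesis unfolding relatively_quasiconvex_def using pair.generated_subgroup of_nat_0_le_iff by blast
qed

text \<open>A conjugate of \<open>K\<close> is contained in some \<open>H j\<close>, whose elements have relative length at most one.\<close>

lemma parabolic_in_factor:
  assumes K: "parabolic G H m K" "K \<subseteq> pair.generated"
  shows "\<exists>u\<in>pair.generated. conj_set G u K \<subseteq> Q\<^sub>1 \<or> conj_set G u K \<subseteq> conj_set G h Q\<^sub>2"
proof -
  obtain a j where Ks: "subgroup K G" and a: "a \<in> carrier G" and j: "j \<in> {1..m}" "conj_set G a K \<subseteq> H j"
    using K(1) unfolding parabolic_def by blast
  have "k \<le> 2 * rel.len a + 2" if x: "x \<in> K" "pair.reduced k b c x" for x k b c
  proof -
    have xc: "x \<in> carrier G" using x(1) subgroup.subset[OF Ks] by blast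
    define y where "y = a \<otimes> x \<otimes> inv a"
    have y: "y \<in> H j" "y \<in> carrier G" using j(2) x(1) a xc by (auto simp: y_def conj_set_eq)
    have "rel.len y \<le> 1" using d_le_1_H[OF j(1), of \<one> y] y by (simp add: word_dist_def)
    moreover have "x = inv a \<otimes> y \<otimes> a" using a xc by (simp add: y_def group_word_simps)
    ultimately have "rel.len x \<le> 2 * rel.len a + 1"
      using rel.len_mult_le[of "inv a \<otimes> y" a] rel.len_mult_le[of "inv a" y] a y(2) by simp
    then show ?thesis using reduced_length[OF x(2)] by simp
  qed
  then obtain u b where "u \<in> pair.generated" "conj_set G u K \<subseteq> pair.factor b"
    using pair.bounded_subgroup_in_factor[OF one_not_reduced Ks K(2)] by blast
  then show ?thesis by (cases b) (auto simp: pair.factor_def)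
qed

end

text \<open>A parabolic subgroup is contained in a conjugate of some \<open>H i\<close>, which is parabolic as well.\<close>

lemma (in group) maximal_parabolic_conjugate:
  assumes H: "\<forall>i\<in>{1..m}. subgroup (H i) G" and P: "maximal_parabolic G H m P"
  obtains g i where "g \<in> carrier G" "i \<in> {1..m}" "P = conj_set G g (H i)"
proof -
  obtain a i where a: "subgroup P G" "a \<in> carrier G" "i \<in> {1..m}" "conj_set G a P \<subseteq> H i"
    using P unfolding maximal_parabolic_def parabolic_def by blast
  note Hi = H[rule_format, OF a(3)]
  let ?P = "conj_set G (inv a) (H i)"
  have "x \<in> ?P" if "x \<in> P" for x
  proof -
    have "x \<in> carrier G" using that subgroup.subset[OF a(1)] by blast
    then have "x = inv a \<otimes> (a \<otimes> x \<otimes> inv a) \<otimes> inv (inv a)" using a(2) by (simp add: group_word_simps)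
    moreover have "a \<otimes> x \<otimes> inv a \<in> H i" using a(4) that by (auto simp: conj_set_eq)
    ultimately show ?thesis unfolding conj_set_eq by blast
  qed
  moreover have "conj_set G a ?P = H i"
    using a(2) subgroup.subset[OF Hi] unfolding conj_set_eq image_image
    by (simp add: group_word_simps subset_eq)
  then have "\<exists>g\<in>carrier G. \<exists>i\<in>{1..m}. conj_set G g ?P \<subseteq> H i" using a(2,3) by blast
  then have "parabolic G H m ?P"
    using conj_set_subgroup[OF Hi] a(2) unfolding parabolic_def by simp
  ultimately have "P = ?P" using P unfolding maximal_parabolic_def by blast
  then show ?thesis using that a by blast
qed

theorem theorem1p2:
  fixes G :: "('a, 'b) monoid_scheme"
    and X :: "'a set"
    and H :: "nat \<Rightarrow> 'a set"
    and m :: nat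
    and Q\<^sub>1 Q\<^sub>2 P R :: "'a set"
  assumes "group G"
    and "finite X" and "X \<subseteq> carrier G" and "\<forall>x\<in>X. inv\<^bsub>G\<^esub> x \<in> X" and "generate G X = carrier G"
    and "\<forall>i\<in>{1..m}. subgroup (H i) G"
    and "relatively_hyperbolic G X H m"
    and "relatively_quasiconvex G X H m Q\<^sub>1"
    and "relatively_quasiconvex G X H m Q\<^sub>2"
    and "maximal_parabolic G H m P"
    and "R = Q\<^sub>1 \<inter> P" and "R = Q\<^sub>2 \<inter> P"
  shows "\<exists>C::real. C \<ge> 0 \<and>
    (\<forall>h\<in>P. conj_set G h R = R \<and>
           (\<forall>g \<in> R #>\<^bsub>G\<^esub> h <#>\<^bsub>G\<^esub> R. real (word_length G X g) \<ge> C) \<longrightarrow>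
      (let Q\<^sub>2h = conj_set G h Q\<^sub>2;
           A = amalgam (G\<lparr>carrier := Q\<^sub>1\<rparr>) (G\<lparr>carrier := Q\<^sub>2h\<rparr>) R;
           \<phi> = amalgam_lift G (\<lambda>x. x) (\<lambda>x. x);
           J = generate G (Q\<^sub>1 \<union> Q\<^sub>2h)
       in \<phi> \<in> hom A G \<and> inj_on \<phi> (carrier A) \<and> \<phi> ` carrier A = J \<and>
          relatively_quasiconvex G X H m J \<and>
          (\<forall>K. parabolic G H m K \<and> K \<subseteq> J \<longrightarrow>
             (\<exists>u\<in>J. conj_set G u K \<subseteq> Q\<^sub>1 \<or> conj_set G u K \<subseteq> Q\<^sub>2h))))"
proof -
  interpret group G by fact
  obtain g i where g: "g \<in> carrier G" "i \<in> {1..m}" "P = conj_set G g (H i)"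
    using maximal_parabolic_conjugate[OF assms(6,10)] .
  interpret parabolic_pair G X H m i g Q\<^sub>1 Q\<^sub>2 P R
    by (intro parabolic_pair.intro relatively_hyperbolic_group.intro relative_cayley.intro
        word_metric.intro parabolic_pair_axioms.intro relatively_hyperbolic_group_axioms.intro
        relative_cayley_axioms.intro word_metric_axioms.intro)
      (use assms g in blast)+
  obtain \<kappa> \<sigma> M where c: "projection_constant \<kappa>"
    "\<And>b. stays_near (Q b) (word_length G X g) \<sigma>" "\<And>b. decomposes \<sigma> M b"
    using constants_exist by blast
  \<comment> \<open>A jump loses at most \<open>2 M\<close> at its ends, and chains require jumps of length more than \<open>3 \<kappa>\<close>.\<close>
  define C where "C = 3 * \<kappa> + 2 * M + 1"
  show ?thesis
  proof (intro exI[of _ "real C"] conjI ballI impI)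
    show "0 \<le> real C" by simp
    fix h
    assume h: "h \<in> P" and *: "conj_set G h R = R \<and>
           (\<forall>g \<in> R #>\<^bsub>G\<^esub> h <#>\<^bsub>G\<^esub> R. real (word_length G X g) \<ge> real C)"
    have long: "3 * \<kappa> + 2 * M < word_length G X (r \<otimes>\<^bsub>G\<^esub> h \<otimes>\<^bsub>G\<^esub> r')" if "r \<in> R" "r' \<in> R" for r r'
    proof -
      have "r \<otimes>\<^bsub>G\<^esub> h \<otimes>\<^bsub>G\<^esub> r' \<in> R #>\<^bsub>G\<^esub> h <#>\<^bsub>G\<^esub> R"
        using that unfolding set_mult_def r_coset_def by blast
      then have "real (word_length G X (r \<otimes>\<^bsub>G\<^esub> h \<otimes>\<^bsub>G\<^esub> r')) \<ge> real C" using * by blast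
      then show ?thesis by (simp add: C_def)
    qed
    interpret combination G X H m i g Q\<^sub>1 Q\<^sub>2 P R h \<kappa> \<sigma> M
      by unfold_locales (use h * c long in \<open>blast+\<close>)
    show "let Q\<^sub>2h = conj_set G h Q\<^sub>2;
           A = amalgam (G\<lparr>carrier := Q\<^sub>1\<rparr>) (G\<lparr>carrier := Q\<^sub>2h\<rparr>) R;
           \<phi> = amalgam_lift G (\<lambda>x. x) (\<lambda>x. x);
           J = generate G (Q\<^sub>1 \<union> Q\<^sub>2h)
       in \<phi> \<in> hom A G \<and> inj_on \<phi> (carrier A) \<and> \<phi> ` carrier A = J \<and>
          relatively_quasiconvex G X H m J \<and>
          (\<forall>K. parabolic G H m K \<and> K \<subseteq> J \<longrightarrow>
             (\<exists>u\<in>J. conj_set G u K \<subseteq> Q\<^sub>1 \<or> conj_set G u K \<subseteq> Q\<^sub>2h))"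
      unfolding Let_def
      using pair.lift_hom pair.lift_inj[OF one_not_reduced] pair.lift_image generated_quasiconvex
        parabolic_in_factor by blast
  qed
qed

end
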